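(* Let $\mathcal M=(M,<,\ldots)$ be a definably complete locally o-minimal structure having property (a) (the image of a nonempty definable discrete set under a coordinate projection is again discrete). Then the following assertions hold. (1) Let $X\subseteq Y$ be definable sets. Then $\dim(X)\le\dim(Y)$. (2) Let $\sigma$ be a permutation of $\{1,\ldots,n\}$ and let $\overline{\sigma}:M^n\to M^n$ be defined by $\overline{\sigma}(x_1,\ldots,x_n)=(x_{\sigma(1)},\ldots,x_{\sigma(n)})$. Then $\dim(X)=\dim(\overline{\sigma}(X))$ for any definable subset $X$ of $M^n$. (3) Let $X$ and $Y$ be definable sets. Then $\dim(X\times Y)=\dim(X)+\dim(Y)$. (4) Let $X$ and $Y$ be definable subsets of $M^n$. Then $\dim(X\cup Y)=\max\{\dim(X),\dim(Y)\}$. (5) Let $f:X\to M^n$ be a definable map. Then $\dim(f(X))\le\dim X$. (6) Let $f:X\to M^n$ be a definable map, and let $\mathcal D(f)$ denote the set of points at which $f$ is discontinuous. Then $\dim(\mathcal D(f))<\dim X$. (7) Let $X$ be a definable set, and let $\partial X=\overline{X}\setminus X$ denote its frontier. Then $\dim(\partial X)<\dim X$.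
   Context: "Definable" means definable in $\mathcal M$ with parameters; a definable set is a definable subset of some $M^n$, and the domain $X$ of a definable map is a definable set. $M$ carries the order topology and $M^n$ the product topology ($M^0$ is a single point); $\overline{X}$ denotes the closure of $X$. An open interval is a set $(a,b)=\{x\in M\mid a<x<b\}$ with $a,b\in M$. A coordinate projection $M^n\to M^d$ is a map $(x_1,\ldots,x_n)\mapsto(x_{i_1},\ldots,x_{i_d})$ with $1\le i_1<\cdots<i_d\le n$. A set is discrete if its subspace topology is discrete. A densely linearly ordered structure without endpoints $\mathcal M=(M,<,\ldots)$ is locally o-minimal if for every definable $X\subseteq M$ and every $a\in M$ there is an open interval $I$ containing $a$ such that $X\cap I$ is a finite union of points and open intervals. It is definably complete if every definable subset of $M$ has a supremum and an infimum in $M\cup\{\pm\infty\}$. Dimension: for a nonempty definable $X\subseteq M^n$, $\dim X$ is the maximal nonnegative integer $d$ such that $\pi(X)$ has a nonempty interior for some coordinate projection $\pi:M^n\to M^d$; one sets $\dim\emptyset=-\infty$.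
   Formalization: In (6) and (7) the definable set X is assumed nonempty, because for X empty the strict inequalities would read −∞ < −∞ under the convention dim ∅ = −∞, which is false. *)

theory Defs
  imports "HOL-Analysis.Analysis" "HOL-Library.Extended" "HOL-Library.Lub_Glb"
    "HOL-Combinatorics.Permutations"
begin

section \<open>First-order structures expanding a linear order\<close>

text \<open>
  The underlying set of the structure is the whole type \<open>'a\<close>, and the order is that of the type.
  Function and relation symbols are interpreted on argument lists of every length; thus a symbol
  together with a length plays the role of a symbol with a fixed arity (constants are function
  symbols applied to the empty list), and every first-order language is covered.
\<close>

record ('f, 'r, 'a) fo_struct =
  fun_of :: "'f \<Rightarrow> 'a list \<Rightarrow> 'a"
  rel_of :: "'r \<Rightarrow> 'a list \<Rightarrow> bool"

datatype 'f fo_term = Var nat | App 'f "'f fo_term list"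

datatype ('f, 'r) fo_form =
    Equal "'f fo_term" "'f fo_term"
  | Less "'f fo_term" "'f fo_term"
  | Rel 'r "'f fo_term list"
  | Neg "('f, 'r) fo_form"
  | Conj "('f, 'r) fo_form" "('f, 'r) fo_form"
  | Exi nat "('f, 'r) fo_form"

primrec eval_term :: "('f, 'r, 'a) fo_struct \<Rightarrow> (nat \<Rightarrow> 'a) \<Rightarrow> 'f fo_term \<Rightarrow> 'a" where
  "eval_term S e (Var i) = e i"
| "eval_term S e (App f ts) = fun_of S f (map (eval_term S e) ts)"

primrec sat :: "('f, 'r, 'a::linorder) fo_struct \<Rightarrow> (nat \<Rightarrow> 'a) \<Rightarrow> ('f, 'r) fo_form \<Rightarrow> bool" where
  "sat S e (Equal s t) \<longleftrightarrow> eval_term S e s = eval_term S e t"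
| "sat S e (Less s t) \<longleftrightarrow> eval_term S e s < eval_term S e t"
| "sat S e (Rel r ts) \<longleftrightarrow> rel_of S r (map (eval_term S e) ts)"
| "sat S e (Neg \<phi>) \<longleftrightarrow> \<not> sat S e \<phi>"
| "sat S e (Conj \<phi> \<psi>) \<longleftrightarrow> sat S e \<phi> \<and> sat S e \<psi>"
| "sat S e (Exi i \<phi>) \<longleftrightarrow> (\<exists>a. sat S (e(i := a)) \<phi>)"


section \<open>Cartesian powers\<close>

text \<open>
  A point of \<open>M\<^sup>n\<close> is an extensional function on \<open>{..<n}\<close>; coordinates are numbered from \<open>0\<close>.
  An extensional function does not determine \<open>n\<close>, so the exponent is an explicit argument
  of the notions below.
\<close>

definition cart_pow :: "nat \<Rightarrow> (nat \<Rightarrow> 'a) set" where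
  "cart_pow n = {..<n} \<rightarrow>\<^sub>E UNIV"

definition pow_top :: "nat \<Rightarrow> (nat \<Rightarrow> 'a::linorder_topology) topology" where
  "pow_top n = product_topology (\<lambda>_. euclidean) {..<n}"

definition append_pt :: "nat \<Rightarrow> nat \<Rightarrow> (nat \<Rightarrow> 'a) \<Rightarrow> (nat \<Rightarrow> 'a) \<Rightarrow> nat \<Rightarrow> 'a" where
  "append_pt m n x y = (\<lambda>i\<in>{..<m + n}. if i < m then x i else y (i - m))"

definition set_prod :: "nat \<Rightarrow> nat \<Rightarrow> (nat \<Rightarrow> 'a) set \<Rightarrow> (nat \<Rightarrow> 'a) set \<Rightarrow> (nat \<Rightarrow> 'a) set" where
  "set_prod m n X Y = {append_pt m n x y | x y. x \<in> X \<and> y \<in> Y}"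

text \<open>
  Both coordinate projections \<open>M\<^sup>n \<rightarrow> M\<^sup>d\<close> (for strictly increasing \<open>\<iota>\<close>) and
  permutations of coordinates are of the following form.
\<close>

definition coord_map :: "nat \<Rightarrow> (nat \<Rightarrow> nat) \<Rightarrow> (nat \<Rightarrow> 'a) \<Rightarrow> nat \<Rightarrow> 'a" where
  "coord_map d \<iota> x = (\<lambda>k\<in>{..<d}. x (\<iota> k))"

definition proj_index :: "nat \<Rightarrow> nat \<Rightarrow> (nat \<Rightarrow> nat) \<Rightarrow> bool" where
  "proj_index n d \<iota> \<longleftrightarrow> \<iota> ` {..<d} \<subseteq> {..<n} \<and> strict_mono_on {..<d} \<iota>"


section \<open>Definable sets and maps\<close>

text \<open>
  Variables \<open>0, \<dots>, n - 1\<close> stand for the coordinates; the assignment \<open>e\<close> supplies the (finitely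
  many relevant) parameters through the remaining variables.
\<close>

definition definable :: "('f, 'r, 'a::linorder) fo_struct \<Rightarrow> nat \<Rightarrow> (nat \<Rightarrow> 'a) set \<Rightarrow> bool" where
  "definable S n X \<longleftrightarrow>
     (\<exists>\<phi> e. X = {x \<in> cart_pow n. sat S (override_on e x {..<n}) \<phi>})"

definition definable1 :: "('f, 'r, 'a::linorder) fo_struct \<Rightarrow> 'a set \<Rightarrow> bool" where
  "definable1 S X \<longleftrightarrow> definable S 1 {x \<in> cart_pow 1. x 0 \<in> X}"

definition definable_map ::
  "('f, 'r, 'a::linorder) fo_struct \<Rightarrow> nat \<Rightarrow> nat \<Rightarrow> (nat \<Rightarrow> 'a) set
     \<Rightarrow> ((nat \<Rightarrow> 'a) \<Rightarrow> nat \<Rightarrow> 'a) \<Rightarrow> bool" where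
  "definable_map S m n X f \<longleftrightarrow>
     definable S m X \<and> f ` X \<subseteq> cart_pow n \<and>
     definable S (m + n) {append_pt m n x (f x) | x. x \<in> X}"


section \<open>Tameness conditions\<close>

definition locally_o_minimal ::
  "('f, 'r, 'a::unbounded_dense_linorder) fo_struct \<Rightarrow> bool" where
  "locally_o_minimal S \<longleftrightarrow>
     (\<forall>X a. definable1 S X \<longrightarrow>
        (\<exists>b c. a \<in> {b<..<c} \<and>
           (\<exists>F G. finite F \<and> finite G \<and> (\<forall>J\<in>G. \<exists>u v. J = {u<..<v}) \<and>
                  X \<inter> {b<..<c} = F \<union> \<Union>G)))"

text \<open>The type \<open>'a extended\<close> is \<open>M \<union> {\<plusminus>\<infinity>}\<close>.\<close>

definition definably_complete ::
  "('f, 'r, 'a::linorder) fo_struct \<Rightarrow> bool" where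
  "definably_complete S \<longleftrightarrow>
     (\<forall>X. definable1 S X \<longrightarrow>
        (\<exists>s :: 'a extended. isLub UNIV (Fin ` X) s) \<and>
        (\<exists>i :: 'a extended. isGlb UNIV (Fin ` X) i))"

definition discrete_set :: "nat \<Rightarrow> (nat \<Rightarrow> 'a::linorder_topology) set \<Rightarrow> bool" where
  "discrete_set n X \<longleftrightarrow> subtopology (pow_top n) X = discrete_topology X"

definition property_a :: "('f, 'r, 'a::linorder_topology) fo_struct \<Rightarrow> bool" where
  "property_a S \<longleftrightarrow>
     (\<forall>n d X \<iota>. definable S n X \<and> X \<noteq> {} \<and> discrete_set n X \<and> proj_index n d \<iota> \<longrightarrow>
        discrete_set d (coord_map d \<iota> ` X))"


section \<open>Dimension, discontinuity set and frontier\<close>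

text \<open>The type \<open>nat extended\<close> is used for dimensions, with \<open>Minf\<close> for the empty set
  and \<open>Minf + d = Minf\<close> for \<open>d \<noteq> Pinf\<close>; the value \<open>Pinf\<close> never occurs.\<close>

definition def_dim :: "nat \<Rightarrow> (nat \<Rightarrow> 'a::linorder_topology) set \<Rightarrow> nat extended" where
  "def_dim n X =
     (if X = {} then Minf
      else Fin (Max {d. \<exists>\<iota>. proj_index n d \<iota> \<and>
                            pow_top d interior_of (coord_map d \<iota> ` X) \<noteq> {}}))"

definition discont ::
  "nat \<Rightarrow> nat \<Rightarrow> (nat \<Rightarrow> 'a::linorder_topology) set \<Rightarrow> ((nat \<Rightarrow> 'a) \<Rightarrow> nat \<Rightarrow> 'a)
     \<Rightarrow> (nat \<Rightarrow> 'a) set" where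
  "discont m n X f =
     {x \<in> X. \<not> topcontinuous_at (subtopology (pow_top m) X) (pow_top n) f x}"

text \<open>This is the closure minus the set itself, unlike the library's \<open>frontier_of\<close>.\<close>

definition frontier_set ::
  "nat \<Rightarrow> (nat \<Rightarrow> 'a::linorder_topology) set \<Rightarrow> (nat \<Rightarrow> 'a) set" where
  "frontier_set n X = pow_top n closure_of X - X"

end

theory Submission
  imports Defs
begin

text \<open>
  Everything is derived from one uniformity principle. If \<open>R x\<close> contains an interval for all \<open>x\<close> in
  an interval, then \<open>R x t\<close> holds for a fixed \<open>t\<close> and all \<open>x\<close> in a subinterval: otherwise the
  points \<open>x\<close> together with the endpoints of the convex components of \<open>R x\<close> form a discrete set,
  which contradicts property (a). By induction on dimensions the same holds for fibres of definable
  sets over any \<open>M\<^sup>m\<close>, so that parameters such as boxes can be chosen uniformly over a nonempty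
  open set; neither definable choice nor generic continuity is needed. Consequently a set of dimension
  at most \<open>e\<close> has discrete fibres over a generic point of \<open>M\<^sup>e\<close>, isolated by boxes that do not
  depend on the point, and the assertions on images, discontinuities and frontiers follow.
\<close>

section \<open>A calculus of definable predicates\<close>

text \<open>A discrete definable set may be infinite, so nothing can be counted: discreteness of
  fibres takes the place that finiteness has in the o-minimal case. The triples of a point and two
  endpoints are isolated for two reasons. A component is determined by x and any one point inside
  it; and the x for which a fixed t lies in R x form a closed discrete set as soon as they contain
  no interval. For the frontier, let X have no projection with interior in dimension e + 1. Over a
  generic z in M^e, a frontier point x above z has a box that misses the fibre of X over z, since
  this fibre is closed and discrete. Once a single box serves all z in an open set, points of X
  close to x project into that open set and lie in the box, which is absurd. Discontinuities are
  excluded in the same way, with a second uniform box in the target. Dimension is handled through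
  thresholds only: \<open>has_dim n d\<close> says that some projection to d coordinates has
  interior, and an inequality of dimensions becomes an implication between such statements.\<close>

lemma eval_term_support:
  "\<exists>F. finite F \<and> (\<forall>e e'. (\<forall>i\<in>F. e i = e' i) \<longrightarrow> eval_term S e t = eval_term S e' t)"
proof (induction t)
  case (Var i)
  then show ?case by (intro exI[of _ "{i}"]) auto
next
  case (App f ts)
  then obtain F where F: "\<And>t. t \<in> set ts \<Longrightarrow> finite (F t) \<and>
      (\<forall>e e'. (\<forall>i\<in>F t. e i = e' i) \<longrightarrow> eval_term S e t = eval_term S e' t)"
    by metis
  have "eval_term S e (App f ts) = eval_term S e' (App f ts)"
    if eq: "\<forall>i\<in>(\<Union>t\<in>set ts. F t). e i = e' i" for e e'
  proof -
    have "eval_term S e t = eval_term S e' t" if "t \<in> set ts" for t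
      using F[OF that] eq that by blast
    then have "map (eval_term S e) ts = map (eval_term S e') ts" by simp
    then show ?thesis by (simp only: eval_term.simps)
  qed
  moreover have "finite (\<Union>t\<in>set ts. F t)" using F by blast
  ultimately show ?case by (intro exI[of _ "\<Union>t\<in>set ts. F t"]) blast
qed

lemma eval_terms_support:
  "\<exists>F. finite F \<and> (\<forall>e e'. (\<forall>i\<in>F. e i = e' i) \<longrightarrow> map (eval_term S e) ts = map (eval_term S e') ts)"
proof (induction ts)
  case (Cons t ts)
  obtain F where F: "finite F" "\<And>e e'. (\<forall>i\<in>F. e i = e' i) \<Longrightarrow> eval_term S e t = eval_term S e' t"
    using eval_term_support[of S t] by blast
  obtain G where G: "finite G"
      "\<And>e e'. (\<forall>i\<in>G. e i = e' i) \<Longrightarrow> map (eval_term S e) ts = map (eval_term S e') ts"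
    using Cons by blast
  have "map (eval_term S e) (t # ts) = map (eval_term S e') (t # ts)"
    if "\<forall>i\<in>F \<union> G. e i = e' i" for e e'
    using F(2)[of e e'] G(2)[of e e'] that by simp
  then show ?case using F(1) G(1) by (intro exI[of _ "F \<union> G"]) blast
qed auto

text \<open>Needed for fresh variables: when a formula is renamed, a bound variable must be sent to
  an index that the rest of the formula does not reach.\<close>

lemma sat_support:
  "\<exists>F. finite F \<and> (\<forall>e e'. (\<forall>i\<in>F. e i = e' i) \<longrightarrow> sat S e \<phi> = sat S e' \<phi>)"
proof (induction \<phi>)
  case (Equal s t)
  obtain F where F: "finite F" "\<And>e e'. (\<forall>i\<in>F. e i = e' i) \<Longrightarrow>
      map (eval_term S e) [s, t] = map (eval_term S e') [s, t]"
    using eval_terms_support[of S "[s, t]"] by blast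
  have "sat S e (Equal s t) = sat S e' (Equal s t)" if "\<forall>i\<in>F. e i = e' i" for e e'
    using F(2)[OF that] by simp
  then show ?case using F(1) by blast
next
  case (Less s t)
  obtain F where F: "finite F" "\<And>e e'. (\<forall>i\<in>F. e i = e' i) \<Longrightarrow>
      map (eval_term S e) [s, t] = map (eval_term S e') [s, t]"
    using eval_terms_support[of S "[s, t]"] by blast
  have "sat S e (Less s t) = sat S e' (Less s t)" if "\<forall>i\<in>F. e i = e' i" for e e'
    using F(2)[OF that] by simp
  then show ?case using F(1) by blast
next
  case (Rel r ts)
  obtain F where F: "finite F" "\<And>e e'. (\<forall>i\<in>F. e i = e' i) \<Longrightarrow>
      map (eval_term S e) ts = map (eval_term S e') ts"
    using eval_terms_support[of S ts] by blast
  have "sat S e (Rel r ts) = sat S e' (Rel r ts)" if "\<forall>i\<in>F. e i = e' i" for e e'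
    using F(2)[OF that] by (simp only: sat.simps)
  then show ?case using F(1) by blast
next
  case (Conj \<phi> \<psi>)
  obtain F where F: "finite F" "\<And>e e'. (\<forall>i\<in>F. e i = e' i) \<Longrightarrow> sat S e \<phi> = sat S e' \<phi>"
    using Conj(1) by blast
  obtain G where G: "finite G" "\<And>e e'. (\<forall>i\<in>G. e i = e' i) \<Longrightarrow> sat S e \<psi> = sat S e' \<psi>"
    using Conj(2) by blast
  have "sat S e (Conj \<phi> \<psi>) = sat S e' (Conj \<phi> \<psi>)" if "\<forall>i\<in>F \<union> G. e i = e' i" for e e'
    using F(2)[of e e'] G(2)[of e e'] that by simp
  then show ?case using F(1) G(1) by (intro exI[of _ "F \<union> G"]) blast
next
  case (Exi i \<phi>)
  then obtain F where F: "finite F" "\<And>e e'. (\<forall>i\<in>F. e i = e' i) \<Longrightarrow> sat S e \<phi> = sat S e' \<phi>"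
    by blast
  have upd: "sat S (e(i := a)) \<phi> = sat S (e'(i := a)) \<phi>" if "\<forall>i\<in>F. e i = e' i" for e e' a
    using that by (intro F(2)) simp
  have "sat S e (Exi i \<phi>) = sat S e' (Exi i \<phi>)" if "\<forall>i\<in>F. e i = e' i" for e e'
    by (simp only: sat.simps upd[OF that])
  then show ?case using F(1) by blast
qed auto

primrec rename_term :: "(nat \<Rightarrow> nat) \<Rightarrow> 'f fo_term \<Rightarrow> 'f fo_term" where
  "rename_term \<sigma> (Var i) = Var (\<sigma> i)"
| "rename_term \<sigma> (App f ts) = App f (map (rename_term \<sigma>) ts)"

lemma eval_rename_term: "eval_term S e (rename_term \<sigma> t) = eval_term S (\<lambda>i. e (\<sigma> i)) t"
proof (induction t)
  case (App f ts)
  then have "map (eval_term S e \<circ> rename_term \<sigma>) ts = map (eval_term S (\<lambda>i. e (\<sigma> i))) ts"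
    by simp
  then show ?case by (simp only: rename_term.simps eval_term.simps map_map)
qed simp

lemma sat_rename: "\<exists>\<phi>'. \<forall>e. sat S e \<phi>' \<longleftrightarrow> sat S (\<lambda>i. e (\<sigma> i)) \<phi>"
proof (induction \<phi> arbitrary: \<sigma>)
  case (Equal s t)
  show ?case by (rule exI[of _ "Equal (rename_term \<sigma> s) (rename_term \<sigma> t)"])
      (simp add: eval_rename_term)
next
  case (Less s t)
  show ?case by (rule exI[of _ "Less (rename_term \<sigma> s) (rename_term \<sigma> t)"])
      (simp add: eval_rename_term)
next
  case (Rel r ts)
  show ?case by (rule exI[of _ "Rel r (map (rename_term \<sigma>) ts)"])
      (simp add: eval_rename_term o_def)
next
  case (Neg \<phi>)
  then obtain \<phi>' where "\<forall>e. sat S e \<phi>' \<longleftrightarrow> sat S (\<lambda>i. e (\<sigma> i)) \<phi>" by blast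
  then show ?case by (intro exI[of _ "Neg \<phi>'"]) simp
next
  case (Conj \<phi> \<psi>)
  obtain \<phi>' where "\<forall>e. sat S e \<phi>' \<longleftrightarrow> sat S (\<lambda>i. e (\<sigma> i)) \<phi>" using Conj(1) by blast
  moreover obtain \<psi>' where "\<forall>e. sat S e \<psi>' \<longleftrightarrow> sat S (\<lambda>i. e (\<sigma> i)) \<psi>" using Conj(2) by blast
  ultimately show ?case by (intro exI[of _ "Conj \<phi>' \<psi>'"]) simp
next
  case (Exi i \<phi>)
  obtain F where F: "finite F" "\<And>e e'. (\<forall>i\<in>F. e i = e' i) \<Longrightarrow> sat S e \<phi> = sat S e' \<phi>"
    using sat_support[of S \<phi>] by blast
  \<comment> \<open>Capture is avoided by choosing \<open>j\<close> outside the image of the finite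
    support; \<sigma> itself may identify variables.\<close>
  obtain j where j: "j \<notin> \<sigma> ` F"
    using F(1) by (metis ex_new_if_finite finite_imageI infinite_UNIV_nat)
  obtain \<phi>' where \<phi>': "\<And>e. sat S e \<phi>' \<longleftrightarrow> sat S (\<lambda>k. e ((\<sigma>(i := j)) k)) \<phi>"
    using Exi.IH[of "\<sigma>(i := j)"] by blast
  have "sat S (e(j := a)) \<phi>' \<longleftrightarrow> sat S ((\<lambda>k. e (\<sigma> k))(i := a)) \<phi>" for e a
    unfolding \<phi>' using j by (intro F(2)) auto
  then show ?case by (intro exI[of _ "Exi j \<phi>'"]) simp
qed

lemma sat_ex_tuple:
  "\<exists>\<phi>'. \<forall>e. sat S e \<phi>' \<longleftrightarrow> (\<exists>x\<in>cart_pow k. sat S (override_on e x {..<k}) \<phi>)"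
proof (induction k arbitrary: \<phi>)
  case 0
  then show ?case by (intro exI[of _ \<phi>]) (simp add: cart_pow_def)
next
  case (Suc k)
  \<comment> \<open>The last coordinate is bound by an ordinary quantifier inside the formula; the
    induction hypothesis, which holds for all formulas, then binds the first \<open>k\<close>
    coordinates.\<close>
  obtain \<phi>' where \<phi>': "\<And>e. sat S e \<phi>' \<longleftrightarrow>
      (\<exists>x\<in>cart_pow k. sat S (override_on e x {..<k}) (Exi k \<phi>))" using Suc by blast
  have upd: "(override_on e x {..<k})(k := a) = override_on e (x(k := a)) {..<Suc k}" for e x a
    by (auto simp: override_on_def fun_eq_iff)
  have "sat S e \<phi>' \<longleftrightarrow> (\<exists>x\<in>cart_pow (Suc k). sat S (override_on e x {..<Suc k}) \<phi>)" for e
  proof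
    assume "sat S e \<phi>'"
    then obtain x a where x: "x \<in> cart_pow k" "sat S (override_on e (x(k := a)) {..<Suc k}) \<phi>"
      by (auto simp: \<phi>' upd)
    moreover have "x(k := a) \<in> cart_pow (Suc k)"
      using x(1) by (auto simp: cart_pow_def PiE_iff extensional_def)
    ultimately show "\<exists>x\<in>cart_pow (Suc k). sat S (override_on e x {..<Suc k}) \<phi>" by blast
  next
    assume "\<exists>x\<in>cart_pow (Suc k). sat S (override_on e x {..<Suc k}) \<phi>"
    then obtain x where x: "x \<in> cart_pow (Suc k)" "sat S (override_on e x {..<Suc k}) \<phi>" by blast
    have "restrict x {..<k} \<in> cart_pow k" by (simp add: cart_pow_def)
    moreover have "(override_on e (restrict x {..<k}) {..<k})(k := x k) = override_on e x {..<Suc k}"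
      by (auto simp: override_on_def fun_eq_iff less_Suc_eq)
    ultimately show "sat S e \<phi>'" using x(2) by (auto simp: \<phi>' intro!: bexI exI[of _ "x k"])
  qed
  then show ?case by blast
qed

text \<open>
  Environments \<open>w :: nat \<Rightarrow> nat \<Rightarrow> 'a\<close> list several tuples \<open>w 0, w 1, \<dots>\<close>, so that quantifiers over
  tuples of varying length correspond to a shift of the first index, in the manner of de Bruijn.
\<close>

definition atomic_term :: "((nat \<Rightarrow> nat \<Rightarrow> 'a) \<Rightarrow> 'a) \<Rightarrow> bool" where
  "atomic_term t \<longleftrightarrow> (\<exists>j k. t = (\<lambda>w. w j k)) \<or> (\<exists>c. t = (\<lambda>_. c))"

text \<open>Parameters are the constant terms, so they need no bookkeeping. The formula reads the
  environment only through the assignment \<open>t\<close>; a substitution of tuples therefore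
  changes \<open>t\<close> and leaves \<phi> alone.\<close>

definition dfn :: "('f, 'r, 'a::linorder) fo_struct \<Rightarrow> ((nat \<Rightarrow> nat \<Rightarrow> 'a) \<Rightarrow> bool) \<Rightarrow> bool" where
  "dfn S P \<longleftrightarrow> (\<exists>\<phi> t. (\<forall>i. atomic_term (t i)) \<and> (\<forall>w. P w \<longleftrightarrow> sat S (\<lambda>i. t i w) \<phi>))"

section \<open>Closure of definable predicates under substitution, connectives and
  quantifiers\<close>

lemma atomic_var: "atomic_term (\<lambda>w. w j k)"
  and atomic_const: "atomic_term (\<lambda>_. c)"
  by (auto simp: atomic_term_def)

lemma atomic_if:
  "atomic_term s \<Longrightarrow> atomic_term t \<Longrightarrow> atomic_term (\<lambda>w. if b then s w else t w)"
  by (cases b) simp_all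

lemma atomic_restrict: "atomic_term (\<lambda>w. f w i) \<Longrightarrow> atomic_term (\<lambda>w. restrict (f w) A i)"
  by (cases "i \<in> A") (simp_all add: atomic_const)

lemma atomic_upd:
  "atomic_term s \<Longrightarrow> atomic_term (\<lambda>w. f w i) \<Longrightarrow> atomic_term (\<lambda>w. ((f w)(m := s w)) i)"
  by (cases "i = m") simp_all

lemma atomic_coord_map: "(\<And>k. atomic_term (\<lambda>w. f w k)) \<Longrightarrow> atomic_term (\<lambda>w. coord_map d \<iota> (f w) i)"
  by (cases "i < d") (simp_all add: atomic_const coord_map_def)

lemma atomic_append:
  "(\<And>k. atomic_term (\<lambda>w. f w k)) \<Longrightarrow> (\<And>k. atomic_term (\<lambda>w. g w k)) \<Longrightarrow>
    atomic_term (\<lambda>w. append_pt m n (f w) (g w) i)"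
  by (cases "i < m + n"; cases "i < m") (simp_all add: atomic_const append_pt_def)

lemmas atomic_intros =
  atomic_var atomic_const atomic_if atomic_restrict atomic_upd atomic_coord_map atomic_append

lemma atomic_comp:
  assumes "atomic_term t" "\<And>j k. atomic_term (\<lambda>w. h w j k)"
  shows "atomic_term (\<lambda>w. t (h w))"
  using assms(1) unfolding atomic_term_def[of t] by (auto simp: assms(2) atomic_const)

lemma dfn_subst:
  assumes "dfn S P" "\<And>j k. atomic_term (\<lambda>w. h w j k)"
  shows "dfn S (\<lambda>w. P (h w))"
proof -
  obtain \<phi> t where t: "\<And>i. atomic_term (t i)" and P: "\<And>w. P w \<longleftrightarrow> sat S (\<lambda>i. t i w) \<phi>"
    using assms(1) by (auto simp: dfn_def)
  show ?thesis unfolding dfn_def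
    by (rule exI[of _ \<phi>], rule exI[of _ "\<lambda>i w. t i (h w)"])
      (simp add: P atomic_comp[OF t assms(2)])
qed

lemma dfn_const: "dfn S (\<lambda>_. b)"
proof -
  have "dfn S (\<lambda>_. True)" unfolding dfn_def
    by (rule exI[of _ "Equal (Var 0) (Var 0)"], rule exI[of _ "\<lambda>_ _. undefined"])
      (simp add: atomic_const)
  moreover have "dfn S (\<lambda>_. False)" unfolding dfn_def
    by (rule exI[of _ "Neg (Equal (Var 0) (Var 0))"], rule exI[of _ "\<lambda>_ _. undefined"])
      (simp add: atomic_const)
  ultimately show ?thesis by (cases b) auto
qed

lemma dfn_less: "atomic_term s \<Longrightarrow> atomic_term t \<Longrightarrow> dfn S (\<lambda>w. s w < t w)"
  unfolding dfn_def
  by (rule exI[of _ "Less (Var 0) (Var 1)"], rule exI[of _ "\<lambda>i. if i = 0 then s else t"]) simp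

lemma dfn_eq: "atomic_term s \<Longrightarrow> atomic_term t \<Longrightarrow> dfn S (\<lambda>w. s w = t w)"
  unfolding dfn_def
  by (rule exI[of _ "Equal (Var 0) (Var 1)"], rule exI[of _ "\<lambda>i. if i = 0 then s else t"]) simp

lemma dfn_not: "dfn S P \<Longrightarrow> dfn S (\<lambda>w. \<not> P w)"
  unfolding dfn_def
proof (elim exE conjE)
  fix \<phi> t assume "\<forall>i. atomic_term (t i)" "\<forall>w. P w = sat S (\<lambda>i. t i w) \<phi>"
  then show "\<exists>\<phi> t. (\<forall>i. atomic_term (t i)) \<and> (\<forall>w. (\<not> P w) = sat S (\<lambda>i. t i w) \<phi>)"
    by (intro exI[of _ "Neg \<phi>"] exI[of _ t]) simp
qed

lemma dfn_conj:
  assumes "dfn S P" "dfn S Q" shows "dfn S (\<lambda>w. P w \<and> Q w)"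
proof -
  obtain \<phi> t where t: "\<And>i. atomic_term (t i)" and P: "\<And>w. P w \<longleftrightarrow> sat S (\<lambda>i. t i w) \<phi>"
    using assms(1) by (auto simp: dfn_def)
  obtain \<psi> u where u: "\<And>i. atomic_term (u i)" and Q: "\<And>w. Q w \<longleftrightarrow> sat S (\<lambda>i. u i w) \<psi>"
    using assms(2) by (auto simp: dfn_def)
  \<comment> \<open>Even variables serve \<phi> and odd ones \<psi>, so that the two assignments do
    not collide.\<close>
  obtain \<phi>' where \<phi>': "\<And>e. sat S e \<phi>' \<longleftrightarrow> sat S (\<lambda>i. e (2 * i)) \<phi>"
    using sat_rename[of S "\<lambda>i. 2 * i" \<phi>] by blast
  obtain \<psi>' where \<psi>': "\<And>e. sat S e \<psi>' \<longleftrightarrow> sat S (\<lambda>i. e (Suc (2 * i))) \<psi>"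
    using sat_rename[of S "\<lambda>i. Suc (2 * i)" \<psi>] by blast
  define v where "v i = (if even i then t (i div 2) else u (i div 2))" for i
  have v: "v (2 * i) = t i" "v (Suc (2 * i)) = u i" for i by (simp_all add: v_def)
  have "atomic_term (v i)" for i using t u by (simp add: v_def)
  moreover have "P w \<and> Q w \<longleftrightarrow> sat S (\<lambda>i. v i w) (Conj \<phi>' \<psi>')" for w
    unfolding P Q sat.simps \<phi>' \<psi>' v ..
  ultimately show ?thesis unfolding dfn_def by blast
qed

lemma dfn_disj:
  assumes "dfn S P" "dfn S Q" shows "dfn S (\<lambda>w. P w \<or> Q w)"
  using dfn_not[OF dfn_conj[OF assms[THEN dfn_not]]] by (simp only: de_Morgan_conj not_not)

lemma dfn_imp:
  assumes "dfn S P" "dfn S Q" shows "dfn S (\<lambda>w. P w \<longrightarrow> Q w)"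
  using dfn_disj[OF dfn_not[OF assms(1)] assms(2)] by (simp only: imp_conv_disj)

lemma dfn_le:
  assumes "atomic_term s" "atomic_term t" shows "dfn S (\<lambda>w. s w \<le> t w)"
  using dfn_not[OF dfn_less[OF assms(2,1)]] by (simp only: not_less)

lemma dfn_all_less: "(\<And>i. i < n \<Longrightarrow> dfn S (P i)) \<Longrightarrow> dfn S (\<lambda>w. \<forall>i<n. P i w)" for n :: nat
proof (induction n)
  case (Suc n)
  have "dfn S (\<lambda>w. P n w \<and> (\<forall>i<n. P i w))"
    by (rule dfn_conj[OF Suc.prems Suc.IH[OF Suc.prems]]) simp_all
  then show ?case by (simp only: All_less_Suc)
qed (simp add: dfn_const)

text \<open>Brings a predicate into the normal form demanded by \<open>definable\<close>: the tuple
  \<open>w 0\<close> occupies the variables below \<open>k\<close>, and everything else moves above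
  them.\<close>

lemma dfn_split_tuple:
  assumes "dfn S P"
  shows "\<exists>\<phi> t. (\<forall>i. atomic_term (t i)) \<and> (\<forall>w. \<forall>x\<in>cart_pow k.
    P (case_nat x w) \<longleftrightarrow> sat S (override_on (\<lambda>i. t i w) x {..<k}) \<phi>)"
proof -
  obtain \<phi> t where t: "\<And>i. atomic_term (t i)" and P: "\<And>w. P w \<longleftrightarrow> sat S (\<lambda>i. t i w) \<phi>"
    using assms(1) by (auto simp: dfn_def)
  \<comment> \<open>All variables that read coordinate \<open>l\<close> of the tuple are merged into
    the variable \<open>l\<close>; the others are shifted by \<open>k\<close>. The index is chosen
    by \<open>SOME\<close> because different coordinates coincide as functions when the type has
    only one element.\<close>
  define \<sigma> where "\<sigma> i = (if \<exists>l<k. t i = (\<lambda>w. w 0 l)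
    then SOME l. l < k \<and> t i = (\<lambda>w. w 0 l) else i + k)" for i
  have \<sigma>: "(\<sigma> i < k \<and> t i = (\<lambda>w. w 0 (\<sigma> i))) \<or> (\<sigma> i = i + k \<and> \<not> (\<exists>l<k. t i = (\<lambda>w. w 0 l)))" for i
  proof (cases "\<exists>l<k. t i = (\<lambda>w. w 0 l)")
    case True
    then show ?thesis using someI_ex[of "\<lambda>l. l < k \<and> t i = (\<lambda>w. w 0 l)"] by (simp add: \<sigma>_def)
  next
    case False
    then have "\<sigma> i = i + k" unfolding \<sigma>_def by (rule if_not_P)
    with False show ?thesis by blast
  qed
  obtain \<phi>' where \<phi>': "\<And>e. sat S e \<phi>' \<longleftrightarrow> sat S (\<lambda>i. e (\<sigma> i)) \<phi>"
    using sat_rename by blast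
  \<comment> \<open>The shift is undone and the tuple is filled with \<open>undefined\<close>: the
    only coordinates of it that are still read here lie beyond its length \<open>k\<close>, where an
    extensional tuple has this value.\<close>
  define t' where "t' i w = t (i - k) (case_nat (\<lambda>_. undefined) w)" for i w
  have "atomic_term (\<lambda>w. (case_nat (\<lambda>_. undefined) w) j l)" for j l
    by (cases j) (simp_all add: atomic_const atomic_var)
  then have "atomic_term (t' i)" for i
    unfolding t'_def by (rule atomic_comp[OF t])
  moreover have "P (case_nat x w) \<longleftrightarrow> sat S (override_on (\<lambda>i. t' i w) x {..<k}) \<phi>'"
    if x: "x \<in> cart_pow k" for x w
  proof -
    have "t i (case_nat x w) = override_on (\<lambda>i. t' i w) x {..<k} (\<sigma> i)" for i
    proof (cases "\<sigma> i < k")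
      case True
      then show ?thesis using \<sigma>[of i] by auto
    next
      case False
      then have \<sigma>i: "\<sigma> i = i + k" and no: "\<not> (\<exists>l<k. t i = (\<lambda>w. w 0 l))" using \<sigma>[of i] by auto
      have "t i (case_nat x w) = t i (case_nat (\<lambda>_. undefined) w)"
      proof -
        consider j l where "t i = (\<lambda>w. w j l)" | c where "t i = (\<lambda>_. c)"
          using t[of i] unfolding atomic_term_def by blast
        then show ?thesis
        proof cases
          case 1
          have "x l = undefined" if "j = 0"
          proof -
            have "\<not> l < k" using no 1 that by blast
            then show ?thesis using x by (simp add: cart_pow_def PiE_iff extensional_def)
          qed
          then show ?thesis unfolding 1 by (cases j) simp_all
        next
          case 2
          show ?thesis unfolding 2 ..
        qed
      qed
      then show ?thesis using \<sigma>i by (simp add: t'_def)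
    qed
    then show ?thesis by (simp add: P \<phi>')
  qed
  ultimately show ?thesis by blast
qed

lemma restrict_in_cart_pow: "restrict f {..<n} \<in> cart_pow n"
  by (simp add: cart_pow_def)

lemma restrict_cart_pow: "x \<in> cart_pow n \<Longrightarrow> restrict x {..<n} = x"
  by (simp add: cart_pow_def PiE_restrict)

text \<open>The bound tuple is presented as \<open>restrict (w 0) {..<k}\<close>, which lies in
  \<open>cart_pow k\<close> by its mere form; the rules for terms then apply without an assumption
  on the environment.\<close>

lemma dfn_bex:
  assumes "dfn S (\<lambda>w. Q (\<lambda>j. w (Suc j)) (restrict (w 0) {..<k}))"
  shows "dfn S (\<lambda>w. \<exists>x\<in>cart_pow k. Q w x)"
proof -
  obtain \<phi> t where t: "\<And>i. atomic_term (t i)" and Q: "\<And>w x. x \<in> cart_pow k \<Longrightarrow>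
      Q w (restrict x {..<k}) \<longleftrightarrow> sat S (override_on (\<lambda>i. t i w) x {..<k}) \<phi>"
    using dfn_split_tuple[OF assms, of k] unfolding nat.case by blast
  obtain \<phi>' where \<phi>': "\<And>e. sat S e \<phi>' \<longleftrightarrow> (\<exists>x\<in>cart_pow k. sat S (override_on e x {..<k}) \<phi>)"
    using sat_ex_tuple by blast
  have "(\<exists>x\<in>cart_pow k. Q w x) \<longleftrightarrow> sat S (\<lambda>i. t i w) \<phi>'" for w
    unfolding \<phi>' using Q by (intro bex_cong refl) (simp add: restrict_cart_pow)
  then show ?thesis unfolding dfn_def using t by blast
qed

lemma dfn_ball:
  assumes "dfn S (\<lambda>w. Q (\<lambda>j. w (Suc j)) (restrict (w 0) {..<k}))"
  shows "dfn S (\<lambda>w. \<forall>x\<in>cart_pow k. Q w x)"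
  using dfn_not[OF dfn_bex[OF dfn_not[OF assms]]] by (simp only: bex_simps not_not)

lemma dfn_ex:
  assumes "dfn S (\<lambda>w. Q (\<lambda>j. w (Suc j)) (w 0 0))"
  shows "dfn S (\<lambda>w. \<exists>a. Q w a)"
proof -
  have "dfn S (\<lambda>w. \<exists>x\<in>cart_pow 1. Q w (x 0))"
    by (rule dfn_bex) (simp only: restrict_apply lessThan_iff zero_less_one if_True assms)
  moreover have "(\<exists>x\<in>cart_pow 1. Q w (x 0)) \<longleftrightarrow> (\<exists>a. Q w a)" for w
  proof
    assume "\<exists>a. Q w a"
    then obtain a where "Q w a" by blast
    then show "\<exists>x\<in>cart_pow 1. Q w (x 0)"
      by (intro bexI[of _ "restrict (\<lambda>_. a) {..<1}"] restrict_in_cart_pow) simp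
  qed blast
  ultimately show ?thesis by simp
qed

lemma dfn_all:
  assumes "dfn S (\<lambda>w. Q (\<lambda>j. w (Suc j)) (w 0 0))"
  shows "dfn S (\<lambda>w. \<forall>a. Q w a)"
  using dfn_not[OF dfn_ex[OF dfn_not[OF assms]]] by (simp only: not_ex not_not)

section \<open>Passage between definable sets and definable predicates\<close>

lemma dfn_mem:
  assumes "definable S n X" "\<And>i. atomic_term (\<lambda>w. f w i)" "\<And>w. f w \<in> cart_pow n"
  shows "dfn S (\<lambda>w. f w \<in> X)"
proof -
  obtain \<phi> e where X: "X = {x \<in> cart_pow n. sat S (override_on e x {..<n}) \<phi>}"
    using assms(1) by (auto simp: definable_def)
  have "override_on e x {..<n} = (\<lambda>i. if i < n then x i else e i)" for x
    by (auto simp: override_on_def)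
  then show ?thesis unfolding dfn_def X
    by (intro exI[of _ \<phi>] exI[of _ "\<lambda>i w. if i < n then f w i else e i"])
      (simp add: assms atomic_if atomic_const)
qed

lemma dfn_definable:
  fixes P :: "(nat \<Rightarrow> 'b::linorder) \<Rightarrow> bool"
  assumes "dfn S (\<lambda>w. P (restrict (w 0) {..<n}))"
  shows "definable S n {x \<in> cart_pow n. P x}"
proof -
  obtain \<phi> t where "\<And>(w :: nat \<Rightarrow> nat \<Rightarrow> 'b) x. x \<in> cart_pow n \<Longrightarrow>
      P (restrict x {..<n}) \<longleftrightarrow> sat S (override_on (\<lambda>i. t i w) x {..<n}) \<phi>"
    using dfn_split_tuple[OF assms, of n] unfolding nat.case by blast
  \<comment> \<open>\<open>P\<close> depends on the first tuple alone, so the remaining tuples can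
    be fixed arbitrarily.\<close>
  then show ?thesis unfolding definable_def
    by (intro exI[of _ \<phi>] exI[of _ "\<lambda>i. t i undefined"]) (auto simp: restrict_cart_pow)
qed

lemma definable_subset: "definable S n X \<Longrightarrow> X \<subseteq> cart_pow n"
  by (auto simp: definable_def)

lemma dfn_definable1: "dfn S (\<lambda>w. w 0 0 \<in> X) \<Longrightarrow> definable1 S X"
  unfolding definable1_def by (rule dfn_definable) simp

text \<open>Later hypotheses state definability of a relation for canonical variables; this rule and
  its variants transport it to arbitrary terms, and they serve there as introduction rules.\<close>

lemma dfn_rel1:
  assumes "dfn S (\<lambda>w. R (restrict (w 0) {..<m}))"
    and "\<And>i. atomic_term (\<lambda>w. f w i)" "\<And>w. f w \<in> cart_pow m"
  shows "dfn S (\<lambda>w. R (f w))"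
  using dfn_subst[OF assms(1), of "\<lambda>w _. f w"] assms(2,3) by (simp add: restrict_cart_pow)

lemma dfn_rel2:
  assumes "dfn S (\<lambda>w. R (restrict (w 0) {..<m}) (restrict (w 1) {..<n}))"
    and "\<And>i. atomic_term (\<lambda>w. f w i)" "\<And>w. f w \<in> cart_pow m"
    and "\<And>i. atomic_term (\<lambda>w. g w i)" "\<And>w. g w \<in> cart_pow n"
  shows "dfn S (\<lambda>w. R (f w) (g w))"
proof -
  have "dfn S (\<lambda>w. R (restrict (f w) {..<m}) (restrict (g w) {..<n}))"
    using dfn_subst[OF assms(1), of "\<lambda>w j. if j = 0 then f w else g w"] assms(2,4)
    by (simp add: if_distribR atomic_if)
  then show ?thesis using assms(3,5) by (simp add: restrict_cart_pow)
qed

lemma dfn_rel3: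
  assumes "dfn S (\<lambda>w. R (restrict (w 0) {..<m}) (restrict (w 1) {..<n}) (restrict (w 2) {..<k}))"
    and "\<And>i. atomic_term (\<lambda>w. f w i)" "\<And>w. f w \<in> cart_pow m"
    and "\<And>i. atomic_term (\<lambda>w. g w i)" "\<And>w. g w \<in> cart_pow n"
    and "\<And>i. atomic_term (\<lambda>w. h w i)" "\<And>w. h w \<in> cart_pow k"
  shows "dfn S (\<lambda>w. R (f w) (g w) (h w))"
proof -
  have "dfn S (\<lambda>w. R (restrict (f w) {..<m}) (restrict (g w) {..<n}) (restrict (h w) {..<k}))"
    using dfn_subst[OF assms(1), of "\<lambda>w j. if j = 0 then f w else if j = 1 then g w else h w"]
      assms(2,4,6)
    by (simp add: if_distribR atomic_if)
  then show ?thesis using assms(3,5,7) by (simp add: restrict_cart_pow)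
qed

lemma dfn_rel_elem:
  assumes "dfn S (\<lambda>w. R (w 0 0) (w 1 0))" "atomic_term s" "atomic_term t"
  shows "dfn S (\<lambda>w. R (s w) (t w))"
  using dfn_subst[OF assms(1), of "\<lambda>w j _. if j = 0 then s w else t w"] assms(2,3)
  by (simp add: atomic_if)

lemma cart_pow_upd: "x \<in> cart_pow n \<Longrightarrow> x(n := a) \<in> cart_pow (Suc n)"
  by (auto simp: cart_pow_def PiE_iff extensional_def)

lemma coord_map_in_cart_pow: "coord_map d \<iota> x \<in> cart_pow d"
  by (simp add: coord_map_def cart_pow_def)

lemma append_in_cart_pow: "append_pt m n x y \<in> cart_pow (m + n)"
  by (simp add: append_pt_def cart_pow_def)

lemmas cart_pow_intros =
  restrict_in_cart_pow cart_pow_upd coord_map_in_cart_pow append_in_cart_pow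

lemmas dfn_intros =
  dfn_const dfn_less dfn_le dfn_eq dfn_not dfn_conj dfn_disj dfn_imp dfn_all_less
  dfn_bex dfn_ball dfn_ex dfn_all atomic_intros cart_pow_intros

section \<open>Open boxes\<close>

definition open_box :: "nat \<Rightarrow> (nat \<Rightarrow> 'a::linorder) \<Rightarrow> (nat \<Rightarrow> 'a) \<Rightarrow> (nat \<Rightarrow> 'a) set" where
  "open_box n a b = {x \<in> cart_pow n. \<forall>i<n. a i < x i \<and> x i < b i}"

text \<open>The corners range over tuples, not over arbitrary functions, so that this is a
  first-order condition on the set. It agrees with having nonempty topological interior by
  \<open>has_interior_iff\<close>.\<close>

definition has_interior :: "nat \<Rightarrow> (nat \<Rightarrow> 'a::linorder) set \<Rightarrow> bool" where
  "has_interior n X \<longleftrightarrow>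
     (\<exists>a\<in>cart_pow n. \<exists>b\<in>cart_pow n. (\<forall>i<n. a i < b i) \<and> open_box n a b \<subseteq> X)"

lemma open_box_subset: "open_box n a b \<subseteq> cart_pow n"
  by (auto simp: open_box_def)

lemma open_box_mono:
  assumes "\<And>i. i < n \<Longrightarrow> a' i \<le> a i" "\<And>i. i < n \<Longrightarrow> b i \<le> b' i"
  shows "open_box n a b \<subseteq> open_box n a' b'"
  using assms unfolding open_box_def by (auto intro: le_less_trans less_le_trans)

lemma open_box_restrict: "open_box n (restrict a {..<n}) (restrict b {..<n}) = open_box n a b"
  by (simp add: open_box_def)

lemma open_box_nonempty:
  fixes a b :: "nat \<Rightarrow> 'a::dense_linorder"
  assumes "\<And>i. i < n \<Longrightarrow> a i < b i"
  obtains x where "x \<in> open_box n a b"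
proof -
  obtain x where "\<And>i. i < n \<Longrightarrow> a i < x i \<and> x i < b i"
    using dense[OF assms] by metis
  then have "restrict x {..<n} \<in> open_box n a b"
    by (simp add: open_box_def restrict_in_cart_pow)
  then show thesis by (rule that)
qed

lemma has_interiorI:
  assumes "\<And>i. i < n \<Longrightarrow> a i < b i" "open_box n a b \<subseteq> X"
  shows "has_interior n X"
  unfolding has_interior_def
  by (intro bexI[of _ "restrict a {..<n}"] bexI[of _ "restrict b {..<n}"] restrict_in_cart_pow)
    (use assms in \<open>simp add: open_box_restrict\<close>)

lemma has_interiorE:
  assumes "has_interior n X"
  obtains a b where "a \<in> cart_pow n" "b \<in> cart_pow n" "\<And>i. i < n \<Longrightarrow> a i < b i" "open_box n a b \<subseteq> X"
  using assms unfolding has_interior_def by blast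

lemma has_interior_mono: "has_interior n X \<Longrightarrow> X \<subseteq> Y \<Longrightarrow> has_interior n Y"
  unfolding has_interior_def by blast

lemma has_interior_open_box:
  assumes "x \<in> open_box n a b"
  shows "has_interior n (open_box n a b)"
  using assms by (intro has_interiorI[of n a b]) (auto simp: open_box_def intro: less_trans)

lemma has_interior_nonempty:
  fixes X :: "(nat \<Rightarrow> 'a::dense_linorder) set"
  assumes "has_interior n X" shows "X \<noteq> {}"
proof -
  obtain a b where ab: "\<And>i. i < n \<Longrightarrow> a i < b i" "open_box n a b \<subseteq> X"
    using assms by (metis has_interiorE)
  obtain x where "x \<in> open_box n a b" using open_box_nonempty ab(1) by metis
  then show ?thesis using ab(2) by blast
qed

lemma has_interior_0: "has_interior 0 X \<longleftrightarrow> (\<lambda>_. undefined) \<in> X"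
  by (auto simp: has_interior_def open_box_def cart_pow_def)

lemma cart_pow_0: "cart_pow 0 = {\<lambda>_. undefined}"
  by (simp add: cart_pow_def)

lemma cart_pow_Suc_cases:
  assumes "x \<in> cart_pow (Suc n)"
  obtains y t where "y \<in> cart_pow n" "x = y(n := t)"
proof
  show "x(n := undefined) \<in> cart_pow n"
    using assms by (auto simp: cart_pow_def PiE_iff extensional_def)
  show "x = (x(n := undefined))(n := x n)" by simp
qed

lemma upd_in_open_box:
  assumes "y \<in> cart_pow n"
  shows "y(n := t) \<in> open_box (Suc n) a b \<longleftrightarrow> y \<in> open_box n a b \<and> a n < t \<and> t < b n"
  using assms cart_pow_upd[OF assms] by (auto simp: open_box_def less_Suc_eq)

lemma has_interior_SucI:
  assumes "\<And>i. i < n \<Longrightarrow> a i < b i" "p < q"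
    and "\<And>y t. y \<in> open_box n a b \<Longrightarrow> p < t \<Longrightarrow> t < q \<Longrightarrow> y(n := t) \<in> X"
  shows "has_interior (Suc n) X"
proof (rule has_interiorI[of _ "a(n := p)" "b(n := q)"])
  show "open_box (Suc n) (a(n := p)) (b(n := q)) \<subseteq> X"
  proof
    fix x assume x: "x \<in> open_box (Suc n) (a(n := p)) (b(n := q))"
    then obtain y t where yt: "y \<in> cart_pow n" "x = y(n := t)"
      by (auto simp: open_box_def elim: cart_pow_Suc_cases)
    then have "y \<in> open_box n (a(n := p)) (b(n := q))" "p < t" "t < q"
      using x by (simp_all add: upd_in_open_box)
    moreover from this(1) have "y \<in> open_box n a b" by (simp add: open_box_def)
    ultimately show "x \<in> X" using assms(3) yt(2) by blast
  qed
qed (use assms(1,2) in auto)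

lemma has_interior_1_iff:
  "has_interior 1 {x. P (x 0)} \<longleftrightarrow> (\<exists>p q. p < q \<and> (\<forall>t. p < t \<and> t < q \<longrightarrow> P t))"
proof
  assume "has_interior 1 {x. P (x 0)}"
  then obtain a b where ab: "a 0 < b 0" "open_box 1 a b \<subseteq> {x. P (x 0)}"
    by (auto elim!: has_interiorE)
  have "P t" if "a 0 < t" "t < b 0" for t
  proof -
    have "(\<lambda>i\<in>{..<1}. t) \<in> open_box 1 a b"
      using that by (simp add: open_box_def restrict_in_cart_pow)
    then show ?thesis using ab(2) by auto
  qed
  then show "\<exists>p q. p < q \<and> (\<forall>t. p < t \<and> t < q \<longrightarrow> P t)" using ab(1) by blast
next
  assume "\<exists>p q. p < q \<and> (\<forall>t. p < t \<and> t < q \<longrightarrow> P t)"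
  then obtain p q where "p < q" "\<And>t. p < t \<Longrightarrow> t < q \<Longrightarrow> P t" by blast
  then show "has_interior 1 {x. P (x 0)}"
    by (intro has_interiorI[of _ "\<lambda>_. p" "\<lambda>_. q"]) (auto simp: open_box_def)
qed

section \<open>Boxes as a basis of the product topology\<close>

lemma topspace_pow_top: "topspace (pow_top n) = cart_pow n"
  by (simp add: pow_top_def cart_pow_def)

lemma open_interval_nbhd:
  fixes x :: "'a::{unbounded_dense_linorder, linorder_topology}"
  assumes "open U" "x \<in> U"
  shows "\<exists>a b. a < x \<and> x < b \<and> {a<..<b} \<subseteq> U"
proof -
  obtain y z where "y < x" "x < z" using lt_ex gt_ex by metis
  obtain a where a: "a < x" "{a<..x} \<subseteq> U" using open_left[OF assms \<open>y < x\<close>] by blast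
  obtain b where b: "x < b" "{x..<b} \<subseteq> U" using open_right[OF assms \<open>x < z\<close>] by blast
  have "{a<..<b} \<subseteq> {a<..x} \<union> {x..<b}" by auto
  then show ?thesis using a b by blast
qed

lemma openin_open_box:
  fixes a b :: "nat \<Rightarrow> 'a::linorder_topology"
  shows "openin (pow_top n) (open_box n a b)"
proof -
  have "open_box n a b = (\<Pi>\<^sub>E i\<in>{..<n}. {a i<..<b i})"
    by (intro set_eqI) (simp add: open_box_def cart_pow_def PiE_iff, blast)
  then show ?thesis by (simp add: pow_top_def openin_PiE)
qed

lemma open_box_nbhd:
  fixes x :: "nat \<Rightarrow> 'a::{unbounded_dense_linorder, linorder_topology}"
  assumes "openin (pow_top n) U" "x \<in> U"
  obtains a b where "a \<in> cart_pow n" "b \<in> cart_pow n" "x \<in> open_box n a b" "open_box n a b \<subseteq> U"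
proof -
  obtain V where V: "\<And>i. i < n \<Longrightarrow> open (V i)" "x \<in> PiE {..<n} V" "PiE {..<n} V \<subseteq> U"
    using assms unfolding pow_top_def openin_product_topology_alt
    by simp (metis lessThan_iff)
  have "\<exists>a b. i < n \<longrightarrow> a < x i \<and> x i < b \<and> {a<..<b} \<subseteq> V i" for i
    using open_interval_nbhd[OF V(1), of i "x i"] V(2) by (auto simp: PiE_iff)
  then obtain a b where ab: "\<And>i. i < n \<Longrightarrow> a i < x i \<and> x i < b i \<and> {a i<..<b i} \<subseteq> V i" by metis
  have "x \<in> open_box n a b" using ab V(2) by (auto simp: open_box_def cart_pow_def PiE_iff)
  moreover have "open_box n a b \<subseteq> PiE {..<n} V"
  proof
    fix y assume y: "y \<in> open_box n a b"
    then have "y i \<in> V i" if "i < n" for i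
      using ab[OF that] that by (auto simp: open_box_def)
    then show "y \<in> PiE {..<n} V" using y by (simp add: open_box_def cart_pow_def PiE_iff)
  qed
  ultimately show ?thesis
    using V(3) by (intro that[of "restrict a {..<n}" "restrict b {..<n}"])
      (auto simp: restrict_in_cart_pow open_box_restrict)
qed

lemma has_interior_iff:
  fixes X :: "(nat \<Rightarrow> 'a::{unbounded_dense_linorder, linorder_topology}) set"
  shows "pow_top n interior_of X \<noteq> {} \<longleftrightarrow> has_interior n X"
proof
  assume "pow_top n interior_of X \<noteq> {}"
  then obtain U x where U: "openin (pow_top n) U" "x \<in> U" "U \<subseteq> X"
    by (auto simp: interior_of_def)
  then obtain a b where "x \<in> open_box n a b" "open_box n a b \<subseteq> U" by (metis open_box_nbhd)
  then show "has_interior n X"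
    using U(3) by (meson has_interior_mono has_interior_open_box subset_trans)
next
  assume "has_interior n X"
  then obtain a b where ab: "\<And>i. i < n \<Longrightarrow> a i < b i" "open_box n a b \<subseteq> X" by (metis has_interiorE)
  obtain x where "x \<in> open_box n a b" using open_box_nonempty ab(1) by metis
  then show "pow_top n interior_of X \<noteq> {}"
    using ab(2) openin_open_box[of n a b] unfolding interior_of_def by blast
qed

lemma discrete_set_iff:
  fixes X :: "(nat \<Rightarrow> 'a::{unbounded_dense_linorder, linorder_topology}) set"
  shows "discrete_set n X \<longleftrightarrow> X \<subseteq> cart_pow n \<and>
     (\<forall>x\<in>X. \<exists>a b. x \<in> open_box n a b \<and> X \<inter> open_box n a b \<subseteq> {x})"
proof
  assume L: "discrete_set n X"
  then have sub: "X \<subseteq> cart_pow n"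
    unfolding discrete_set_def by (metis inf.cobounded1 topspace_discrete_topology
        topspace_pow_top topspace_subtopology)
  have "\<exists>a b. x \<in> open_box n a b \<and> X \<inter> open_box n a b \<subseteq> {x}" if "x \<in> X" for x
  proof -
    have "openin (subtopology (pow_top n) X) {x}"
      using L that by (simp add: discrete_set_def)
    then obtain U where "openin (pow_top n) U" "{x} = U \<inter> X" by (auto simp: openin_subtopology)
    moreover from this obtain a b where "x \<in> open_box n a b" "open_box n a b \<subseteq> U"
      using open_box_nbhd by (metis IntD1 singletonI)
    ultimately show ?thesis by blast
  qed
  with sub show "X \<subseteq> cart_pow n \<and> (\<forall>x\<in>X. \<exists>a b. x \<in> open_box n a b \<and> X \<inter> open_box n a b \<subseteq> {x})"
    by blast
next
  assume R: "X \<subseteq> cart_pow n \<and> (\<forall>x\<in>X. \<exists>a b. x \<in> open_box n a b \<and> X \<inter> open_box n a b \<subseteq> {x})"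
  have "openin (subtopology (pow_top n) X) {x}" if "x \<in> X" for x
  proof -
    have "\<exists>a b. x \<in> open_box n a b \<and> X \<inter> open_box n a b \<subseteq> {x}"
      using conjunct2[OF R] that by (rule bspec)
    then obtain a b where "x \<in> open_box n a b" "X \<inter> open_box n a b \<subseteq> {x}"
      by (elim exE conjE)
    then have "{x} = open_box n a b \<inter> X" using that by blast
    then show ?thesis using openin_open_box unfolding openin_subtopology by blast
  qed
  then show "discrete_set n X"
    using R unfolding discrete_set_def
    by (subst eq_commute, subst discrete_topology_unique) (auto simp: topspace_pow_top)
qed

text \<open>Open sets are replaced by boxes with corners in \<open>cart_pow n\<close>, so every
  quantifier ranges over tuples; in this form the frontier is visibly definable. The next lemma does
  the same for discontinuities.\<close>

lemma in_frontier_set_iff: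
  fixes X :: "(nat \<Rightarrow> 'a::{unbounded_dense_linorder, linorder_topology}) set"
  shows "x \<in> frontier_set n X \<longleftrightarrow> x \<in> cart_pow n \<and> x \<notin> X \<and>
     (\<forall>a\<in>cart_pow n. \<forall>b\<in>cart_pow n. x \<in> open_box n a b \<longrightarrow>
       (\<exists>y\<in>cart_pow n. y \<in> X \<and> y \<in> open_box n a b))"
proof -
  have "x \<in> pow_top n closure_of X \<longleftrightarrow> x \<in> cart_pow n \<and>
     (\<forall>a\<in>cart_pow n. \<forall>b\<in>cart_pow n. x \<in> open_box n a b \<longrightarrow>
       (\<exists>y\<in>cart_pow n. y \<in> X \<and> y \<in> open_box n a b))"
    (is "_ \<longleftrightarrow> ?R")
  proof
    assume cl: "x \<in> pow_top n closure_of X"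
    have "\<exists>y\<in>cart_pow n. y \<in> X \<and> y \<in> open_box n a b" if "x \<in> open_box n a b" for a b
      using cl that openin_open_box[of n a b] open_box_subset[of n a b]
      unfolding in_closure_of topspace_pow_top by blast
    then show ?R using cl unfolding in_closure_of topspace_pow_top by simp
  next
    assume R: ?R
    have "\<exists>y. y \<in> X \<and> y \<in> U" if U: "x \<in> U" "openin (pow_top n) U" for U
    proof -
      obtain a b where "a \<in> cart_pow n" "b \<in> cart_pow n" "x \<in> open_box n a b" "open_box n a b \<subseteq> U"
        using open_box_nbhd[OF U(2,1)] by metis
      then show ?thesis using R by blast
    qed
    then show "x \<in> pow_top n closure_of X"
      using R unfolding in_closure_of topspace_pow_top by blast
  qed
  then show ?thesis by (auto simp: frontier_set_def)
qed

lemma in_discont_iff: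
  fixes X :: "(nat \<Rightarrow> 'a::{unbounded_dense_linorder, linorder_topology}) set"
  assumes X: "X \<subseteq> cart_pow m" and f: "f ` X \<subseteq> cart_pow n"
  shows "x \<in> discont m n X f \<longleftrightarrow> x \<in> X \<and> (\<exists>c\<in>cart_pow n. \<exists>d\<in>cart_pow n. f x \<in> open_box n c d \<and>
     (\<forall>a\<in>cart_pow m. \<forall>b\<in>cart_pow m. x \<in> open_box m a b \<longrightarrow>
       (\<exists>y\<in>cart_pow m. y \<in> X \<and> y \<in> open_box m a b \<and> f y \<notin> open_box n c d)))"
proof (cases "x \<in> X")
  case True
  have tops: "topspace (subtopology (pow_top m) X) = X" using X by (auto simp: topspace_pow_top)
  have cont: "topcontinuous_at (subtopology (pow_top m) X) (pow_top n) f x \<longleftrightarrow>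
    (\<forall>V. openin (pow_top n) V \<and> f x \<in> V \<longrightarrow>
      (\<exists>U. openin (subtopology (pow_top m) X) U \<and> x \<in> U \<and> (\<forall>y\<in>U. f y \<in> V)))"
    using True X f by (auto simp: topcontinuous_at_def tops topspace_pow_top)
  have "topcontinuous_at (subtopology (pow_top m) X) (pow_top n) f x \<longleftrightarrow>
    (\<forall>c\<in>cart_pow n. \<forall>d\<in>cart_pow n. f x \<in> open_box n c d \<longrightarrow>
      (\<exists>a\<in>cart_pow m. \<exists>b\<in>cart_pow m. x \<in> open_box m a b \<and>
        (\<forall>y\<in>X. y \<in> open_box m a b \<longrightarrow> f y \<in> open_box n c d)))" (is "?C \<longleftrightarrow> ?R")
  proof
    assume C: ?C
    show ?R
    proof (intro ballI impI)
      fix c d assume "f x \<in> open_box n c d"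
      then obtain U where U: "openin (subtopology (pow_top m) X) U" "x \<in> U"
          "\<forall>y\<in>U. f y \<in> open_box n c d"
        using C openin_open_box[of n c d] unfolding cont by blast
      then obtain W where W: "openin (pow_top m) W" "U = W \<inter> X" by (auto simp: openin_subtopology)
      obtain a b where "a \<in> cart_pow m" "b \<in> cart_pow m" "x \<in> open_box m a b" "open_box m a b \<subseteq> W"
        using open_box_nbhd[OF W(1)] U(2) W(2) by (metis IntD1)
      then show "\<exists>a\<in>cart_pow m. \<exists>b\<in>cart_pow m. x \<in> open_box m a b \<and>
        (\<forall>y\<in>X. y \<in> open_box m a b \<longrightarrow> f y \<in> open_box n c d)" using U(3) W(2) by blast
    qed
  next
    assume R: ?R
    show ?C unfolding cont
    proof (intro allI impI)
      fix V assume V: "openin (pow_top n) V \<and> f x \<in> V"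
      obtain c d where "c \<in> cart_pow n" "d \<in> cart_pow n" "f x \<in> open_box n c d"
          and cdV: "open_box n c d \<subseteq> V"
        using V open_box_nbhd by metis
      then obtain a b where "x \<in> open_box m a b"
          "\<forall>y\<in>X. y \<in> open_box m a b \<longrightarrow> f y \<in> open_box n c d" using R by blast
      then show "\<exists>U. openin (subtopology (pow_top m) X) U \<and> x \<in> U \<and> (\<forall>y\<in>U. f y \<in> V)"
        using cdV True openin_open_box[of m a b]
        by (intro exI[of _ "open_box m a b \<inter> X"]) (auto simp: openin_subtopology)
    qed
  qed
  then show ?thesis using True X unfolding discont_def by blast
qed (simp add: discont_def)

section \<open>Definable subsets of the line\<close>

definition has_interval :: "('a::linorder \<Rightarrow> bool) \<Rightarrow> bool" where
  "has_interval P \<longleftrightarrow> (\<exists>p q. p < q \<and> (\<forall>t. p < t \<and> t < q \<longrightarrow> P t))"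

lemma has_interval_mono: "has_interval P \<Longrightarrow> (\<And>t. P t \<Longrightarrow> Q t) \<Longrightarrow> has_interval Q"
  unfolding has_interval_def by blast

locale tame_structure =
  fixes S :: "('f, 'r, 'a::{unbounded_dense_linorder, linorder_topology}) fo_struct"
  assumes complete: "definably_complete S"
    and locally_o_minimal: "locally_o_minimal S"
    and property_a: "property_a S"
begin

text \<open>Being constant on both one-sided germs at \<open>a\<close> holds for points and for open
  intervals and passes to finite unions, hence to the traces that local o-minimality
  provides.\<close>

lemma germs:
  assumes "dfn S (\<lambda>w. P (w 0 0))"
  shows "\<exists>b c. b < a \<and> a < c \<and>
    ((\<forall>t. b < t \<and> t < a \<longrightarrow> P t) \<or> (\<forall>t. b < t \<and> t < a \<longrightarrow> \<not> P t)) \<and>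
    ((\<forall>t. a < t \<and> t < c \<longrightarrow> P t) \<or> (\<forall>t. a < t \<and> t < c \<longrightarrow> \<not> P t))"
proof -
  define good where "good Y \<longleftrightarrow> (\<exists>b c. b < a \<and> a < c \<and>
    ((\<forall>t. b < t \<and> t < a \<longrightarrow> t \<in> Y) \<or> (\<forall>t. b < t \<and> t < a \<longrightarrow> t \<notin> Y)) \<and>
    ((\<forall>t. a < t \<and> t < c \<longrightarrow> t \<in> Y) \<or> (\<forall>t. a < t \<and> t < c \<longrightarrow> t \<notin> Y)))" for Y
  have Un: "good (Y \<union> Z)" if Y: "good Y" and Z: "good Z" for Y Z
  proof -
    obtain b c where bc: "b < a" "a < c"
      "(\<forall>t. b < t \<and> t < a \<longrightarrow> t \<in> Y) \<or> (\<forall>t. b < t \<and> t < a \<longrightarrow> t \<notin> Y)"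
      "(\<forall>t. a < t \<and> t < c \<longrightarrow> t \<in> Y) \<or> (\<forall>t. a < t \<and> t < c \<longrightarrow> t \<notin> Y)"
      using Y unfolding good_def by blast
    obtain b' c' where bc': "b' < a" "a < c'"
      "(\<forall>t. b' < t \<and> t < a \<longrightarrow> t \<in> Z) \<or> (\<forall>t. b' < t \<and> t < a \<longrightarrow> t \<notin> Z)"
      "(\<forall>t. a < t \<and> t < c' \<longrightarrow> t \<in> Z) \<or> (\<forall>t. a < t \<and> t < c' \<longrightarrow> t \<notin> Z)"
      using Z unfolding good_def by blast
    show ?thesis unfolding good_def
      by (rule exI[of _ "max b b'"], rule exI[of _ "min c c'"]) (use bc bc' in auto)
  qed
  obtain l u where lu: "l < a" "a < u" using lt_ex gt_ex by metis
  have empty: "good {}" unfolding good_def using lu by blast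
  have single: "good {x}" for x
  proof -
    consider "x < a" | "x = a" | "a < x" by fastforce
    then show ?thesis
    proof cases
      case 1 then show ?thesis unfolding good_def using lu by (intro exI[of _ x] exI[of _ u]) auto
    next
      case 2 then show ?thesis unfolding good_def using lu by (intro exI[of _ l] exI[of _ u]) auto
    next
      case 3 then show ?thesis unfolding good_def using lu by (intro exI[of _ l] exI[of _ x]) auto
    qed
  qed
  have interval: "good {x<..<y}" for x y
  proof -
    \<comment> \<open>\<open>b\<close> and \<open>c\<close> are the endpoints of the interval
      nearest to \<open>a\<close> on the left and on the right, or \<open>l\<close> and
      \<open>u\<close> if there is none on that side.\<close>
    define b where "b = (if y < a then y else if x < a then x else l)"
    define c where "c = (if a < x then x else if a < y then y else u)"
    show ?thesis unfolding good_def
      by (rule exI[of _ b], rule exI[of _ c]) (use lu in \<open>auto simp: b_def c_def\<close>)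
  qed
  have fin: "good F" if "finite F" for F
    using that
  proof induction
    case (insert x F)
    then show ?case using Un[OF single, of F x] by simp
  qed (rule empty)
  have fin_Un: "good (\<Union>G)" if "finite G" "\<forall>J\<in>G. \<exists>u v. J = {u<..<v}" for G
    using that
  proof induction
    case (insert J G)
    then obtain x y where "J = {x<..<y}" by auto
    then show ?case using Un[OF interval[of x y], of "\<Union>G"] insert by simp
  qed (simp add: empty)
  have "definable1 S (Collect P)" using assms by (intro dfn_definable1) simp
  then obtain b c F G where bc: "a \<in> {b<..<c}" and FG: "finite F" "finite G"
      "\<forall>J\<in>G. \<exists>u v. J = {u<..<v}" "Collect P \<inter> {b<..<c} = F \<union> \<Union>G"
    using locally_o_minimal unfolding locally_o_minimal_def by metis
  have "good (Collect P \<inter> {b<..<c})"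
    unfolding FG(4) using FG by (intro Un fin fin_Un)
  then obtain b' c' where bc': "b' < a" "a < c'"
      "(\<forall>t. b' < t \<and> t < a \<longrightarrow> t \<in> Collect P \<inter> {b<..<c}) \<or>
       (\<forall>t. b' < t \<and> t < a \<longrightarrow> t \<notin> Collect P \<inter> {b<..<c})"
      "(\<forall>t. a < t \<and> t < c' \<longrightarrow> t \<in> Collect P \<inter> {b<..<c}) \<or>
       (\<forall>t. a < t \<and> t < c' \<longrightarrow> t \<notin> Collect P \<inter> {b<..<c})"
    unfolding good_def by blast
  show ?thesis
    by (rule exI[of _ "max b b'"], rule exI[of _ "min c c'"]) (use bc bc' in auto)
qed

text \<open>A one-sided germ on which \<open>P\<close> holds would be an interval, so both germs
  avoid \<open>P\<close>. As \<open>a\<close> is an arbitrary point of the line, \<open>P\<close> is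
  closed as well as discrete.\<close>

lemma isolated:
  assumes "dfn S (\<lambda>w. P (w 0 0))" "\<not> has_interval P"
  obtains b c where "b < a" "a < c" "\<And>t. b < t \<Longrightarrow> t < c \<Longrightarrow> P t \<Longrightarrow> t = a"
proof -
  obtain b c where bc: "b < a" "a < c"
      "(\<forall>t. b < t \<and> t < a \<longrightarrow> P t) \<or> (\<forall>t. b < t \<and> t < a \<longrightarrow> \<not> P t)"
      "(\<forall>t. a < t \<and> t < c \<longrightarrow> P t) \<or> (\<forall>t. a < t \<and> t < c \<longrightarrow> \<not> P t)"
    using germs[OF assms(1), of a] by blast
  have "\<not> (\<forall>t. b < t \<and> t < a \<longrightarrow> P t)" "\<not> (\<forall>t. a < t \<and> t < c \<longrightarrow> P t)"
    using assms(2) bc(1,2) unfolding has_interval_def by blast+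
  then have no: "\<forall>t. b < t \<and> t < a \<longrightarrow> \<not> P t" "\<forall>t. a < t \<and> t < c \<longrightarrow> \<not> P t"
    using bc(3,4) by blast+
  have "t = a" if "b < t" "t < c" "P t" for t
    using no that by (meson linorder_neqE)
  then show thesis by (rule that[OF bc(1,2)])
qed

text \<open>Otherwise \<open>P\<close> and \<open>Q\<close> would both be closed and discrete, and
  both would miss a right neighbourhood of the left end of the interval that they cover.\<close>

lemma has_interval_disj:
  assumes "dfn S (\<lambda>w. P (w 0 0))" "dfn S (\<lambda>w. Q (w 0 0))" "has_interval (\<lambda>t. P t \<or> Q t)"
  shows "has_interval P \<or> has_interval Q"
proof (rule ccontr)
  assume no: "\<not> ?thesis"
  obtain p q where pq: "p < q" "\<And>t. p < t \<Longrightarrow> t < q \<Longrightarrow> P t \<or> Q t"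
    using assms(3) unfolding has_interval_def by blast
  obtain b c where bc: "b < p" "p < c" "\<And>t. b < t \<Longrightarrow> t < c \<Longrightarrow> P t \<Longrightarrow> t = p"
    using isolated[OF assms(1)] no by metis
  obtain b' c' where bc': "b' < p" "p < c'" "\<And>t. b' < t \<Longrightarrow> t < c' \<Longrightarrow> Q t \<Longrightarrow> t = p"
    using isolated[OF assms(2)] no by metis
  obtain t where t: "p < t" "t < min q (min c c')"
    using dense[of p "min q (min c c')"] pq(1) bc(2) bc'(2) by auto
  then have "P t \<or> Q t" using pq(2) by simp
  moreover have "b < t" "b' < t" using t(1) bc(1) bc'(1) by (blast intro: less_trans)+
  ultimately show False using bc(3)[of t] bc'(3)[of t] t by auto
qed

section \<open>Consequences of definable completeness and of property (a)\<close>

lemma definable_Sup: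
  assumes "dfn S (\<lambda>w. P (w 0 0))" "P t0" "\<And>t. P t \<Longrightarrow> t \<le> u"
  shows "\<exists>s. (\<forall>t. P t \<longrightarrow> t \<le> s) \<and> (\<forall>v<s. \<exists>t. P t \<and> v < t)"
proof -
  have "definable1 S (Collect P)" using assms(1) by (intro dfn_definable1) simp
  then obtain s :: "'a extended" where s: "isLub UNIV (Fin ` Collect P) s"
    using complete unfolding definably_complete_def by blast
  have ub: "Fin t \<le> s" if "P t" for t
    using isLubD2[OF s] that by auto
  have least: "s \<le> Fin v" if "\<And>t. P t \<Longrightarrow> t \<le> v" for v
    by (rule isLub_le_isUb[OF s]) (use that in \<open>auto simp: isUb_def setle_def\<close>)
  \<comment> \<open>The element \<open>t0\<close> excludes the value \<open>Minf\<close>, and the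
    bound \<open>u\<close> excludes \<open>Pinf\<close>.\<close>
  obtain s' where s': "s = Fin s'"
    using ub[OF assms(2)] least[OF assms(3)] by (cases s) auto
  have "t \<le> s'" if "P t" for t using ub[OF that] s' by simp
  moreover have "\<exists>t. P t \<and> v < t" if "v < s'" for v
  proof (rule ccontr)
    assume "\<not> ?thesis"
    then have "s \<le> Fin v" by (intro least) (meson leI)
    then show False using that s' by simp
  qed
  ultimately show ?thesis by blast
qed

text \<open>Obtained as the supremum of the definable set of lower bounds.\<close>

lemma definable_Inf:
  assumes "dfn S (\<lambda>w. P (w 0 0))" "P t0" "\<And>t. P t \<Longrightarrow> u \<le> t"
  shows "\<exists>s. (\<forall>t. P t \<longrightarrow> s \<le> t) \<and> (\<forall>v>s. \<exists>t. P t \<and> t < v)"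
proof -
  have "dfn S (\<lambda>w. \<forall>t. P t \<longrightarrow> w 0 0 \<le> t)"
    by (intro dfn_intros) (rule dfn_subst[OF assms(1), of "\<lambda>w _ _. w 0 0"], rule atomic_intros)
  moreover have "\<forall>t. P t \<longrightarrow> u \<le> t" using assms(3) by blast
  moreover have "v \<le> t0" if "\<forall>t. P t \<longrightarrow> v \<le> t" for v using that assms(2) by blast
  ultimately have "\<exists>s. (\<forall>v. (\<forall>t. P t \<longrightarrow> v \<le> t) \<longrightarrow> v \<le> s) \<and>
      (\<forall>v<s. \<exists>u. (\<forall>t. P t \<longrightarrow> u \<le> t) \<and> v < u)"
    by (rule definable_Sup[of "\<lambda>v. \<forall>t. P t \<longrightarrow> v \<le> t" u t0])
  then obtain s where s: "\<And>v. \<forall>t. P t \<longrightarrow> v \<le> t \<Longrightarrow> v \<le> s"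
      "\<And>v. v < s \<Longrightarrow> \<exists>u. (\<forall>t. P t \<longrightarrow> u \<le> t) \<and> v < u" by blast
  have "s \<le> t" if "P t" for t
  proof (rule ccontr)
    assume "\<not> s \<le> t"
    then obtain u where "\<forall>t. P t \<longrightarrow> u \<le> t" "t < u" using s(2)[of t] by (auto simp: not_le)
    then show False using that by (auto dest: spec[of _ t])
  qed
  moreover have "\<exists>t. P t \<and> t < v" if "s < v" for v
  proof (rule ccontr)
    assume "\<not> ?thesis"
    then have "v \<le> s" by (intro s(1)) (meson leI)
    then show False using that by simp
  qed
  ultimately show ?thesis by blast
qed

text \<open>The form in which property (a) enters the proof: the projection to one coordinate is a
  discrete subset of the line, while every point of an interval is a limit of other points of
  it.\<close>

lemma discrete_coordinate:
  assumes "definable S n X" "discrete_set n X" "i < n"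
  shows "\<not> has_interval (\<lambda>t. \<exists>x\<in>X. x i = t)"
proof
  assume "has_interval (\<lambda>t. \<exists>x\<in>X. x i = t)"
  then obtain p q where pq: "p < q" "\<And>t. p < t \<Longrightarrow> t < q \<Longrightarrow> \<exists>x\<in>X. x i = t"
    unfolding has_interval_def by blast
  obtain s where s: "p < s" "s < q" using dense[OF pq(1)] by blast
  have pi: "proj_index n 1 (\<lambda>_. i)"
    using assms(3) by (auto simp: proj_index_def strict_mono_on_def)
  have "X \<noteq> {}" using pq(2)[OF s] by blast
  then have disc: "discrete_set 1 (coord_map 1 (\<lambda>_. i) ` X)"
    using property_a assms(1,2) pi unfolding property_a_def by blast
  define e where "e t = (\<lambda>k\<in>{..<1::nat}. t :: 'a)" for t
  have e: "e t \<in> coord_map 1 (\<lambda>_. i) ` X" if t: "p < t" "t < q" for t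
  proof -
    obtain x where "x \<in> X" "x i = t" using pq(2)[OF t] by blast
    then show ?thesis by (intro image_eqI[of _ _ x]) (auto simp: coord_map_def e_def)
  qed
  obtain a b where ab: "e s \<in> open_box 1 a b"
      "coord_map 1 (\<lambda>_. i) ` X \<inter> open_box 1 a b \<subseteq> {e s}"
    using disc e[OF s] unfolding discrete_set_iff by blast
  have box: "e t \<in> open_box 1 a b \<longleftrightarrow> a 0 < t \<and> t < b 0" for t
    by (simp add: open_box_def e_def restrict_in_cart_pow)
  obtain t where t: "s < t" "t < min (b 0) q"
    using dense[of s "min (b 0) q"] ab(1) s(2) box by auto
  then have "e t \<in> coord_map 1 (\<lambda>_. i) ` X \<inter> open_box 1 a b"
    using e[of t] ab(1) s(1) t unfolding box Int_iff by (auto intro: less_trans)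
  then have "e t = e s" using ab(2) by blast
  then have "e t 0 = e s 0" by simp
  then show False using t(1) by (simp add: e_def)
qed

text \<open>
  If no line \<open>R _ t\<close> contained an interval, then the triples consisting of a point \<open>x\<close> and the
  endpoints of a convex component of \<open>R x\<close> would form a discrete set, whose projection to the
  first coordinate is the whole of \<open>A\<close>, against property (a). The flags \<open>lo\<close> and \<open>hi\<close> tell which
  endpoints are finite; an infinite endpoint is replaced by a dummy value \<open>d\<close>.
\<close>

lemma uniform_point_line:
  assumes A: "dfn S (\<lambda>w. A (w 0 0))" "has_interval A"
    and R: "dfn S (\<lambda>w. R (w 0 0) (w 1 0))" "\<And>x. A x \<Longrightarrow> has_interval (R x)"
  shows "\<exists>t. has_interval (\<lambda>x. A x \<and> R x t)"
proof (rule ccontr)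
  assume no: "\<not> ?thesis"
  define J where "J lo hi a b t \<longleftrightarrow> (lo \<longrightarrow> a < t) \<and> (hi \<longrightarrow> t < b)" for lo hi and a b t :: 'a
  define d :: 'a where "d = undefined"
  \<comment> \<open>An endpoint may itself belong to \<open>R x\<close>. The clauses on
    \<open>u\<close> only say that points outside \<open>R x\<close> occur at the endpoint or
    arbitrarily close beyond it, so the component cannot be enlarged.\<close>
  define E where "E lo hi x a b \<longleftrightarrow> A x \<and> (\<exists>t. J lo hi a b t) \<and> (\<forall>t. J lo hi a b t \<longrightarrow> R x t) \<and>
      (lo \<longrightarrow> (\<forall>u. u < a \<longrightarrow> (\<exists>t. u < t \<and> t \<le> a \<and> \<not> R x t))) \<and>
      (hi \<longrightarrow> (\<forall>u. b < u \<longrightarrow> (\<exists>t. b \<le> t \<and> t < u \<and> \<not> R x t))) \<and>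
      (\<not> lo \<longrightarrow> a = d) \<and> (\<not> hi \<longrightarrow> b = d)" for lo hi x a b
  define T where "T lo hi = {z \<in> cart_pow 3. E lo hi (z 0) (z 1) (z 2)}" for lo hi
  have A': "dfn S (\<lambda>w. A (s w))" if "atomic_term s" for s
    by (rule dfn_subst[OF A(1), of "\<lambda>w _ _. s w"]) (rule that)
  have R': "dfn S (\<lambda>w. R (s w) (t w))" if "atomic_term s" "atomic_term t" for s t
    by (rule dfn_rel_elem[OF R(1) that])
  have T: "definable S 3 (T lo hi)" for lo hi
    unfolding T_def E_def J_def by (rule dfn_definable) (intro dfn_intros A' R')
  have "discrete_set 3 (T lo hi)" for lo hi
    unfolding discrete_set_iff
  proof (intro conjI ballI)
    show "T lo hi \<subseteq> cart_pow 3" by (auto simp: T_def)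
    fix z assume "z \<in> T lo hi"
    then have z: "z \<in> cart_pow 3" and E: "E lo hi (z 0) (z 1) (z 2)" by (auto simp: T_def)
    obtain s where s: "J lo hi (z 1) (z 2) s" using E unfolding E_def by blast
    \<comment> \<open>By the assumption to be refuted, the points of \<open>A\<close> with
      \<open>R x s\<close> contain no interval; their isolation is what isolates the first
      coordinate of \<open>z\<close>.\<close>
    have "dfn S (\<lambda>w. A (w 0 0) \<and> R (w 0 0) s)" by (intro dfn_intros A' R')
    moreover have "\<not> has_interval (\<lambda>x. A x \<and> R x s)" using no by blast
    ultimately obtain l r where lr: "l < z 0" "z 0 < r"
        "\<And>x. l < x \<Longrightarrow> x < r \<Longrightarrow> A x \<and> R x s \<Longrightarrow> x = z 0"
      using isolated[of "\<lambda>x. A x \<and> R x s" "z 0"] by blast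
    obtain l1 u1 l2 u2 where lu: "l1 < z 1" "z 1 < u1" "l2 < z 2" "z 2 < u2"
      using lt_ex gt_ex by metis
    \<comment> \<open>A finite left endpoint is kept below \<open>s\<close> and a finite right
      endpoint above it, so that \<open>s\<close> lies in the component described by any point of
      \<open>T lo hi\<close> in the box. The other bounds are arbitrary.\<close>
    define a where "a = (\<lambda>i::nat. if i = 0 then l else if i = 1 then l1 else if hi then s else l2)"
    define b where "b = (\<lambda>i::nat. if i = 0 then r else if i = 1 then if lo then s else u1 else u2)"
    have three: "(\<forall>i<3. P i) \<longleftrightarrow> P 0 \<and> P 1 \<and> P 2" for P :: "nat \<Rightarrow> bool"
      by (auto simp: less_Suc_eq numeral_3_eq_3 numeral_2_eq_2)
    have "z \<in> open_box 3 a b"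
      using z lr(1,2) lu s unfolding open_box_def three by (simp add: a_def b_def J_def)
    moreover have "y = z" if y: "y \<in> T lo hi" "y \<in> open_box 3 a b" for y
    proof -
      have Ey: "E lo hi (y 0) (y 1) (y 2)" and yc: "y \<in> cart_pow 3" using y(1) by (auto simp: T_def)
      have yb: "l < y 0" "y 0 < r" "J lo hi (y 1) (y 2) s"
        using y(2) unfolding open_box_def three by (auto simp: a_def b_def J_def)
      have y0: "y 0 = z 0" using Ey yb by (intro lr(3)) (auto simp: E_def)
      \<comment> \<open>Two components of the same \<open>R x\<close> that share \<open>s\<close>
        have the same endpoints: a point outside \<open>R x\<close> at or just below the larger left
        endpoint would lie inside the component that starts earlier. The right endpoints are treated
        symmetrically.\<close>
      have left: "\<not> a < a'" if h: "E lo hi x a b" "E lo hi x a' b'" "J lo hi a b s" "J lo hi a' b' s" lo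
        for x a b a' b'
      proof
        assume "a < a'"
        then obtain t where t: "a < t" "t \<le> a'" "\<not> R x t" using h(2,5) unfolding E_def by blast
        have "J lo hi a b t" using h(3,4,5) t(1,2) by (auto simp: J_def)
        moreover have "\<forall>t. J lo hi a b t \<longrightarrow> R x t" using h(1) by (simp add: E_def)
        ultimately show False using t(3) by blast
      qed
      have right: "\<not> b' < b" if h: "E lo hi x a b" "E lo hi x a' b'" "J lo hi a b s" "J lo hi a' b' s" hi
        for x a b a' b'
      proof
        assume "b' < b"
        then obtain t where t: "b' \<le> t" "t < b" "\<not> R x t" using h(2,5) unfolding E_def by blast
        have "J lo hi a b t" using h(3,4,5) t(1,2) by (auto simp: J_def)
        moreover have "\<forall>t. J lo hi a b t \<longrightarrow> R x t" using h(1) by (simp add: E_def)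
        ultimately show False using t(3) by blast
      qed
      have "y 1 = z 1"
      proof (cases lo)
        case True
        then show ?thesis
          using left[of "y 0" "y 1" "y 2" "z 1" "z 2"] left[of "y 0" "z 1" "z 2" "y 1" "y 2"]
            Ey E y0 yb(3) s by auto
      next
        case False
        then show ?thesis using Ey E by (simp add: E_def)
      qed
      moreover have "y 2 = z 2"
      proof (cases hi)
        case True
        then show ?thesis
          using right[of "y 0" "y 1" "y 2" "z 1" "z 2"] right[of "y 0" "z 1" "z 2" "y 1" "y 2"]
            Ey E y0 yb(3) s by auto
      next
        case False
        then show ?thesis using Ey E by (simp add: E_def)
      qed
      ultimately have "\<forall>i<3. y i = z i" using y0 unfolding three by simp
      then show ?thesis using yc z unfolding cart_pow_def by (intro PiE_ext) auto
    qed
    ultimately show "\<exists>a b. z \<in> open_box 3 a b \<and> T lo hi \<inter> open_box 3 a b \<subseteq> {z}" by blast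
  qed
  then have noT: "\<not> has_interval (\<lambda>x. \<exists>z\<in>T lo hi. z 0 = x)" for lo hi
    by (rule discrete_coordinate[OF T]) simp
  have dT: "dfn S (\<lambda>w. \<exists>z\<in>T lo hi. z 0 = w 0 0)" for lo hi
  proof -
    have "dfn S (\<lambda>w. \<exists>z\<in>cart_pow 3. z \<in> T lo hi \<and> z 0 = w 0 0)"
      by (intro dfn_intros dfn_mem[OF T])
    moreover have "(\<exists>z\<in>cart_pow 3. z \<in> T lo hi \<and> z 0 = x) \<longleftrightarrow> (\<exists>z\<in>T lo hi. z 0 = x)" for x
      by (auto simp: T_def)
    ultimately show ?thesis by simp
  qed
  have ex: "\<exists>lo hi. \<exists>z\<in>T lo hi. z 0 = x" if x: "A x" for x
  proof -
    obtain p q where pq: "p < q" "\<And>t. p < t \<Longrightarrow> t < q \<Longrightarrow> R x t"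
      using R(2)[OF x] unfolding has_interval_def by blast
    obtain s where s: "p < s" "s < q" using dense[OF pq(1)] by blast
    have dR: "dfn S (\<lambda>w. w 0 0 < s \<and> \<not> R x (w 0 0))" "dfn S (\<lambda>w. s < w 0 0 \<and> \<not> R x (w 0 0))"
      by (intro dfn_intros R')+
    define lo where "lo \<longleftrightarrow> (\<exists>y. y < s \<and> \<not> R x y)"
    define hi where "hi \<longleftrightarrow> (\<exists>y. s < y \<and> \<not> R x y)"
    \<comment> \<open>The left endpoint is the supremum of the points below \<open>s\<close> outside
      \<open>R x\<close>, provided there are any; they are all bounded by \<open>p\<close>, which
      keeps the supremum below \<open>s\<close>.\<close>
    have "\<exists>a. (lo \<longrightarrow> a < s \<and> (\<forall>t. a < t \<and> t < s \<longrightarrow> R x t) \<and>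
        (\<forall>u. u < a \<longrightarrow> (\<exists>t. u < t \<and> t \<le> a \<and> \<not> R x t))) \<and> (\<not> lo \<longrightarrow> a = d)"
    proof (cases lo)
      case True
      then obtain y where y: "y < s \<and> \<not> R x y" unfolding lo_def by blast
      have bd: "t \<le> p" if "t < s \<and> \<not> R x t" for t
        using that pq(2)[of t] s by (meson leI less_trans)
      obtain a where a: "\<And>t. t < s \<and> \<not> R x t \<Longrightarrow> t \<le> a"
          "\<And>v. v < a \<Longrightarrow> \<exists>t. (t < s \<and> \<not> R x t) \<and> v < t"
        using definable_Sup[of "\<lambda>t. t < s \<and> \<not> R x t" y p, OF dR(1) y bd] by blast
      have "a < s" using a(2)[of p] bd s(1) by (meson leD leI le_less_trans)
      then show ?thesis using a True by (intro exI[of _ a]) (meson leD)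
    qed auto
    then obtain a where a: "lo \<Longrightarrow> a < s" "\<And>t. lo \<Longrightarrow> a < t \<Longrightarrow> t < s \<Longrightarrow> R x t"
        "\<And>u. lo \<Longrightarrow> u < a \<Longrightarrow> \<exists>t. u < t \<and> t \<le> a \<and> \<not> R x t" "\<not> lo \<Longrightarrow> a = d" by blast
    have "\<exists>b. (hi \<longrightarrow> s < b \<and> (\<forall>t. s < t \<and> t < b \<longrightarrow> R x t) \<and>
        (\<forall>u. b < u \<longrightarrow> (\<exists>t. b \<le> t \<and> t < u \<and> \<not> R x t))) \<and> (\<not> hi \<longrightarrow> b = d)"
    proof (cases hi)
      case True
      then obtain y where y: "s < y \<and> \<not> R x y" unfolding hi_def by blast
      have bd: "q \<le> t" if "s < t \<and> \<not> R x t" for t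
        using that pq(2)[of t] s by (meson leI less_trans)
      obtain b where b: "\<And>t. s < t \<and> \<not> R x t \<Longrightarrow> b \<le> t"
          "\<And>v. b < v \<Longrightarrow> \<exists>t. (s < t \<and> \<not> R x t) \<and> t < v"
        using definable_Inf[of "\<lambda>t. s < t \<and> \<not> R x t" y q, OF dR(2) y bd] by blast
      have "s < b" using b(2)[of q] bd s(2) by (meson leD leI less_le_trans)
      then show ?thesis using b True by (intro exI[of _ b]) (meson leD)
    qed auto
    then obtain b where b: "hi \<Longrightarrow> s < b" "\<And>t. hi \<Longrightarrow> s < t \<Longrightarrow> t < b \<Longrightarrow> R x t"
        "\<And>u. hi \<Longrightarrow> b < u \<Longrightarrow> \<exists>t. b \<le> t \<and> t < u \<and> \<not> R x t" "\<not> hi \<Longrightarrow> b = d" by blast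
    have Rx: "R x t" if t: "J lo hi a b t" for t
    proof -
      consider "t < s" | "t = s" | "s < t" by fastforce
      then show ?thesis
      proof cases
        case 1 then show ?thesis using a(2)[of t] t lo_def by (auto simp: J_def)
      next
        case 2 then show ?thesis using pq(2) s by simp
      next
        case 3 then show ?thesis using b(2)[of t] t hi_def by (auto simp: J_def)
      qed
    qed
    have "J lo hi a b s" using a(1) b(1) by (simp add: J_def)
    then have "E lo hi x a b"
      unfolding E_def using x Rx a(3,4) b(3,4) by blast
    then have "(\<lambda>i\<in>{..<3::nat}. if i = 0 then x else if i = 1 then a else b) \<in> T lo hi"
      by (simp add: T_def restrict_in_cart_pow)
    then have "\<exists>z\<in>T lo hi. z 0 = x" by (rule rev_bexI) simp
    then show ?thesis by blast
  qed
  define U where "U lo hi x \<longleftrightarrow> (\<exists>z\<in>T lo hi. z 0 = x)" for lo hi x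
  have dU: "dfn S (\<lambda>w. U lo hi (w 0 0))" and noU: "\<not> has_interval (U lo hi)" for lo hi
    using dT[of lo hi] noT[of lo hi] by (simp_all add: U_def[abs_def])
  \<comment> \<open>The four pairs of flags cover \<open>A\<close>, so one of the four projections
    would contain an interval.\<close>
  have "has_interval (\<lambda>x. (U True True x \<or> U True False x) \<or> (U False True x \<or> U False False x))"
    using A(2)
  proof (rule has_interval_mono)
    fix x assume "A x"
    then obtain lo hi where "U lo hi x" using ex unfolding U_def by blast
    then show "(U True True x \<or> U True False x) \<or> (U False True x \<or> U False False x)"
      by (cases lo; cases hi) simp_all
  qed
  from has_interval_disj[OF dfn_disj[OF dU dU] dfn_disj[OF dU dU] this] show False
    using has_interval_disj[OF dU dU] noU by blast
qed

end

section \<open>Uniform choice of points and boxes in fibres\<close>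

lemma dfn_has_interval:
  assumes "dfn S (\<lambda>w. Q (\<lambda>j. w (Suc j)) (w 0 0))"
  shows "dfn S (\<lambda>w. has_interval (Q w))"
proof -
  \<comment> \<open>Unfolding \<open>has_interval\<close> puts its endpoints \<open>p\<close> and
    \<open>q\<close> between the bound point and the outer environment; the substitution moves the
    outer tuples two places on to make room for them.\<close>
  have "atomic_term (\<lambda>w. (if j = 0 then w 0 else w (Suc (Suc j))) k)" for j k :: nat
    by (cases "j = 0") (simp_all add: atomic_var)
  from dfn_subst[of S _ "\<lambda>w j. if j = 0 then w 0 else w (Suc (Suc j))", OF assms this]
  have "dfn S (\<lambda>w. Q (\<lambda>j. w (Suc (Suc (Suc j)))) (w 0 0))"
    by simp
  then show ?thesis unfolding has_interval_def by (intro dfn_intros)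
qed

lemma dfn_has_interior:
  assumes "dfn S (\<lambda>w. Q (\<lambda>j. w (Suc j)) (restrict (w 0) {..<k}))"
  shows "dfn S (\<lambda>w. has_interior k {x. Q w x})"
proof -
  have "atomic_term (\<lambda>w. (if j = 0 then w 0 else w (Suc (Suc j))) k)" for j k :: nat
    by (cases "j = 0") (simp_all add: atomic_var)
  from dfn_subst[of S _ "\<lambda>w j. if j = 0 then w 0 else w (Suc (Suc j))", OF assms this]
  have "dfn S (\<lambda>w. Q (\<lambda>j. w (Suc (Suc (Suc j)))) (restrict (w 0) {..<k}))"
    by simp
  then have "dfn S (\<lambda>w. \<exists>a\<in>cart_pow k. \<exists>b\<in>cart_pow k. (\<forall>i<k. a i < b i) \<and>
      (\<forall>x\<in>cart_pow k. (\<forall>i<k. a i < x i \<and> x i < b i) \<longrightarrow> Q w x))"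
    by (intro dfn_intros)
  moreover have "has_interior k {x. Q w x} \<longleftrightarrow> (\<exists>a\<in>cart_pow k. \<exists>b\<in>cart_pow k. (\<forall>i<k. a i < b i) \<and>
      (\<forall>x\<in>cart_pow k. (\<forall>i<k. a i < x i \<and> x i < b i) \<longrightarrow> Q w x))" for w
    unfolding has_interior_def open_box_def by blast
  ultimately show ?thesis by simp
qed

lemma dfn_in_open_box:
  assumes "\<And>i. atomic_term (\<lambda>w. f w i)" "\<And>i. atomic_term (\<lambda>w. a w i)"
    "\<And>i. atomic_term (\<lambda>w. b w i)" "\<And>w. f w \<in> cart_pow n"
  shows "dfn S (\<lambda>w. f w \<in> open_box n (a w) (b w))"
proof -
  have "dfn S (\<lambda>w. \<forall>i<n. a w i < f w i \<and> f w i < b w i)"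
    by (intro dfn_intros assms)
  then show ?thesis using assms(4) by (simp add: open_box_def)
qed

lemma dfn_ball_open_box:
  assumes "dfn S (\<lambda>w. Q (\<lambda>j. w (Suc j)) (restrict (w 0) {..<n}))"
    "\<And>i. atomic_term (\<lambda>w. a w i)" "\<And>i. atomic_term (\<lambda>w. b w i)"
  shows "dfn S (\<lambda>w. \<forall>x\<in>open_box n (a w) (b w). Q w x)"
proof -
  have "atomic_term (\<lambda>w. a (\<lambda>j. w (Suc j)) i)" "atomic_term (\<lambda>w. b (\<lambda>j. w (Suc j)) i)" for i
    by (rule atomic_comp[OF assms(2)] atomic_comp[OF assms(3)], rule atomic_var)+
  then have "dfn S (\<lambda>w. \<forall>x\<in>cart_pow n. (\<forall>i<n. a w i < x i \<and> x i < b w i) \<longrightarrow> Q w x)"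
    by (intro dfn_intros assms(1))
  moreover have "(\<forall>x\<in>cart_pow n. (\<forall>i<n. a w i < x i \<and> x i < b w i) \<longrightarrow> Q w x) \<longleftrightarrow>
      (\<forall>x\<in>open_box n (a w) (b w). Q w x)" for w
    by (auto simp: open_box_def)
  ultimately show ?thesis by simp
qed

lemma has_interior_cong:
  "(\<And>z. z \<in> cart_pow m \<Longrightarrow> P z = Q z) \<Longrightarrow> has_interior m {z. P z} = has_interior m {z. Q z}"
  unfolding has_interior_def open_box_def by blast

lemma dfn_rel_tuple_elem:
  assumes "dfn S (\<lambda>w. R (restrict (w 0) {..<m}) (w 1 0))"
    and "\<And>i. atomic_term (\<lambda>w. f w i)" "\<And>w. f w \<in> cart_pow m" "atomic_term s"
  shows "dfn S (\<lambda>w. R (f w) (s w))"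
proof -
  have "dfn S (\<lambda>w. R (restrict (f w) {..<m}) (s w))"
    using dfn_subst[OF assms(1), of "\<lambda>w j. if j = 0 then f w else (\<lambda>_. s w)"] assms(2,4)
    by (simp add: if_distribR atomic_if)
  then show ?thesis using assms(3) by (simp add: restrict_cart_pow)
qed

lemma dfn_bex_finite:
  assumes "finite I" "\<And>i. i \<in> I \<Longrightarrow> dfn S (P i)"
  shows "dfn S (\<lambda>w. \<exists>i\<in>I. P i w)"
  using assms
proof (induction I)
  case (insert i I)
  then have "dfn S (\<lambda>w. P i w \<or> (\<exists>i\<in>I. P i w))" by (intro dfn_disj) simp_all
  then show ?case by simp
qed (simp add: dfn_const)

context tame_structure
begin

text \<open>Endpoints are fixed one after the other. For each \<open>x\<close> the admissible left
  endpoints contain an interval, so one \<open>u\<close> serves an interval of \<open>x\<close>; for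
  this \<open>u\<close> the admissible right endpoints contain an interval as well, because
  shortening preserves admissibility.\<close>

lemma uniform_interval_line:
  assumes A: "dfn S (\<lambda>w. A (w 0 0))" "has_interval A"
    and R: "dfn S (\<lambda>w. R (w 0 0) (w 1 0))" "\<And>x. A x \<Longrightarrow> has_interval (R x)"
  shows "\<exists>u v. u < v \<and> has_interval (\<lambda>x. A x \<and> (\<forall>t. u < t \<and> t < v \<longrightarrow> R x t))"
proof -
  have A': "dfn S (\<lambda>w. A (s w))" if "atomic_term s" for s
    by (rule dfn_subst[OF A(1), of "\<lambda>w _ _. s w"]) (rule that)
  have R': "dfn S (\<lambda>w. R (s w) (t w))" if "atomic_term s" "atomic_term t" for s t
    by (rule dfn_rel_elem[OF R(1) that])
  define B where "B u v x \<longleftrightarrow> u < v \<and> (\<forall>t. u < t \<and> t < v \<longrightarrow> R x t)" for u v x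
  have B: "dfn S (\<lambda>w. B (s w) (t w) (u w))"
    if "atomic_term s" "atomic_term t" "atomic_term u" for s t u
  proof -
    have "dfn S (\<lambda>w. w 0 0 < w 1 0 \<and> (\<forall>t. w 0 0 < t \<and> t < w 1 0 \<longrightarrow> R (w 2 0) t))"
      by (intro dfn_intros R')
    from dfn_subst[OF this, of "\<lambda>w j _. if j = 0 then s w else if j = 1 then t w else u w"]
    show ?thesis using that by (simp add: B_def atomic_if)
  qed
  have dB: "dfn S (\<lambda>w. \<exists>v. B (w 1 0) v (w 0 0))"
    by (intro dfn_intros B)
  have "has_interval (\<lambda>u. \<exists>v. B u v x)" if x: "A x" for x
  proof -
    obtain p q where "p < q" "\<And>t. p < t \<Longrightarrow> t < q \<Longrightarrow> R x t"
      using R(2)[OF x] unfolding has_interval_def by blast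
    then have "B u q x" if "p < u" "u < q" for u
      using that unfolding B_def by (meson less_trans)
    then show ?thesis using \<open>p < q\<close> unfolding has_interval_def by blast
  qed
  then obtain u where u: "has_interval (\<lambda>x. A x \<and> (\<exists>v. B u v x))"
    using uniform_point_line[OF A, of "\<lambda>x u. \<exists>v. B u v x"] dB by blast
  have dB': "dfn S (\<lambda>w. A (w 0 0) \<and> (\<exists>v. B u v (w 0 0)))" "dfn S (\<lambda>w. B u (w 1 0) (w 0 0))"
    by (intro dfn_intros B A')+
  have "has_interval (\<lambda>v. B u v x)" if ex: "A x \<and> (\<exists>v. B u v x)" for x
  proof -
    obtain v where v: "B u v x" using ex by blast
    then have "B u v' x" if "u < v'" "v' < v" for v'
      using that unfolding B_def by (meson less_trans)
    then show ?thesis using v unfolding has_interval_def B_def by blast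
  qed
  then obtain v where v: "has_interval (\<lambda>x. (A x \<and> (\<exists>v. B u v x)) \<and> B u v x)"
    using uniform_point_line[of "\<lambda>x. A x \<and> (\<exists>v. B u v x)" "\<lambda>x v. B u v x", OF _ u] dB'
    by blast
  then have "has_interval (\<lambda>x. A x \<and> (\<forall>t. u < t \<and> t < v \<longrightarrow> R x t))"
    by (rule has_interval_mono) (auto simp: B_def)
  moreover have "u < v"
    using v dense unfolding has_interval_def B_def by blast
  ultimately show ?thesis by blast
qed

text \<open>Uniformity over M^m for a single fibre coordinate, named for the induction on
  \<open>m\<close>: the step to \<open>Suc m\<close> needs it for three fibre coordinates, which
  \<open>uniform_at_point\<close> supplies.\<close>

definition uniform_at :: "nat \<Rightarrow> bool" where
  "uniform_at m \<longleftrightarrow> (\<forall>A R. dfn S (\<lambda>w. A (restrict (w 0) {..<m})) \<longrightarrow>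
     dfn S (\<lambda>w. R (restrict (w 0) {..<m}) (w 1 0)) \<longrightarrow> has_interior m {z. A z} \<longrightarrow>
     (\<forall>z\<in>cart_pow m. A z \<longrightarrow> has_interval (R z)) \<longrightarrow> (\<exists>t. has_interior m {z. A z \<and> R z t}))"

text \<open>The last coordinate of \<open>y\<close> is fixed first: the values whose slice has
  interior contain an interval, so one of them serves an open set of \<open>z\<close>. The base
  shrinks to the \<open>z\<close> for which it works, and the induction hypothesis finds the other
  coordinates.\<close>

lemma uniform_at_point:
  assumes U: "uniform_at m"
    and "dfn S (\<lambda>w. A (restrict (w 0) {..<m}))"
    and "dfn S (\<lambda>w. R (restrict (w 0) {..<m}) (restrict (w 1) {..<k}))"
    and "has_interior m {z. A z}"
    and "\<And>z. z \<in> cart_pow m \<Longrightarrow> A z \<Longrightarrow> has_interior k {y. R z y}"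
  shows "\<exists>y\<in>cart_pow k. has_interior m {z. A z \<and> R z y}"
  using assms(2-)
proof (induction k arbitrary: A R)
  case 0
  have "has_interior m {z. A z \<and> R z (\<lambda>_. undefined)} = has_interior m {z. A z}"
    using "0.prems"(4) by (intro has_interior_cong) (auto simp: has_interior_0)
  then show ?case using "0.prems"(3) by (simp add: cart_pow_0)
next
  case (Suc k)
  note A' = dfn_rel1[OF Suc.prems(1)] and R' = dfn_rel2[OF Suc.prems(2)]
  have d: "dfn S (\<lambda>w. has_interior k {y. R (restrict (w 0) {..<m}) (y(k := w 1 0))})"
    by (rule dfn_has_interior, rule R') (intro dfn_intros)+
  have "has_interval (\<lambda>t. has_interior k {y. R z (y(k := t))})" if z: "z \<in> cart_pow m" "A z" for z
  proof -
    obtain a b where ab: "\<And>i. i < Suc k \<Longrightarrow> a i < b i" "open_box (Suc k) a b \<subseteq> {y. R z y}"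
      using has_interiorE[OF Suc.prems(4)[OF z]] by metis
    have "has_interior k {y. R z (y(k := t))}" if t: "a k < t" "t < b k" for t
    proof (rule has_interiorI)
      show "open_box k a b \<subseteq> {y. R z (y(k := t))}"
        using ab(2) t upd_in_open_box[of _ k t a b] open_box_subset[of k a b] by blast
    qed (simp add: ab(1))
    then show ?thesis using ab(1)[of k] unfolding has_interval_def by blast
  qed
  then obtain t where t: "has_interior m {z. A z \<and> has_interior k {y. R z (y(k := t))}}"
    using U[unfolded uniform_at_def, rule_format, OF Suc.prems(1) d Suc.prems(3)] by blast
  have "\<exists>y\<in>cart_pow k. has_interior m
      {z. (A z \<and> has_interior k {y. R z (y(k := t))}) \<and> R z (y(k := t))}"
  proof (rule Suc.IH)
    show "dfn S (\<lambda>w. A (restrict (w 0) {..<m}) \<and>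
        has_interior k {y. R (restrict (w 0) {..<m}) (y(k := t))})"
      by (intro dfn_intros A' dfn_has_interior R')
    show "dfn S (\<lambda>w. R (restrict (w 0) {..<m}) ((restrict (w 1) {..<k})(k := t)))"
      by (intro dfn_intros R')
    show "has_interior m {z. A z \<and> has_interior k {y. R z (y(k := t))}}" by (rule t)
  qed blast
  then obtain y where "y \<in> cart_pow k" "has_interior m
      {z. (A z \<and> has_interior k {y. R z (y(k := t))}) \<and> R z (y(k := t))}" by blast
  then show ?case
    by (intro bexI[of _ "y(k := t)"] cart_pow_upd) (elim has_interior_mono, blast)
qed

lemma uniform_at_0: "uniform_at 0"
  unfolding uniform_at_def has_interior_0 cart_pow_0
proof (intro allI impI)
  fix A and R :: "(nat \<Rightarrow> 'a) \<Rightarrow> 'a \<Rightarrow> bool"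
  assume "(\<lambda>_. undefined) \<in> {z :: nat \<Rightarrow> 'a. A z}"
    and "\<forall>z\<in>{\<lambda>_. undefined}. A z \<longrightarrow> has_interval (R z)"
  then obtain p q where "p < q" "\<And>t. p < t \<Longrightarrow> t < q \<Longrightarrow> R (\<lambda>_. undefined) t"
    unfolding has_interval_def by blast
  moreover obtain t where "p < t" "t < q" using dense[OF \<open>p < q\<close>] by blast
  ultimately show "\<exists>t. (\<lambda>_. undefined) \<in> {z. A z \<and> R z t}"
    using \<open>(\<lambda>_. undefined) \<in> {z. A z}\<close> by blast
qed

text \<open>Over M^m, uniformity is applied to triples: the two endpoints of an interval of last
  coordinates, and a common value of \<open>R\<close> above it. On the line over \<open>z\<close>
  the admissible triples contain a box by \<open>uniform_interval_line\<close>. A triple that serves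
  an open set of \<open>z\<close> then gives an open set in one dimension more.\<close>

lemma uniform_at_Suc:
  assumes U: "uniform_at m"
  shows "uniform_at (Suc m)"
  unfolding uniform_at_def
proof (intro allI impI)
  fix A and R :: "(nat \<Rightarrow> 'a) \<Rightarrow> 'a \<Rightarrow> bool"
  assume A: "dfn S (\<lambda>w. A (restrict (w 0) {..<Suc m}))"
    and R: "dfn S (\<lambda>w. R (restrict (w 0) {..<Suc m}) (w 1 0))"
    and int: "has_interior (Suc m) {z. A z}"
    and fib: "\<forall>z\<in>cart_pow (Suc m). A z \<longrightarrow> has_interval (R z)"
  note A' = dfn_rel1[OF A] and R' = dfn_rel_tuple_elem[OF R]
  obtain a b where ab: "\<And>i. i < Suc m \<Longrightarrow> a i < b i" "open_box (Suc m) a b \<subseteq> {z. A z}"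
    using has_interiorE[OF int] by metis
  define Q where "Q z p \<longleftrightarrow> p 0 < p 1 \<and>
      (\<forall>s. p 0 < s \<and> s < p 1 \<longrightarrow> A (z(m := s)) \<and> R (z(m := s)) (p 2))" for z and p :: "nat \<Rightarrow> 'a"
  have "\<exists>p\<in>cart_pow 3. has_interior m {z. z \<in> open_box m a b \<and> Q z p}"
  proof (rule uniform_at_point[OF U])
    show "dfn S (\<lambda>w. restrict (w 0) {..<m} \<in> open_box m a b)"
      by (intro dfn_in_open_box dfn_intros)
    show "dfn S (\<lambda>w. Q (restrict (w 0) {..<m}) (restrict (w 1) {..<3}))"
      unfolding Q_def by (intro dfn_intros A' R')
    show "has_interior m {z. z \<in> open_box m a b}"
      by (rule has_interiorI[of _ a b]) (use ab(1) in auto)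
    fix z assume z: "z \<in> cart_pow m" "z \<in> open_box m a b"
    have Az: "A (z(m := s))" if "a m < s" "s < b m" for s
      using ab(2) upd_in_open_box[OF z(1), of s a b] z(2) that by blast
    have "\<exists>u v. u < v \<and> has_interval (\<lambda>s. (a m < s \<and> s < b m) \<and>
        (\<forall>t. u < t \<and> t < v \<longrightarrow> R (z(m := s)) t))"
    proof (rule uniform_interval_line)
      show "dfn S (\<lambda>w. a m < w 0 0 \<and> w 0 0 < b m)" by (intro dfn_intros)
      show "has_interval (\<lambda>s. a m < s \<and> s < b m)"
        using ab(1)[of m] unfolding has_interval_def by blast
      show "dfn S (\<lambda>w. R (z(m := w 0 0)) (w 1 0))"
        by (intro R' dfn_intros z(1))
      show "has_interval (R (z(m := s)))" if "a m < s \<and> s < b m" for s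
        using fib cart_pow_upd[OF z(1)] Az that by blast
    qed
    then obtain u v where uv: "u < v" and "has_interval (\<lambda>s. (a m < s \<and> s < b m) \<and>
        (\<forall>t. u < t \<and> t < v \<longrightarrow> R (z(m := s)) t))" by blast
    then obtain p q where pq: "p < q" and R: "\<And>s t. p < s \<Longrightarrow> s < q \<Longrightarrow>
        u < t \<Longrightarrow> t < v \<Longrightarrow> (a m < s \<and> s < b m) \<and> R (z(m := s)) t"
      unfolding has_interval_def using dense[OF uv] by blast
    \<comment> \<open>\<open>r\<close> keeps the first entry of the triple below the second; with
      the third entry between \<open>u\<close> and \<open>v\<close> this gives a box of admissible
      triples.\<close>
    obtain r where r: "p < r" "r < q" using dense[OF pq] by blast
    show "has_interior 3 {y. Q z y}"
    proof (rule has_interiorI)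
      show "(\<lambda>i::nat. if i = 0 then p else if i = 1 then r else u) i <
          (\<lambda>i::nat. if i = 0 then r else if i = 1 then q else v) i" for i
        using r uv by simp
      have three: "(\<forall>i<3. P i) \<longleftrightarrow> P 0 \<and> P 1 \<and> P 2" for P :: "nat \<Rightarrow> bool"
        by (auto simp: less_Suc_eq numeral_3_eq_3 numeral_2_eq_2)
      show "open_box 3 (\<lambda>i. if i = 0 then p else if i = 1 then r else u)
          (\<lambda>i. if i = 0 then r else if i = 1 then q else v) \<subseteq> {y. Q z y}"
      proof
        fix y assume "y \<in> open_box 3 (\<lambda>i. if i = 0 then p else if i = 1 then r else u)
          (\<lambda>i. if i = 0 then r else if i = 1 then q else v)"
        then have y: "p < y 0" "y 0 < r" "r < y 1" "y 1 < q" "u < y 2" "y 2 < v"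
          unfolding open_box_def three by auto
        have "A (z(m := s)) \<and> R (z(m := s)) (y 2)" if s: "y 0 < s" "s < y 1" for s
        proof -
          have "p < s" "s < q" using s y by (blast intro: less_trans)+
          then show ?thesis using R[of s "y 2"] Az y(5,6) by blast
        qed
        then show "y \<in> {y. Q z y}" using y unfolding Q_def by (auto intro: less_trans)
      qed
    qed
  qed
  then obtain p where p: "has_interior m {z. z \<in> open_box m a b \<and> Q z p}" by blast
  obtain c d where cd: "\<And>i. i < m \<Longrightarrow> c i < d i" "open_box m c d \<subseteq> {z. z \<in> open_box m a b \<and> Q z p}"
    using p unfolding has_interior_def by blast
  have Q: "Q z p" if "z \<in> open_box m c d" for z using cd(2) that by blast
  obtain z where "z \<in> open_box m c d" using open_box_nonempty[of m c d] cd(1) by metis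
  then have "p 0 < p 1" using Q unfolding Q_def by blast
  then have "has_interior (Suc m) {z. A z \<and> R z (p 2)}"
    using Q by (intro has_interior_SucI[of m c d "p 0" "p 1"] cd(1)) (auto simp: Q_def)
  then show "\<exists>t. has_interior (Suc m) {z. A z \<and> R z t}" by blast
qed

lemma uniform_at: "uniform_at m"
  by (induction m) (simp_all add: uniform_at_0 uniform_at_Suc)

lemmas uniform_point = uniform_at_point[OF uniform_at]

text \<open>The two corners are fixed one after the other, as on the line. If (p, q) is a good box
  for \<open>z\<close>, then every lower corner inside it works with \<open>q\<close>; for a fixed
  lower corner \<open>a\<close>, every upper corner between \<open>a\<close> and a good one works,
  since shrinking preserves goodness.\<close>

lemma uniform_box:
  assumes A: "dfn S (\<lambda>w. A (restrict (w 0) {..<m}))"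
    and R: "dfn S (\<lambda>w. R (restrict (w 0) {..<m}) (restrict (w 1) {..<k}))"
    and int: "has_interior m {z. A z}"
    and fib: "\<And>z. z \<in> cart_pow m \<Longrightarrow> A z \<Longrightarrow> has_interior k {y. R z y}"
  shows "\<exists>a\<in>cart_pow k. \<exists>b\<in>cart_pow k. (\<forall>i<k. a i < b i) \<and>
    has_interior m {z. A z \<and> (\<forall>y\<in>open_box k a b. R z y)}"
proof -
  note A' = dfn_rel1[OF A] and R' = dfn_rel2[OF R]
  define B where "B z a b \<longleftrightarrow> (\<forall>i<k. a i < b i) \<and> (\<forall>y\<in>open_box k a b. R z y)" for z a b
  have B: "dfn S (\<lambda>w. B (restrict (w 0) {..<m}) (restrict (w 1) {..<k}) (restrict (w 2) {..<k}))"
    unfolding B_def by (intro dfn_ball_open_box dfn_intros R')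
  note B' = dfn_rel3[OF B]
  have shrink: "B z a' b'" if "B z a b" "\<And>i. i < k \<Longrightarrow> a i \<le> a' i \<and> a' i < b' i \<and> b' i \<le> b i" for z a b a' b'
    using that open_box_mono[of k a a' b' b] unfolding B_def by blast
  have "\<exists>a\<in>cart_pow k. has_interior m {z. A z \<and> (\<exists>b\<in>cart_pow k. B z a b)}"
  proof (rule uniform_point[OF A])
    show "dfn S (\<lambda>w. \<exists>b\<in>cart_pow k. B (restrict (w 0) {..<m}) (restrict (w 1) {..<k}) b)"
      by (intro dfn_intros B')
    fix z assume "z \<in> cart_pow m" "A z"
    then obtain p q where pq: "q \<in> cart_pow k" "\<And>i. i < k \<Longrightarrow> p i < q i" "open_box k p q \<subseteq> {y. R z y}"
      using has_interiorE[OF fib] by metis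
    then have "B z p q" unfolding B_def by blast
    then have "B z a q" if "a \<in> open_box k p q" for a
      by (rule shrink) (use that in \<open>auto simp: open_box_def\<close>)
    then show "has_interior k {a. \<exists>b\<in>cart_pow k. B z a b}"
      using pq by (intro has_interiorI[of k p q]) blast+
  qed (rule int)
  then obtain a where a: "a \<in> cart_pow k" "has_interior m {z. A z \<and> (\<exists>b\<in>cart_pow k. B z a b)}"
    by blast
  have "\<exists>b\<in>cart_pow k. has_interior m {z. (A z \<and> (\<exists>b\<in>cart_pow k. B z a b)) \<and> B z a b}"
  proof (rule uniform_point[OF _ _ a(2)])
    show "dfn S (\<lambda>w. A (restrict (w 0) {..<m}) \<and> (\<exists>b\<in>cart_pow k. B (restrict (w 0) {..<m}) a b))"
      by (intro dfn_intros A' B' a(1))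
    show "dfn S (\<lambda>w. B (restrict (w 0) {..<m}) a (restrict (w 1) {..<k}))"
      by (intro dfn_intros B' a(1))
    fix z assume "A z \<and> (\<exists>b\<in>cart_pow k. B z a b)"
    then obtain q where q: "B z a q" by blast
    then have "B z a b" if "b \<in> open_box k a q" for b
      by (rule shrink) (use that in \<open>auto simp: open_box_def\<close>)
    then show "has_interior k {b. B z a b}"
      using q by (intro has_interiorI[of k a q]) (auto simp: B_def)
  qed
  then obtain b where b: "b \<in> cart_pow k"
      "has_interior m {z. (A z \<and> (\<exists>b\<in>cart_pow k. B z a b)) \<and> B z a b}" by blast
  then have "\<forall>i<k. a i < b i"
    using has_interior_nonempty[OF b(2)] unfolding B_def by blast
  moreover have "has_interior m {z. A z \<and> (\<forall>y\<in>open_box k a b. R z y)}"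
    by (rule has_interior_mono[OF b(2)]) (auto simp: B_def)
  ultimately show ?thesis using a(1) b(1) by blast
qed

lemma uniform_interval:
  assumes A: "dfn S (\<lambda>w. A (restrict (w 0) {..<m}))"
    and R: "dfn S (\<lambda>w. R (restrict (w 0) {..<m}) (w 1 0))"
    and int: "has_interior m {z. A z}"
    and fib: "\<And>z. z \<in> cart_pow m \<Longrightarrow> A z \<Longrightarrow> has_interval (R z)"
  shows "\<exists>u v. u < v \<and> has_interior m {z. A z \<and> (\<forall>t. u < t \<and> t < v \<longrightarrow> R z t)}"
proof -
  have "\<exists>u\<in>cart_pow 1. \<exists>v\<in>cart_pow 1. (\<forall>i<1. u i < v i) \<and>
    has_interior m {z. A z \<and> (\<forall>y\<in>open_box 1 u v. R z (y 0))}"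
  proof (rule uniform_box[OF A])
    show "dfn S (\<lambda>w. R (restrict (w 0) {..<m}) (restrict (w 1) {..<1} 0))"
      by (intro dfn_rel_tuple_elem[OF R] dfn_intros)
    show "has_interior 1 {y. R z (y 0)}" if "z \<in> cart_pow m" "A z" for z
      using fib[OF that] by (simp only: has_interior_1_iff has_interval_def)
  qed (rule int)
  then obtain u v where uv: "u 0 < v 0"
    and int': "has_interior m {z. A z \<and> (\<forall>y\<in>open_box 1 u v. R z (y 0))}"
    by auto
  have "R z t" if "\<forall>y\<in>open_box 1 u v. R z (y 0)" and t: "u 0 < t" "t < v 0" for z t
  proof -
    have "(\<lambda>i\<in>{..<1}. t) \<in> open_box 1 u v"
      using t by (simp add: open_box_def restrict_in_cart_pow)
    then have "R z ((\<lambda>i\<in>{..<1::nat}. t) 0)" using that(1) by blast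
    then show ?thesis by simp
  qed
  then have "has_interior m {z. A z \<and> (\<forall>t. u 0 < t \<and> t < v 0 \<longrightarrow> R z t)}"
    by (intro has_interior_mono[OF int']) blast
  then show ?thesis using uv by blast
qed

text \<open>The point \<open>p\<close> depends on \<open>z\<close>, and no definable choice of it is
  available. It suffices to fix corners: below \<open>p\<close> every lower corner between
  \<open>a\<close> and \<open>p\<close> is admissible, above it every upper corner between
  \<open>p\<close> and \<open>b\<close>, so both kinds contain boxes and
  \<open>uniform_point\<close> applies twice.\<close>

lemma uniform_small_box:
  assumes A: "dfn S (\<lambda>w. A (restrict (w 0) {..<m}))"
    and R: "dfn S (\<lambda>w. R (restrict (w 0) {..<m}) (restrict (w 1) {..<k}) (restrict (w 2) {..<k}))"
    and int: "has_interior m {z. A z}"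
    and fib: "\<And>z. z \<in> cart_pow m \<Longrightarrow> A z \<Longrightarrow> \<exists>p a b. p \<in> open_box k a b \<and>
      (\<forall>a' b'. p \<in> open_box k a' b' \<and> open_box k a' b' \<subseteq> open_box k a b \<longrightarrow> R z a' b')"
  shows "\<exists>a\<in>cart_pow k. \<exists>b\<in>cart_pow k. has_interior m {z. A z \<and> R z a b}"
proof -
  note A' = dfn_rel1[OF A] and R' = dfn_rel3[OF R]
  have d: "dfn S (\<lambda>w. has_interior k {b. R (restrict (w 0) {..<m}) (restrict (w 1) {..<k}) b})"
    by (intro dfn_has_interior dfn_intros R')
  have "\<exists>a\<in>cart_pow k. has_interior m {z. A z \<and> has_interior k {b. R z a b}}"
  proof (rule uniform_point[OF A d int])
    fix z assume "z \<in> cart_pow m" "A z"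
    then obtain p a b where p: "p \<in> open_box k a b" and
      small: "\<And>a' b'. p \<in> open_box k a' b' \<and> open_box k a' b' \<subseteq> open_box k a b \<Longrightarrow> R z a' b'"
      using fib by meson
    have lt: "a i < p i" "p i < b i" if "i < k" for i using p that by (auto simp: open_box_def)
    have "has_interior k {b'. R z a' b'}" if a': "a' \<in> open_box k a p" for a'
    proof (rule has_interiorI[of k p b])
      show "open_box k p b \<subseteq> {b'. R z a' b'}"
      proof
        fix b' assume b': "b' \<in> open_box k p b"
        have "p \<in> open_box k a' b'" using p a' b' by (auto simp: open_box_def)
        moreover have "open_box k a' b' \<subseteq> open_box k a b"
          using a' b' by (intro open_box_mono) (auto simp: open_box_def)
        ultimately show "b' \<in> {b'. R z a' b'}" using small by blast
      qed
    qed (rule lt)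
    then show "has_interior k {a. has_interior k {b. R z a b}}"
      using lt by (intro has_interiorI[of k a p]) auto
  qed
  then obtain a where a: "a \<in> cart_pow k" "has_interior m {z. A z \<and> has_interior k {b. R z a b}}"
    by blast
  have "\<exists>b\<in>cart_pow k. has_interior m {z. (A z \<and> has_interior k {b. R z a b}) \<and> R z a b}"
  proof (rule uniform_point[OF _ _ a(2)])
    show "dfn S (\<lambda>w. A (restrict (w 0) {..<m}) \<and> has_interior k {b. R (restrict (w 0) {..<m}) a b})"
      by (intro dfn_intros dfn_has_interior A' R' a(1))
    show "dfn S (\<lambda>w. R (restrict (w 0) {..<m}) a (restrict (w 1) {..<k}))"
      by (intro dfn_intros R' a(1))
  qed simp
  then obtain b where "b \<in> cart_pow k"
      "has_interior m {z. (A z \<and> has_interior k {b. R z a b}) \<and> R z a b}" by blast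
  moreover from this(2) have "has_interior m {z. A z \<and> R z a b}"
    by (rule has_interior_mono) blast
  ultimately show ?thesis using a(1) by blast
qed

text \<open>The case of the line is applied to the slices over a box in M^m: each slice contains an
  interval of \<open>P\<close> or of \<open>Q\<close>. By induction one of the two alternatives
  holds on an open set of base points, and \<open>uniform_interval\<close> replaces the intervals
  there by a common one.\<close>

lemma has_interior_disj:
  assumes "dfn S (\<lambda>w. P (restrict (w 0) {..<m}))" "dfn S (\<lambda>w. Q (restrict (w 0) {..<m}))"
    and "has_interior m {z. P z \<or> Q z}"
  shows "has_interior m {z. P z} \<or> has_interior m {z. Q z}"
  using assms
proof (induction m arbitrary: P Q)
  case 0
  then show ?case by (simp add: has_interior_0)
next
  case (Suc m)
  obtain a b where ab: "\<And>i. i < Suc m \<Longrightarrow> a i < b i" "open_box (Suc m) a b \<subseteq> {z. P z \<or> Q z}"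
    using has_interiorE[OF Suc.prems(3)] by metis
  define fat where "fat W z \<longleftrightarrow> has_interval (\<lambda>t. W (z(m := t)))" for W and z :: "nat \<Rightarrow> 'a"
  have fat: "dfn S (\<lambda>w. fat W (restrict (w 0) {..<m}))"
    if "dfn S (\<lambda>w. W (restrict (w 0) {..<Suc m}))" for W
    unfolding fat_def by (intro dfn_has_interval dfn_rel1[OF that] dfn_intros)
  have lift: "has_interior (Suc m) {z. W z}"
    if W: "dfn S (\<lambda>w. W (restrict (w 0) {..<Suc m}))" and int: "has_interior m {z. fat W z}" for W
  proof -
    have "\<exists>u v. u < v \<and>
      has_interior m {z. fat W z \<and> (\<forall>t. u < t \<and> t < v \<longrightarrow> W (z(m := t)))}"
    proof (rule uniform_interval[OF fat[OF W]])
      show "dfn S (\<lambda>w. W ((restrict (w 0) {..<m})(m := w 1 0)))"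
        by (intro dfn_rel1[OF W] dfn_intros)
    qed (use int in \<open>simp_all add: fat_def\<close>)
    then obtain u v where uv: "u < v"
      and int': "has_interior m {z. fat W z \<and> (\<forall>t. u < t \<and> t < v \<longrightarrow> W (z(m := t)))}"
      by blast
    obtain c d where cd: "\<And>i. i < m \<Longrightarrow> c i < d i"
        "open_box m c d \<subseteq> {z. fat W z \<and> (\<forall>t. u < t \<and> t < v \<longrightarrow> W (z(m := t)))}"
      using int' unfolding has_interior_def by blast
    show ?thesis
      by (rule has_interior_SucI[OF cd(1) uv]) (use cd(2) in blast)+
  qed
  have "fat P z \<or> fat Q z" if z: "z \<in> open_box m a b" for z
    unfolding fat_def
  proof (rule has_interval_disj)
    have zc: "z \<in> cart_pow m" using z open_box_subset by blast
    show "dfn S (\<lambda>w. P (z(m := w 0 0)))" "dfn S (\<lambda>w. Q (z(m := w 0 0)))"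
      by (intro dfn_rel1[OF Suc.prems(1)] dfn_rel1[OF Suc.prems(2)] dfn_intros zc)+
    have "P (z(m := t)) \<or> Q (z(m := t))" if "a m < t" "t < b m" for t
      using ab(2) upd_in_open_box[OF zc, of t a b] z that by blast
    then show "has_interval (\<lambda>t. P (z(m := t)) \<or> Q (z(m := t)))"
      using ab(1)[of m] unfolding has_interval_def by blast
  qed
  then have "has_interior m {z. fat P z \<or> fat Q z}"
    using ab(1) by (intro has_interiorI[of m a b]) auto
  then have "has_interior m {z. fat P z} \<or> has_interior m {z. fat Q z}"
    by (intro Suc.IH fat Suc.prems)
  then show ?case using lift Suc.prems by blast
qed

text \<open>Used to pick one coordinate, or one coordinate projection, that works over an open set
  when finitely many compete.\<close>

lemma has_interior_bex:
  assumes "finite I" "\<And>i. i \<in> I \<Longrightarrow> dfn S (\<lambda>w. P i (restrict (w 0) {..<m}))"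
    and "has_interior m {z. \<exists>i\<in>I. P i z}"
  shows "\<exists>i\<in>I. has_interior m {z. P i z}"
  using assms
proof (induction I)
  case empty
  then show ?case using has_interior_nonempty by fastforce
next
  case (insert i I)
  have "has_interior m {z. P i z} \<or> has_interior m {z. \<exists>i\<in>I. P i z}"
  proof (rule has_interior_disj)
    show "dfn S (\<lambda>w. \<exists>i\<in>I. P i (restrict (w 0) {..<m}))"
      by (rule dfn_bex_finite[OF insert.hyps(1)]) (rule insert.prems(1), erule insertI2)
    show "has_interior m {z. P i z \<or> (\<exists>i\<in>I. P i z)}" using insert.prems(2) by simp
  qed (rule insert.prems(1), simp)
  then show ?case using insert by auto
qed

end

section \<open>Dimension\<close>

text \<open>\<open>d\<close> is a lower bound for the dimension. Injective index maps replace the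
  increasing ones, so that a coordinate can be appended at the end and permutations act by
  composition.\<close>

definition has_dim :: "nat \<Rightarrow> nat \<Rightarrow> (nat \<Rightarrow> 'a::linorder) set \<Rightarrow> bool" where
  "has_dim n d X \<longleftrightarrow> (\<exists>\<iota>. inj_on \<iota> {..<d} \<and> \<iota> ` {..<d} \<subseteq> {..<n} \<and> has_interior d (coord_map d \<iota> ` X))"

lemma coord_map_eq_iff:
  "z \<in> cart_pow d \<Longrightarrow> coord_map d \<iota> x = z \<longleftrightarrow> (\<forall>k<d. x (\<iota> k) = z k)"
  by (auto simp: coord_map_def cart_pow_def PiE_iff extensional_def fun_eq_iff)

lemma coord_map_coord_map:
  "\<iota> ` {..<d} \<subseteq> {..<n} \<Longrightarrow> coord_map d \<iota> (coord_map n \<sigma> x) = coord_map d (\<lambda>k. \<sigma> (\<iota> k)) x"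
  by (auto simp: coord_map_def fun_eq_iff)

lemma coord_map_upd: "coord_map (Suc d) (\<iota>(d := i)) x = (coord_map d \<iota> x)(d := x i)"
  by (auto simp: coord_map_def fun_eq_iff less_Suc_eq)

lemma cart_pow_eqI: "x \<in> cart_pow n \<Longrightarrow> y \<in> cart_pow n \<Longrightarrow> (\<And>i. i < n \<Longrightarrow> x i = y i) \<Longrightarrow> x = y"
  unfolding cart_pow_def by (rule PiE_ext) auto

lemma has_interior_permute:
  assumes \<sigma>: "\<sigma> permutes {..<d}" and "has_interior d Y"
  shows "has_interior d (coord_map d \<sigma> ` Y)"
proof -
  obtain a b where ab: "\<And>i. i < d \<Longrightarrow> a i < b i" "open_box d a b \<subseteq> Y"
    using assms(2) unfolding has_interior_def by blast
  have in_d: "\<sigma> i < d \<longleftrightarrow> i < d" "inv \<sigma> i < d \<longleftrightarrow> i < d" for i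
    using permutes_in_image[OF \<sigma>] permutes_in_image[OF permutes_inv[OF \<sigma>]] by auto
  show ?thesis
  proof (rule has_interiorI)
    show "open_box d (\<lambda>i. a (\<sigma> i)) (\<lambda>i. b (\<sigma> i)) \<subseteq> coord_map d \<sigma> ` Y"
    proof
      fix x assume x: "x \<in> open_box d (\<lambda>i. a (\<sigma> i)) (\<lambda>i. b (\<sigma> i))"
      then have "a (\<sigma> (inv \<sigma> i)) < x (inv \<sigma> i) \<and> x (inv \<sigma> i) < b (\<sigma> (inv \<sigma> i))" if "i < d" for i
        using in_d that by (auto simp: open_box_def)
      then have "coord_map d (inv \<sigma>) x \<in> open_box d a b"
        by (simp add: open_box_def coord_map_in_cart_pow permutes_inverses[OF \<sigma>])
          (simp add: coord_map_def)
      moreover have "coord_map d \<sigma> (coord_map d (inv \<sigma>) x) = x"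
        using x by (subst coord_map_eq_iff)
          (auto simp: open_box_def coord_map_def in_d permutes_inverses[OF \<sigma>])
      ultimately show "x \<in> coord_map d \<sigma> ` Y" using ab(2) by force
    qed
  qed (simp add: in_d ab(1))
qed

text \<open>Sorting the set of indices makes the map increasing; the two projections differ by a
  permutation of the \<open>d\<close> coordinates, which preserves interiors.\<close>

lemma has_dim_iff:
  "has_dim n d X \<longleftrightarrow> (\<exists>\<iota>. proj_index n d \<iota> \<and> has_interior d (coord_map d \<iota> ` X))"
proof
  assume "has_dim n d X"
  then obtain \<iota> where \<iota>: "inj_on \<iota> {..<d}" "\<iota> ` {..<d} \<subseteq> {..<n}"
    and int: "has_interior d (coord_map d \<iota> ` X)" by (auto simp: has_dim_def)
  define s where "s = sorted_list_of_set (\<iota> ` {..<d})"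
  have s: "length s = d" "set s = \<iota> ` {..<d}" "sorted_wrt (<) s"
    using card_image[OF \<iota>(1)] by (simp_all add: s_def)
  define \<sigma> where "\<sigma> k = (if k < d then the_inv_into {..<d} \<iota> (s ! k) else k)" for k
  have bij_s: "bij_betw ((!) s) {..<d} (\<iota> ` {..<d})"
    using s by (intro bij_betw_nth) (auto simp: strict_sorted_iff)
  have "bij_betw (\<lambda>k. the_inv_into {..<d} \<iota> (s ! k)) {..<d} {..<d}"
    using bij_betw_trans[OF bij_s bij_betw_the_inv_into[OF inj_on_imp_bij_betw[OF \<iota>(1)]]]
    by (simp add: o_def)
  then have "bij_betw \<sigma> {..<d} {..<d}"
    by (rule bij_betw_cong[THEN iffD1, rotated]) (simp add: \<sigma>_def)
  then have \<sigma>: "\<sigma> permutes {..<d}"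
    by (rule bij_imp_permutes) (simp add: \<sigma>_def)
  have \<iota>\<sigma>: "\<iota> (\<sigma> k) = s ! k" if "k < d" for k
    using that s bij_s f_the_inv_into_f[OF \<iota>(1), of "s ! k"] by (auto simp: \<sigma>_def bij_betw_def)
  have "coord_map d \<sigma> (coord_map d \<iota> x) = coord_map d ((!) s) x" for x :: "nat \<Rightarrow> 'a"
    using permutes_in_image[OF \<sigma>] \<iota>\<sigma> by (auto simp: coord_map_def fun_eq_iff)
  then have "has_interior d (coord_map d ((!) s) ` X)"
    using has_interior_permute[OF \<sigma> int] by (simp add: image_image)
  moreover have "proj_index n d ((!) s)"
    using s \<iota>(2) bij_s sorted_wrt_nth_less[OF s(3)]
    by (auto simp: proj_index_def strict_mono_on_def bij_betw_def)
  ultimately show "\<exists>\<iota>. proj_index n d \<iota> \<and> has_interior d (coord_map d \<iota> ` X)" by blast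
next
  assume "\<exists>\<iota>. proj_index n d \<iota> \<and> has_interior d (coord_map d \<iota> ` X)"
  then show "has_dim n d X"
    unfolding has_dim_def proj_index_def by (blast intro: strict_mono_on_imp_inj_on)
qed

lemma has_dim_le: "has_dim n d X \<Longrightarrow> d \<le> n"
  unfolding has_dim_def using card_inj_on_le[of _ "{..<d}" "{..<n}"] by fastforce

lemma has_dim_0: "has_dim n 0 X \<longleftrightarrow> X \<noteq> {}"
proof -
  have "coord_map 0 \<iota> x = (\<lambda>_. undefined)" for \<iota> and x :: "nat \<Rightarrow> 'a"
    by (auto simp: coord_map_def)
  then show ?thesis by (auto simp: has_dim_def has_interior_0)
qed

lemma has_dim_mono:
  assumes "has_dim n d X" "X \<subseteq> Y"
  shows "has_dim n d Y"
  using assms(1) has_interior_mono[OF _ image_mono[OF assms(2)]] unfolding has_dim_def by blast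

text \<open>Forgetting coordinates maps a box onto a box; a point of the smaller box is completed by
  the remaining coordinates of a fixed point \<open>z\<close> of the larger one.\<close>

lemma has_dim_antimono:
  fixes X :: "(nat \<Rightarrow> 'a::dense_linorder) set"
  assumes "has_dim n d X" "e \<le> d"
  shows "has_dim n e X"
proof -
  obtain \<iota> where \<iota>: "inj_on \<iota> {..<d}" "\<iota> ` {..<d} \<subseteq> {..<n}"
    and int: "has_interior d (coord_map d \<iota> ` X)" using assms(1) by (auto simp: has_dim_def)
  obtain a b where ab: "\<And>i. i < d \<Longrightarrow> a i < b i" "open_box d a b \<subseteq> coord_map d \<iota> ` X"
    using int unfolding has_interior_def by blast
  obtain z where z: "z \<in> open_box d a b" using open_box_nonempty[of d a b] ab(1) by metis
  have "open_box e a b \<subseteq> coord_map e \<iota> ` X"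
  proof
    fix y assume y: "y \<in> open_box e a b"
    define y' where "y' i = (if i < e then y i else z i)" for i
    have "y' \<in> open_box d a b"
      using y z assms(2) by (auto simp: open_box_def y'_def cart_pow_def PiE_iff extensional_def)
    then obtain x where "x \<in> X" and x: "coord_map d \<iota> x = y'" using ab(2) by blast
    have "x (\<iota> k) = y k" if "k < e" for k
      using fun_cong[OF x, of k] that assms(2) by (simp add: coord_map_def y'_def)
    then have "coord_map e \<iota> x = y" using y by (subst coord_map_eq_iff) (auto simp: open_box_def)
    then show "y \<in> coord_map e \<iota> ` X" using \<open>x \<in> X\<close> by blast
  qed
  then have "has_interior e (coord_map e \<iota> ` X)"
    using ab(1) assms(2) by (intro has_interiorI[of e a b]) auto
  moreover have "{..<e} \<subseteq> {..<d}" using assms(2) by auto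
  ultimately show ?thesis using \<iota> unfolding has_dim_def by (meson image_mono inj_on_subset subset_trans)
qed

text \<open>The thresholds reached by a nonempty set are bounded by \<open>n\<close>, contain 0 and
  are closed downwards, so being at most their maximum means being one of them. The empty set
  reaches none, in accordance with \<open>Minf\<close>.\<close>

lemma Fin_le_def_dim:
  fixes X :: "(nat \<Rightarrow> 'a::{unbounded_dense_linorder, linorder_topology}) set"
  shows "Fin d \<le> def_dim n X \<longleftrightarrow> has_dim n d X"
proof (cases "X = {}")
  case True
  then have "\<not> has_dim n d X" unfolding has_dim_def using has_interior_nonempty by blast
  then show ?thesis using True by (simp add: def_dim_def)
next
  case False
  define D where "D = {d. has_dim n d X}"
  have D: "D = {d. \<exists>\<iota>. proj_index n d \<iota> \<and> pow_top d interior_of (coord_map d \<iota> ` X) \<noteq> {}}"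
    unfolding D_def has_dim_iff has_interior_iff ..
  have "D \<subseteq> {..n}" unfolding D_def using has_dim_le by blast
  then have fin: "finite D" by (rule finite_subset) simp
  have "0 \<in> D" using False by (simp add: D_def has_dim_0)
  then have "Max D \<in> D" using fin by (intro Max_in) auto
  have "d \<le> Max D \<longleftrightarrow> d \<in> D"
    using Max_ge[OF fin] \<open>Max D \<in> D\<close> has_dim_antimono unfolding D_def by blast
  then show ?thesis using False D by (simp add: def_dim_def D_def)
qed

lemma def_dim_cases:
  obtains "X = {}" "def_dim n X = Minf" | d where "X \<noteq> {}" "def_dim n X = Fin d"
  by (cases "X = {}") (auto simp: def_dim_def)

context
  fixes X Y :: "(nat \<Rightarrow> 'a::{unbounded_dense_linorder, linorder_topology}) set"
begin

lemma def_dim_leI: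
  assumes "\<And>d. has_dim m d X \<Longrightarrow> has_dim n d Y"
  shows "def_dim m X \<le> def_dim n Y"
  using assms by (cases rule: def_dim_cases[of X m]) (auto simp flip: Fin_le_def_dim)

lemma def_dim_eqI:
  assumes "\<And>d. has_dim m d X \<longleftrightarrow> has_dim n d Y"
  shows "def_dim m X = def_dim n Y"
  using assms
  by (cases rule: def_dim_cases[of X m]; cases rule: def_dim_cases[of Y n])
    (auto simp flip: Fin_le_def_dim intro: order_antisym)

text \<open>With \<open>d\<close> the dimension of \<open>X\<close>, the threshold
  \<open>Suc d\<close> fails for \<open>X\<close>, hence \<open>d\<close> already fails for
  \<open>Y\<close>. For empty \<open>X\<close> both dimensions would be \<open>Minf\<close>.\<close>

lemma def_dim_lessI:
  assumes "X \<noteq> {}" "\<And>d. \<not> has_dim m (Suc d) X \<Longrightarrow> \<not> has_dim n d Y"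
  shows "def_dim n Y < def_dim m X"
  using assms(1)
proof (cases rule: def_dim_cases[of X m])
  case (2 d)
  then have "\<not> Fin (Suc d) \<le> def_dim m X" by simp
  then have "\<not> Fin d \<le> def_dim n Y" using assms(2) by (simp add: Fin_le_def_dim)
  then show ?thesis using 2 by (simp add: not_le)
qed simp

end

section \<open>Products and permutations of coordinates\<close>

lemma has_dim_set_prod:
  fixes X Y :: "(nat \<Rightarrow> 'a::dense_linorder) set"
  shows "has_dim (m + n) d (set_prod m n X Y) \<longleftrightarrow>
    (\<exists>p q. d = p + q \<and> has_dim m p X \<and> has_dim n q Y)"
proof
  assume "has_dim (m + n) d (set_prod m n X Y)"
  then obtain \<iota> where \<iota>: "\<iota> ` {..<d} \<subseteq> {..<m + n}" "strict_mono_on {..<d} \<iota>"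
    and int: "has_interior d (coord_map d \<iota> ` set_prod m n X Y)"
    unfolding has_dim_iff proj_index_def by blast
  obtain a b where ab: "\<And>i. i < d \<Longrightarrow> a i < b i"
      "open_box d a b \<subseteq> coord_map d \<iota> ` set_prod m n X Y"
    using int unfolding has_interior_def by blast
  \<comment> \<open>\<open>p\<close> counts the indices that point into the first factor; as \<iota>
    is increasing, they come first. The alternative \<open>d \<le> k\<close> yields
    \<open>p = d\<close> if all of them do.\<close>
  define p where "p = (LEAST k. d \<le> k \<or> m \<le> \<iota> k)"
  have "d \<le> p \<or> m \<le> \<iota> p" unfolding p_def by (rule LeastI[of _ d]) simp
  moreover have lt: "k < d \<and> \<iota> k < m" if "k < p" for k
    using not_less_Least[of k "\<lambda>k. d \<le> k \<or> m \<le> \<iota> k"] that by (auto simp: p_def)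
  moreover have "p \<le> d" unfolding p_def by (rule Least_le) simp
  ultimately have ge: "m \<le> \<iota> k" if "p \<le> k" "k < d" for k
    using that \<iota>(2) strict_mono_onD[OF \<iota>(2), of p k] by (cases "p = k") auto
  define q where "q = d - p"
  have d: "d = p + q" using \<open>p \<le> d\<close> by (simp add: q_def)
  have inj: "inj_on \<iota> {..<d}" using \<iota>(2) by (rule strict_mono_on_imp_inj_on)
  obtain z where z: "z \<in> open_box d a b" using open_box_nonempty[of d a b] ab(1) by metis
  have "has_dim m p X" unfolding has_dim_def
  proof (intro exI conjI)
    show "inj_on \<iota> {..<p}" using inj by (rule inj_on_subset) (simp add: d)
    show "\<iota> ` {..<p} \<subseteq> {..<m}" using lt by auto
    show "has_interior p (coord_map p \<iota> ` X)"
    proof (rule has_interiorI[of p a b])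
      show "open_box p a b \<subseteq> coord_map p \<iota> ` X"
      proof
        fix y assume y: "y \<in> open_box p a b"
        define y' where "y' i = (if i < p then y i else z i)" for i
        have "y' \<in> open_box d a b"
          using y z d by (auto simp: open_box_def y'_def cart_pow_def PiE_iff extensional_def)
        then obtain u v where "u \<in> X" and u: "coord_map d \<iota> (append_pt m n u v) = y'"
          using ab(2) unfolding set_prod_def by blast
        have "u (\<iota> k) = y k" if "k < p" for k
          using fun_cong[OF u, of k] lt[OF that] that
          by (simp add: coord_map_def append_pt_def y'_def)
        then have "coord_map p \<iota> u = y"
          using y by (subst coord_map_eq_iff) (auto simp: open_box_def)
        then show "y \<in> coord_map p \<iota> ` X" using \<open>u \<in> X\<close> by blast
      qed
    qed (use ab(1) d in auto)
  qed
  moreover have "has_dim n q Y" unfolding has_dim_def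
  proof (intro exI conjI)
    show "inj_on (\<lambda>k. \<iota> (p + k) - m) {..<q}"
    proof (rule inj_onI)
      fix i j assume ij: "i \<in> {..<q}" "j \<in> {..<q}" "\<iota> (p + i) - m = \<iota> (p + j) - m"
      then have "\<iota> (p + i) = \<iota> (p + j)" using ge[of "p + i"] ge[of "p + j"] d by simp
      then show "i = j" using inj_onD[OF inj, of "p + i" "p + j"] ij d by simp
    qed
    show "(\<lambda>k. \<iota> (p + k) - m) ` {..<q} \<subseteq> {..<n}"
    proof (rule image_subsetI)
      fix k assume "k \<in> {..<q}"
      then have "\<iota> (p + k) < m + n" "m \<le> \<iota> (p + k)"
        using \<iota>(1) ge[of "p + k"] d by (auto simp: image_subset_iff)
      then show "\<iota> (p + k) - m \<in> {..<n}" by auto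
    qed
    show "has_interior q (coord_map q (\<lambda>k. \<iota> (p + k) - m) ` Y)"
    proof (rule has_interiorI[of q "\<lambda>i. a (p + i)" "\<lambda>i. b (p + i)"])
      show "open_box q (\<lambda>i. a (p + i)) (\<lambda>i. b (p + i)) \<subseteq> coord_map q (\<lambda>k. \<iota> (p + k) - m) ` Y"
      proof
        fix y assume y: "y \<in> open_box q (\<lambda>i. a (p + i)) (\<lambda>i. b (p + i))"
        define y' where "y' = (\<lambda>i\<in>{..<d}. if i < p then z i else y (i - p))"
        have yb: "a i < y (i - p) \<and> y (i - p) < b i" if "\<not> i < p" "i < d" for i
        proof -
          have "i - p < q" using that d by simp
          then have "a (p + (i - p)) < y (i - p) \<and> y (i - p) < b (p + (i - p))"
            using y by (simp add: open_box_def)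
          then show ?thesis using that by simp
        qed
        have "y' \<in> open_box d a b"
          using z yb by (auto simp: open_box_def y'_def restrict_in_cart_pow)
        then obtain u v where "v \<in> Y" and v: "coord_map d \<iota> (append_pt m n u v) = y'"
          using ab(2) unfolding set_prod_def by blast
        have "v (\<iota> (p + k) - m) = y k" if "k < q" for k
        proof -
          have "\<iota> (p + k) < m + n" "m \<le> \<iota> (p + k)"
            using \<iota>(1) ge[of "p + k"] d that by (auto simp: image_subset_iff)
          then show ?thesis
            using fun_cong[OF v, of "p + k"] that d by (simp add: coord_map_def append_pt_def y'_def)
        qed
        then have "coord_map q (\<lambda>k. \<iota> (p + k) - m) v = y"
          using y by (subst coord_map_eq_iff) (auto simp: open_box_def)
        then show "y \<in> coord_map q (\<lambda>k. \<iota> (p + k) - m) ` Y" using \<open>v \<in> Y\<close> by blast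
      qed
    qed (use ab(1) d in auto)
  qed
  ultimately show "\<exists>p q. d = p + q \<and> has_dim m p X \<and> has_dim n q Y" using d by blast
next
  assume "\<exists>p q. d = p + q \<and> has_dim m p X \<and> has_dim n q Y"
  then obtain p q \<iota> \<kappa> where d: "d = p + q"
    and \<iota>: "inj_on \<iota> {..<p}" "\<iota> ` {..<p} \<subseteq> {..<m}" and intX: "has_interior p (coord_map p \<iota> ` X)"
    and \<kappa>: "inj_on \<kappa> {..<q}" "\<kappa> ` {..<q} \<subseteq> {..<n}" and intY: "has_interior q (coord_map q \<kappa> ` Y)"
    unfolding has_dim_def by blast
  obtain a b where ab: "\<And>i. i < p \<Longrightarrow> a i < b i" "open_box p a b \<subseteq> coord_map p \<iota> ` X"
    using intX unfolding has_interior_def by blast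
  obtain a' b' where ab': "\<And>i. i < q \<Longrightarrow> a' i < b' i" "open_box q a' b' \<subseteq> coord_map q \<kappa> ` Y"
    using intY unfolding has_interior_def by blast
  \<comment> \<open>The two index maps are placed side by side; those of the second factor are
    shifted by \<open>m\<close>, in accordance with \<open>append_pt\<close>.\<close>
  define \<mu> where "\<mu> k = (if k < p then \<iota> k else m + \<kappa> (k - p))" for k
  define A where "A k = (if k < p then a k else a' (k - p))" for k
  define B where "B k = (if k < p then b k else b' (k - p))" for k
  have \<iota>m: "\<iota> k < m" if "k < p" for k using \<iota>(2) that by auto
  have \<kappa>n: "\<kappa> k < n" if "k < q" for k using \<kappa>(2) that by auto
  show "has_dim (m + n) d (set_prod m n X Y)" unfolding has_dim_def
  proof (intro exI conjI)
    show "inj_on \<mu> {..<d}"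
    proof (rule inj_onI)
      fix i j assume ij: "i \<in> {..<d}" "j \<in> {..<d}" "\<mu> i = \<mu> j"
      show "i = j"
      proof (cases "i < p"; cases "j < p")
        assume "i < p" "j < p"
        then show ?thesis using ij inj_onD[OF \<iota>(1)] by (simp add: \<mu>_def)
      next
        assume "\<not> i < p" "\<not> j < p"
        moreover from this have "i - p = j - p"
          using ij d inj_onD[OF \<kappa>(1), of "i - p" "j - p"] by (simp add: \<mu>_def)
        ultimately show ?thesis by simp
      qed (use ij \<iota>m[of i] \<iota>m[of j] in \<open>auto simp: \<mu>_def\<close>)
    qed
    show "\<mu> ` {..<d} \<subseteq> {..<m + n}"
      using \<iota>m \<kappa>n d by (auto simp: \<mu>_def intro: trans_less_add1)
    show "has_interior d (coord_map d \<mu> ` set_prod m n X Y)"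
    proof (rule has_interiorI[of d A B])
      show "A i < B i" if "i < d" for i using ab(1) ab'(1)[of "i - p"] that d by (auto simp: A_def B_def)
      show "open_box d A B \<subseteq> coord_map d \<mu> ` set_prod m n X Y"
      proof
        fix z assume z: "z \<in> open_box d A B"
        then have zi: "A i < z i \<and> z i < B i" if "i < d" for i using that by (simp add: open_box_def)
        have "restrict z {..<p} \<in> open_box p a b"
          unfolding open_box_def
        proof (intro CollectI conjI allI impI restrict_in_cart_pow)
          fix i assume "i < p"
          then show "a i < restrict z {..<p} i" "restrict z {..<p} i < b i"
            using zi[of i] d by (simp_all add: A_def B_def)
        qed
        then obtain x where x: "x \<in> X" "coord_map p \<iota> x = restrict z {..<p}" using ab(2) by force
        have "(\<lambda>k\<in>{..<q}. z (p + k)) \<in> open_box q a' b'"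
          unfolding open_box_def
        proof (intro CollectI conjI allI impI restrict_in_cart_pow)
          fix i assume "i < q"
          then show "a' i < (\<lambda>k\<in>{..<q}. z (p + k)) i" "(\<lambda>k\<in>{..<q}. z (p + k)) i < b' i"
            using zi[of "p + i"] d by (simp_all add: A_def B_def)
        qed
        then obtain y where y: "y \<in> Y" "coord_map q \<kappa> y = (\<lambda>k\<in>{..<q}. z (p + k))" using ab'(2) by force
        have "append_pt m n x y (\<mu> k) = z k" if "k < d" for k
        proof (cases "k < p")
          case True
          then show ?thesis using fun_cong[OF x(2), of k] \<iota>m
            by (simp add: append_pt_def \<mu>_def coord_map_def trans_less_add1)
        next
          case False
          then have "k - p < q" using that d by simp
          then show ?thesis using False fun_cong[OF y(2), of "k - p"] \<kappa>n[of "k - p"] that d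
            by (simp add: append_pt_def \<mu>_def coord_map_def)
        qed
        then have "coord_map d \<mu> (append_pt m n x y) = z"
          using z by (subst coord_map_eq_iff) (auto simp: open_box_def)
        then show "z \<in> coord_map d \<mu> ` set_prod m n X Y"
          using x(1) y(1) unfolding set_prod_def by blast
      qed
    qed
  qed
qed

lemma def_dim_set_prod:
  fixes X Y :: "(nat \<Rightarrow> 'a::{unbounded_dense_linorder, linorder_topology}) set"
  shows "def_dim (m + n) (set_prod m n X Y) = def_dim m X + def_dim n Y"
proof (cases "X = {} \<or> Y = {}")
  case True
  then have "set_prod m n X Y = {}" by (auto simp: set_prod_def)
  then show ?thesis
    using True by (cases rule: def_dim_cases[of X m]; cases rule: def_dim_cases[of Y n])
      (auto simp: def_dim_def)
next
  case False
  obtain p where p: "def_dim m X = Fin p" using False by (cases rule: def_dim_cases[of X m]) auto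
  obtain q where q: "def_dim n Y = Fin q" using False by (cases rule: def_dim_cases[of Y n]) auto
  have "set_prod m n X Y \<noteq> {}" using False by (auto simp: set_prod_def)
  then obtain r where r: "def_dim (m + n) (set_prod m n X Y) = Fin r"
    by (cases rule: def_dim_cases[of "set_prod m n X Y" "m + n"]) auto
  have "d \<le> r \<longleftrightarrow> (\<exists>i j. d = i + j \<and> i \<le> p \<and> j \<le> q)" for d
    using has_dim_set_prod[of m n d X Y] by (simp flip: Fin_le_def_dim add: p q r)
  from this[of r] this[of "p + q"] have "r = p + q" by (auto intro!: order_antisym)
  then show ?thesis by (simp add: p q r)
qed

text \<open>Projecting along \<iota> after permuting by \<sigma> is projecting along the composite,
  which is again injective; the converse uses the inverse of \<sigma>.\<close>

lemma has_dim_permute: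
  assumes "\<sigma> permutes {..<n}"
  shows "has_dim n d (coord_map n \<sigma> ` X) \<longleftrightarrow> has_dim n d X"
proof
  have in_n: "(\<lambda>k. \<tau> (\<iota> k)) ` {..<d} \<subseteq> {..<n}" if "\<tau> permutes {..<n}" "\<iota> ` {..<d} \<subseteq> {..<n}" for \<iota> \<tau>
    using that(2) permutes_in_image[OF that(1)] by (auto simp: image_subset_iff)
  have inj: "inj_on (\<lambda>k. \<tau> (\<iota> k)) {..<d}" if "\<tau> permutes {..<n}" "inj_on \<iota> {..<d}" for \<iota> \<tau>
    using that(2) permutes_inj[OF that(1)] by (auto simp: inj_on_def inj_def)
  {
    assume "has_dim n d (coord_map n \<sigma> ` X)"
    then obtain \<iota> where \<iota>: "inj_on \<iota> {..<d}" "\<iota> ` {..<d} \<subseteq> {..<n}"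
      "has_interior d (coord_map d \<iota> ` coord_map n \<sigma> ` X)" unfolding has_dim_def by blast
    then show "has_dim n d X" unfolding has_dim_def
      using inj[OF assms \<iota>(1)] in_n[OF assms \<iota>(2)] \<iota>(3)
      by (intro exI[of _ "\<lambda>k. \<sigma> (\<iota> k)"]) (simp add: image_image coord_map_coord_map)
  next
    assume "has_dim n d X"
    then obtain \<iota> where \<iota>: "inj_on \<iota> {..<d}" "\<iota> ` {..<d} \<subseteq> {..<n}"
      "has_interior d (coord_map d \<iota> ` X)" unfolding has_dim_def by blast
    note \<tau> = permutes_inv[OF assms]
    have "has_interior d (coord_map d (\<lambda>k. inv \<sigma> (\<iota> k)) ` coord_map n \<sigma> ` X)"
      using \<iota>(3) in_n[OF \<tau> \<iota>(2)]
      by (simp add: image_image coord_map_coord_map permutes_inverses[OF assms])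
    then show "has_dim n d (coord_map n \<sigma> ` X)" unfolding has_dim_def
      using inj[OF \<tau> \<iota>(1)] in_n[OF \<tau> \<iota>(2)] by blast
  }
qed

section \<open>Discrete fibres\<close>

lemma dfn_tuple_eq:
  assumes "\<And>i. atomic_term (\<lambda>w. f w i)" "\<And>i. atomic_term (\<lambda>w. g w i)"
    "\<And>w. f w \<in> cart_pow n" "\<And>w. g w \<in> cart_pow n"
  shows "dfn S (\<lambda>w. f w = g w)"
proof -
  have "dfn S (\<lambda>w. \<forall>i<n. f w i = g w i)" by (intro dfn_intros assms)
  moreover have "(\<forall>i<n. f w i = g w i) \<longleftrightarrow> f w = g w" for w
    using cart_pow_eqI[OF assms(3,4)] by metis
  ultimately show ?thesis by simp
qed

lemma dfn_coord_eq:
  assumes "\<And>i. atomic_term (\<lambda>w. f w i)" "\<And>i. atomic_term (\<lambda>w. g w i)" "\<And>w. g w \<in> cart_pow d"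
  shows "dfn S (\<lambda>w. coord_map d \<iota> (f w) = g w)"
  by (rule dfn_tuple_eq[OF _ assms(2) coord_map_in_cart_pow assms(3)]) (rule atomic_coord_map[OF assms(1)])

lemma dfn_bex_mem:
  assumes "definable S n X" "dfn S (\<lambda>w. Q (\<lambda>j. w (Suc j)) (restrict (w 0) {..<n}))"
  shows "dfn S (\<lambda>w. \<exists>x\<in>X. Q w x)"
proof -
  have "dfn S (\<lambda>w. \<exists>x\<in>cart_pow n. x \<in> X \<and> Q w x)"
    by (intro dfn_intros assms(2) dfn_mem[OF assms(1)])
  moreover have "(\<exists>x\<in>cart_pow n. x \<in> X \<and> Q w x) \<longleftrightarrow> (\<exists>x\<in>X. Q w x)" for w
    using definable_subset[OF assms(1)] by blast
  ultimately show ?thesis by simp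
qed

lemma dfn_in_image_coord_map:
  assumes "definable S n X"
  shows "dfn S (\<lambda>w. restrict (w 0) {..<d} \<in> coord_map d \<iota> ` X)"
proof -
  have "dfn S (\<lambda>w. \<exists>x\<in>X. coord_map d \<iota> x = restrict (w 0) {..<d})"
    by (intro dfn_bex_mem[OF assms] dfn_coord_eq dfn_intros)
  then show ?thesis by (simp add: image_iff eq_commute)
qed

definition fibre :: "nat \<Rightarrow> (nat \<Rightarrow> nat) \<Rightarrow> (nat \<Rightarrow> 'a) set \<Rightarrow> (nat \<Rightarrow> 'a) \<Rightarrow> (nat \<Rightarrow> 'a) set" where
  "fibre e \<iota> X z = {x \<in> X. coord_map e \<iota> x = z}"

text \<open>For definable sets this is equivalent to discreteness, but it is visibly a definable condition.\<close>

definition thin :: "nat \<Rightarrow> (nat \<Rightarrow> 'a::linorder) set \<Rightarrow> bool" where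
  "thin m X \<longleftrightarrow> (\<forall>i<m. \<not> has_interval (\<lambda>t. \<exists>x\<in>X. x i = t))"

lemma definable_fibre:
  assumes "definable S n X" "z \<in> cart_pow e"
  shows "definable S n (fibre e \<iota> X z)"
proof -
  have "definable S n {x \<in> cart_pow n. x \<in> X \<and> coord_map e \<iota> x = z}"
    by (intro dfn_definable dfn_intros dfn_mem[OF assms(1)] dfn_coord_eq assms(2))
  moreover have "fibre e \<iota> X z = {x \<in> cart_pow n. x \<in> X \<and> coord_map e \<iota> x = z}"
    using definable_subset[OF assms(1)] by (auto simp: fibre_def)
  ultimately show ?thesis by simp
qed

lemma bex_fibre: "(\<exists>x\<in>fibre e \<iota> X z. P x) \<longleftrightarrow> (\<exists>x\<in>X. coord_map e \<iota> x = z \<and> P x)"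
  by (auto simp: fibre_def)

lemma dfn_thin_fibre:
  assumes "definable S n X"
  shows "dfn S (\<lambda>w. thin n (fibre e \<iota> X (restrict (w 0) {..<e})))"
  unfolding thin_def bex_fibre
  by (intro dfn_all_less dfn_not dfn_has_interval dfn_bex_mem[OF assms] dfn_coord_eq dfn_intros)

text \<open>On the coordinates hit by \<iota> the two intervals are intersected. This is continuity
  of a coordinate projection at \<open>x\<close>, in terms of boxes.\<close>

lemma pullback_open_box:
  fixes x :: "nat \<Rightarrow> 'a::unbounded_dense_linorder"
  assumes "inj_on \<iota> {..<d}" "x \<in> open_box n a b" "coord_map d \<iota> x \<in> open_box d p q"
    and "\<iota> ` {..<d} \<subseteq> {..<n}"
  obtains a' b' where "x \<in> open_box n a' b'" "open_box n a' b' \<subseteq> open_box n a b"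
    "\<And>y. y \<in> open_box n a' b' \<Longrightarrow> coord_map d \<iota> y \<in> open_box d p q"
proof -
  define P where "P i = (if i \<in> \<iota> ` {..<d} then max (a i) (p (the_inv_into {..<d} \<iota> i)) else a i)" for i
  define Q where "Q i = (if i \<in> \<iota> ` {..<d} then min (b i) (q (the_inv_into {..<d} \<iota> i)) else b i)" for i
  have P: "P (\<iota> k) = max (a (\<iota> k)) (p k)" "Q (\<iota> k) = min (b (\<iota> k)) (q k)" if "k < d" for k
    using that by (auto simp: P_def Q_def the_inv_into_f_f[OF assms(1)])
  have x: "p k < x (\<iota> k) \<and> x (\<iota> k) < q k" if "k < d" for k
    using assms(3) that by (auto simp: open_box_def coord_map_def)
  show thesis
  proof
    show "x \<in> open_box n P Q"
      unfolding open_box_def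
    proof (intro CollectI conjI allI impI)
      show "x \<in> cart_pow n" using assms(2) by (simp add: open_box_def)
      fix i assume i: "i < n"
      then have ab: "a i < x i" "x i < b i" using assms(2) by (auto simp: open_box_def)
      show "P i < x i" "x i < Q i"
        using ab P x by (cases "i \<in> \<iota> ` {..<d}"; force simp: P_def Q_def the_inv_into_f_f[OF assms(1)])+
    qed
    show "open_box n P Q \<subseteq> open_box n a b"
      by (intro open_box_mono) (auto simp: P_def Q_def)
    show "coord_map d \<iota> y \<in> open_box d p q" if y: "y \<in> open_box n P Q" for y
      unfolding open_box_def
    proof (intro CollectI conjI allI impI coord_map_in_cart_pow)
      fix k assume k: "k < d"
      then have "\<iota> k < n" using assms(4) by (auto simp: image_subset_iff)
      then have "P (\<iota> k) < y (\<iota> k)" "y (\<iota> k) < Q (\<iota> k)" using y by (auto simp: open_box_def)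
      then show "p k < coord_map d \<iota> y k" "coord_map d \<iota> y k < q k"
        using k by (simp_all add: P coord_map_def)
    qed
  qed
qed

text \<open>The value \<open>f x\<close> is not a term of the calculus, so a map can occur in a
  definable predicate only through its graph.\<close>

definition graph_of :: "'b set \<Rightarrow> ('b \<Rightarrow> 'c) \<Rightarrow> 'b \<Rightarrow> 'c \<Rightarrow> bool" where
  "graph_of X f x y \<longleftrightarrow> x \<in> X \<and> y = f x"

lemma append_pt_mem_graph:
  assumes "x \<in> cart_pow m" "y \<in> cart_pow n" "X \<subseteq> cart_pow m" "f ` X \<subseteq> cart_pow n"
  shows "append_pt m n x y \<in> {append_pt m n x (f x) | x. x \<in> X} \<longleftrightarrow> graph_of X f x y"
  unfolding graph_of_def
proof
  assume "append_pt m n x y \<in> {append_pt m n x (f x) | x. x \<in> X}"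
  then obtain x' where x': "x' \<in> X" and eq: "append_pt m n x y = append_pt m n x' (f x')" by blast
  have "x i = x' i" if "i < m" for i
    using fun_cong[OF eq, of i] that by (simp add: append_pt_def)
  then have "x = x'" using assms(1,3) x' by (intro cart_pow_eqI[of x m x']) auto
  moreover have "y i = f x' i" if "i < n" for i
    using fun_cong[OF eq, of "m + i"] that by (simp add: append_pt_def)
  then have "y = f x'" using assms(2,4) x' by (intro cart_pow_eqI[of y n "f x'"]) auto
  ultimately show "x \<in> X \<and> y = f x" using x' by simp
qed blast

section \<open>Fibres over generic points, and the dimension of a union\<close>

context tame_structure
begin

text \<open>The values of each coordinate on \<open>X\<close> form a closed discrete subset of the
  line, and the product of the isolating intervals is the box. The point \<open>p\<close> may lie
  outside \<open>X\<close>, so a thin set is closed too; the frontier argument relies on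
  this.\<close>

lemma thin_isolated:
  assumes X: "definable S n X" and "thin n X" and p: "p \<in> cart_pow n"
  shows "\<exists>a b. p \<in> open_box n a b \<and> X \<inter> open_box n a b \<subseteq> {p}"
proof -
  have "\<exists>b c. i < n \<longrightarrow> b < p i \<and> p i < c \<and> (\<forall>t. b < t \<and> t < c \<and> (\<exists>x\<in>X. x i = t) \<longrightarrow> t = p i)" for i
  proof (cases "i < n")
    case True
    have "dfn S (\<lambda>w. \<exists>x\<in>X. x i = w 0 0)" by (intro dfn_bex_mem[OF X] dfn_intros)
    moreover have "\<not> has_interval (\<lambda>t. \<exists>x\<in>X. x i = t)" using assms(2) True by (simp add: thin_def)
    ultimately obtain b c where "b < p i" "p i < c"
        "\<And>t. b < t \<Longrightarrow> t < c \<Longrightarrow> \<exists>x\<in>X. x i = t \<Longrightarrow> t = p i"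
      using isolated[of "\<lambda>t. \<exists>x\<in>X. x i = t" "p i"] by blast
    then show ?thesis by blast
  qed blast
  then obtain b c where bc: "\<And>i. i < n \<Longrightarrow> b i < p i \<and> p i < c i \<and>
      (\<forall>t. b i < t \<and> t < c i \<and> (\<exists>x\<in>X. x i = t) \<longrightarrow> t = p i)"
    by metis
  have "x = p" if x: "x \<in> X" "x \<in> open_box n b c" for x
  proof (rule cart_pow_eqI[OF _ p])
    show "x \<in> cart_pow n" using x(2) open_box_subset by blast
    show "x i = p i" if "i < n" for i using bc[OF that] x that by (auto simp: open_box_def)
  qed
  moreover have "p \<in> open_box n b c" using bc p by (simp add: open_box_def)
  ultimately show ?thesis by blast
qed

text \<open>Over an open set of \<open>z\<close>, one and the same coordinate \<open>i\<close> takes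
  an interval of values on the fibre, and a common interval can be chosen there. Appending
  \<open>i\<close> to \<iota> then gives a projection that contains a box in dimension
  \<open>Suc e\<close>.\<close>

lemma thick_fibres:
  assumes X: "definable S m X" and \<iota>: "inj_on \<iota> {..<e}" "\<iota> ` {..<e} \<subseteq> {..<m}"
    and int: "has_interior e {z. \<not> thin m (fibre e \<iota> X z)}"
  shows "has_dim m (Suc e) X"
proof -
  define P where "P i z \<longleftrightarrow> has_interval (\<lambda>t. \<exists>x\<in>X. coord_map e \<iota> x = z \<and> x i = t)" for i z
  have P: "dfn S (\<lambda>w. P i (restrict (w 0) {..<e}))" for i
    unfolding P_def by (intro dfn_has_interval dfn_bex_mem[OF X] dfn_conj dfn_coord_eq dfn_intros)
  have "has_interior e {z. \<exists>i\<in>{..<m}. P i z}"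
    using int by (rule has_interior_mono) (auto simp: thin_def bex_fibre P_def)
  then obtain i where i: "i < m" "has_interior e {z. P i z}"
    using has_interior_bex[of "{..<m}" P e] P by auto
  have "\<exists>u v. u < v \<and> has_interior e {z. P i z \<and>
      (\<forall>t. u < t \<and> t < v \<longrightarrow> (\<exists>x\<in>X. coord_map e \<iota> x = z \<and> x i = t))}"
  proof (rule uniform_interval[OF P _ i(2)])
    show "dfn S (\<lambda>w. \<exists>x\<in>X. coord_map e \<iota> x = restrict (w 0) {..<e} \<and> x i = w 1 0)"
      by (intro dfn_bex_mem[OF X] dfn_conj dfn_coord_eq dfn_intros)
  qed (simp add: P_def)
  then obtain u v where uv: "u < v" and "has_interior e {z. P i z \<and>
      (\<forall>t. u < t \<and> t < v \<longrightarrow> (\<exists>x\<in>X. coord_map e \<iota> x = z \<and> x i = t))}" by blast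
  then obtain c d where cd: "\<And>i. i < e \<Longrightarrow> c i < d i" and
      sub: "open_box e c d \<subseteq> {z. P i z \<and>
        (\<forall>t. u < t \<and> t < v \<longrightarrow> (\<exists>x\<in>X. coord_map e \<iota> x = z \<and> x i = t))}"
    unfolding has_interior_def by blast
  have ex: "\<exists>x\<in>X. coord_map e \<iota> x = z \<and> x i = t" if "z \<in> open_box e c d" "u < t" "t < v" for z t
    using sub that by blast
  \<comment> \<open>A coordinate selected by \<iota> is constant on each fibre, so it cannot run
    through an interval.\<close>
  have "i \<notin> \<iota> ` {..<e}"
  proof
    assume "i \<in> \<iota> ` {..<e}"
    then obtain k where k: "k < e" "i = \<iota> k" by auto
    obtain z where z: "z \<in> open_box e c d" using open_box_nonempty[of e c d] cd by metis
    have val: "t = z k" if t: "u < t" "t < v" for t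
    proof -
      obtain x where "coord_map e \<iota> x = z" "x i = t" using ex[OF z t] by blast
      then show ?thesis using k by (auto simp: coord_map_def)
    qed
    obtain s where s: "u < s" "s < v" using dense[OF uv] by blast
    obtain t where t: "u < t" "t < s" using dense[OF s(1)] by blast
    show False using val[OF s] val[of t] t s by auto
  qed
  then have "inj_on (\<iota>(e := i)) {..<Suc e}"
    using \<iota>(1) by (auto simp: inj_on_def less_Suc_eq)
  moreover have "(\<iota>(e := i)) ` {..<Suc e} \<subseteq> {..<m}"
    using \<iota>(2) i(1) by (auto simp: less_Suc_eq image_subset_iff)
  moreover have "has_interior (Suc e) (coord_map (Suc e) (\<iota>(e := i)) ` X)"
  proof (rule has_interior_SucI[OF cd uv])
    fix z t assume zt: "z \<in> open_box e c d" "u < t" "t < v"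
    then obtain x where "x \<in> X" "coord_map e \<iota> x = z" "x i = t" using ex by blast
    then show "z(e := t) \<in> coord_map (Suc e) (\<iota>(e := i)) ` X"
      by (intro image_eqI[of _ _ x]) (simp_all add: coord_map_upd)
  qed
  ultimately show ?thesis unfolding has_dim_def by blast
qed

text \<open>By \<open>thick_fibres\<close>, the points with thick fibre have no interior; removing
  them from a set with interior leaves interior.\<close>

lemma generic_thin:
  assumes X: "definable S m X" "\<not> has_dim m (Suc e) X"
    and \<iota>: "inj_on \<iota> {..<e}" "\<iota> ` {..<e} \<subseteq> {..<m}"
    and A: "dfn S (\<lambda>w. A (restrict (w 0) {..<e}))" "has_interior e {z. A z}"
  shows "has_interior e {z. A z \<and> thin m (fibre e \<iota> X z)}"
proof -
  have "has_interior e {z. (A z \<and> thin m (fibre e \<iota> X z)) \<or> \<not> thin m (fibre e \<iota> X z)}"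
    using A(2) by (rule has_interior_mono) blast
  then have "has_interior e {z. A z \<and> thin m (fibre e \<iota> X z)} \<or>
      has_interior e {z. \<not> thin m (fibre e \<iota> X z)}"
    by (intro has_interior_disj dfn_conj dfn_not A(1) dfn_thin_fibre X(1))
  then show ?thesis using thick_fibres[OF X(1) \<iota>] X(2) by blast
qed

text \<open>Projections commute with unions, so this is \<open>has_interior_disj\<close> for the two
  projected sets.\<close>

lemma has_dim_Un:
  assumes X: "definable S n X" and Y: "definable S n Y"
  shows "has_dim n d (X \<union> Y) \<longleftrightarrow> has_dim n d X \<or> has_dim n d Y"
proof
  assume "has_dim n d (X \<union> Y)"
  then obtain \<iota> where \<iota>: "inj_on \<iota> {..<d}" "\<iota> ` {..<d} \<subseteq> {..<n}"
    and int: "has_interior d (coord_map d \<iota> ` (X \<union> Y))" by (auto simp: has_dim_def)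
  have "{z. z \<in> coord_map d \<iota> ` X \<or> z \<in> coord_map d \<iota> ` Y} = coord_map d \<iota> ` (X \<union> Y)" by blast
  then have "has_interior d (coord_map d \<iota> ` X) \<or> has_interior d (coord_map d \<iota> ` Y)"
    using has_interior_disj[OF dfn_in_image_coord_map[OF X] dfn_in_image_coord_map[OF Y], of d \<iota> \<iota>] int
    by simp
  then show "has_dim n d X \<or> has_dim n d Y" using \<iota> unfolding has_dim_def by blast
qed (auto intro: has_dim_mono)

section \<open>Images\<close>

text \<open>The graph of \<open>R\<close> over \<open>F\<close> is discrete whether or not
  \<open>R\<close> is continuous: a box that isolates a point of \<open>F\<close> contains only one
  point of the graph above it, because \<open>R\<close> is functional. The values of
  \<open>R\<close> are the last coordinates of this discrete set.\<close>

lemma has_interval_graph: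
  assumes F: "definable S m F" "thin m F"
    and R: "dfn S (\<lambda>w. R (restrict (w 0) {..<m}) (w 1 0))"
    and fn: "\<And>x s t. x \<in> F \<Longrightarrow> R x s \<Longrightarrow> R x t \<Longrightarrow> s = t"
  shows "\<not> has_interval (\<lambda>t. \<exists>x\<in>F. R x t)"
proof -
  define E where "E = {v \<in> cart_pow (Suc m). restrict v {..<m} \<in> F \<and> R (restrict v {..<m}) (v m)}"
  have E: "definable S (Suc m) E"
    unfolding E_def
    by (intro dfn_definable dfn_conj dfn_mem[OF F(1)] dfn_rel_tuple_elem[OF R] dfn_intros)
  have "discrete_set (Suc m) E"
    unfolding discrete_set_iff
  proof (intro conjI ballI)
    show "E \<subseteq> cart_pow (Suc m)" by (auto simp: E_def)
    fix v assume v: "v \<in> E"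
    then have vF: "restrict v {..<m} \<in> F" "R (restrict v {..<m}) (v m)" "v \<in> cart_pow (Suc m)"
      by (auto simp: E_def)
    obtain a b where ab: "restrict v {..<m} \<in> open_box m a b"
        "F \<inter> open_box m a b \<subseteq> {restrict v {..<m}}"
      using thin_isolated[OF F restrict_in_cart_pow] by metis
    obtain l u where lu: "l < v m" "v m < u" using lt_ex gt_ex by metis
    have box: "y \<in> open_box (Suc m) (a(m := l)) (b(m := u)) \<longleftrightarrow>
        y \<in> cart_pow (Suc m) \<and> restrict y {..<m} \<in> open_box m a b \<and> l < y m \<and> y m < u" for y
      by (auto simp: open_box_def less_Suc_eq restrict_in_cart_pow)
    have "y = v" if y: "y \<in> E" "y \<in> open_box (Suc m) (a(m := l)) (b(m := u))" for y
    proof -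
      have yF: "restrict y {..<m} \<in> F" "R (restrict y {..<m}) (y m)" "y \<in> cart_pow (Suc m)"
        using y(1) by (auto simp: E_def)
      have eq: "restrict y {..<m} = restrict v {..<m}" using ab(2) yF(1) y(2) unfolding box by blast
      then have "y m = v m" using fn vF(1,2) yF(2) by metis
      moreover have "y i = v i" if "i < m" for i using fun_cong[OF eq, of i] that by simp
      ultimately show ?thesis by (intro cart_pow_eqI[OF yF(3) vF(3)]) (auto simp: less_Suc_eq)
    qed
    moreover have "v \<in> open_box (Suc m) (a(m := l)) (b(m := u))"
      unfolding box using ab(1) vF(3) lu by blast
    ultimately show "\<exists>a b. v \<in> open_box (Suc m) a b \<and> E \<inter> open_box (Suc m) a b \<subseteq> {v}" by blast
  qed
  then have "\<not> has_interval (\<lambda>t. \<exists>v\<in>E. v m = t)"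
    by (rule discrete_coordinate[OF E]) simp
  moreover have "\<exists>v\<in>E. v m = t" if "x \<in> F" "R x t" for x t
  proof -
    have x: "x \<in> cart_pow m" using definable_subset[OF F(1)] that(1) by blast
    then have "restrict (x(m := t)) {..<m} = x" by (intro cart_pow_eqI[OF restrict_in_cart_pow x]) auto
    then have "x(m := t) \<in> E" using that cart_pow_upd[OF x] by (simp add: E_def)
    then show ?thesis by (intro bexI[of _ "x(m := t)"]) simp_all
  qed
  then have "has_interval (\<lambda>t. \<exists>v\<in>E. v m = t)" if "has_interval (\<lambda>t. \<exists>x\<in>F. R x t)"
    by (intro has_interval_mono[OF that]) blast
  ultimately show ?thesis by blast
qed

text \<open>
  Induction on the number \<open>d\<close> of coordinates of the target. Fixing the last coordinate \<open>t\<close>, the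
  induction hypothesis gives a coordinate projection under which the preimage of the slice is fat;
  it can be chosen independently of \<open>t\<close>. Its fibres then map onto a common interval of values
  \<open>t\<close>, hence they are not discrete.
\<close>

lemma has_dim_domain:
  assumes "dfn S (\<lambda>w. R (restrict (w 0) {..<m}) (restrict (w 1) {..<d}))"
    and "\<And>x y y'. x \<in> cart_pow m \<Longrightarrow> y \<in> cart_pow d \<Longrightarrow> y' \<in> cart_pow d \<Longrightarrow>
      R x y \<Longrightarrow> R x y' \<Longrightarrow> y = y'"
    and "has_interior d {y. \<exists>x\<in>cart_pow m. R x y}"
  shows "has_dim m d {x \<in> cart_pow m. \<exists>y\<in>cart_pow d. R x y}"
  using assms
proof (induction d arbitrary: R)
  case 0
  then have "\<exists>x\<in>cart_pow m. R x (\<lambda>_. undefined)" by (simp add: has_interior_0)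
  then show ?case unfolding has_dim_0 cart_pow_0 by blast
next
  case (Suc d)
  note R = dfn_rel2[OF Suc.prems(1)]
  define X where "X = {x \<in> cart_pow m. \<exists>y\<in>cart_pow (Suc d). R x y}"
  have X: "definable S m X" unfolding X_def by (intro dfn_definable dfn_intros R)
  obtain a b where ab: "\<And>i. i < Suc d \<Longrightarrow> a i < b i"
      "open_box (Suc d) a b \<subseteq> {y. \<exists>x\<in>cart_pow m. R x y}"
    using Suc.prems(3) unfolding has_interior_def by blast
  \<comment> \<open>\<open>Q \<iota> t\<close> is the projection along \<iota> of the set of those
    \<open>x\<close> whose value has last coordinate \<open>t\<close>.\<close>
  define Q where "Q \<iota> t z \<longleftrightarrow> (\<exists>x\<in>cart_pow m. \<exists>y\<in>cart_pow d. R x (y(d := t)) \<and> coord_map d \<iota> x = z)"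
    for \<iota> t z
  \<comment> \<open>Index maps are taken extensional to have only finitely many of them, so that one
    can be selected for an interval of values \<open>t\<close>.\<close>
  define I where "I = {\<iota> \<in> {..<d} \<rightarrow>\<^sub>E {..<m}. inj_on \<iota> {..<d}}"
  have "finite I"
    by (rule finite_subset[of _ "{..<d} \<rightarrow>\<^sub>E {..<m}"]) (auto simp: I_def intro: finite_PiE)
  have Q: "dfn S (\<lambda>w. Q \<iota> (s w) (f w))"
    if "atomic_term s" "\<And>i. atomic_term (\<lambda>w. f w i)" "\<And>w. f w \<in> cart_pow d" for \<iota> s f
  proof -
    have "dfn S (\<lambda>w. Q \<iota> (w 1 0) (restrict (w 0) {..<d}))"
      unfolding Q_def by (intro dfn_bex dfn_conj dfn_coord_eq R dfn_intros)
    from dfn_rel_tuple_elem[of S "\<lambda>z t. Q \<iota> t z", OF this that(2,3,1)] show ?thesis .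
  qed
  have proj: "\<exists>\<iota>\<in>I. has_interior d {z. Q \<iota> t z}" if t: "a d < t" "t < b d" for t
  proof -
    have "has_dim m d {x \<in> cart_pow m. \<exists>y\<in>cart_pow d. R x (y(d := t))}"
    proof (rule Suc.IH)
      show "dfn S (\<lambda>w. R (restrict (w 0) {..<m}) ((restrict (w 1) {..<d})(d := t)))"
        by (intro R dfn_intros)
      show "has_interior d {y. \<exists>x\<in>cart_pow m. R x (y(d := t))}"
      proof (rule has_interiorI[of d a b])
        show "open_box d a b \<subseteq> {y. \<exists>x\<in>cart_pow m. R x (y(d := t))}"
          using ab(2) upd_in_open_box[of _ d t a b] t open_box_subset[of d a b] by blast
      qed (simp add: ab(1))
      fix x y y' assume x: "x \<in> cart_pow m" and y: "y \<in> cart_pow d" "y' \<in> cart_pow d"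
        and "R x (y(d := t))" "R x (y'(d := t))"
      then have eq: "y(d := t) = y'(d := t)"
        by (intro Suc.prems(2)[OF x cart_pow_upd[OF y(1)] cart_pow_upd[OF y(2)]])
      show "y = y'"
      proof (rule cart_pow_eqI[OF y])
        show "y i = y' i" if "i < d" for i using fun_cong[OF eq, of i] that by simp
      qed
    qed
    then obtain \<iota> where \<iota>: "inj_on \<iota> {..<d}" "\<iota> ` {..<d} \<subseteq> {..<m}" and
      int: "has_interior d (coord_map d \<iota> ` {x \<in> cart_pow m. \<exists>y\<in>cart_pow d. R x (y(d := t))})"
      unfolding has_dim_def by blast
    define \<kappa> where "\<kappa> = restrict \<iota> {..<d}"
    have eq: "coord_map d \<iota> x = coord_map d \<kappa> x" for x :: "nat \<Rightarrow> 'a"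
      by (auto simp: coord_map_def \<kappa>_def)
    have "\<kappa> \<in> I" using \<iota> by (auto simp: I_def \<kappa>_def)
    moreover have "has_interior d {z. Q \<kappa> t z}"
      using int by (rule has_interior_mono) (auto simp: Q_def eq)
    ultimately show ?thesis by blast
  qed
  \<comment> \<open>The value \<open>t\<close> is written as a point of M^1, since the selection and
    uniformity lemmas speak of open sets in powers of M.\<close>
  have dI: "dfn S (\<lambda>w. has_interior d {z. Q \<iota> (restrict (w 0) {..<1} 0) z})" for \<iota>
    by (intro dfn_has_interior Q dfn_intros)
  have "has_interior 1 {y. \<exists>\<iota>\<in>I. has_interior d {z. Q \<iota> (y 0) z}}"
  proof (subst has_interior_1_iff[of "\<lambda>t. \<exists>\<iota>\<in>I. has_interior d {z. Q \<iota> t z}"], intro exI conjI allI impI)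
    show "a d < b d" by (rule ab(1)) simp
    show "\<exists>\<iota>\<in>I. has_interior d {z. Q \<iota> t z}" if "a d < t \<and> t < b d" for t
      using proj that by blast
  qed
  from has_interior_bex[OF \<open>finite I\<close> dI this]
  obtain \<iota> where \<iota>I: "\<iota> \<in> I" and int: "has_interior 1 {y. has_interior d {z. Q \<iota> (y 0) z}}"
    by (elim bexE)
  have "\<exists>a\<in>cart_pow d. \<exists>b\<in>cart_pow d. (\<forall>i<d. a i < b i) \<and>
    has_interior 1 {y. has_interior d {z. Q \<iota> (y 0) z} \<and> (\<forall>z\<in>open_box d a b. Q \<iota> (y 0) z)}"
  proof (rule uniform_box[OF dI _ int])
    show "dfn S (\<lambda>w. Q \<iota> (restrict (w 0) {..<1} 0) (restrict (w 1) {..<d}))"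
      by (intro Q dfn_intros)
  qed
  then obtain p q where pq: "\<And>i. i < d \<Longrightarrow> p i < q i" and
    "has_interior 1 {y. has_interior d {z. Q \<iota> (y 0) z} \<and> (\<forall>z\<in>open_box d p q. Q \<iota> (y 0) z)}"
    by blast
  then have "\<exists>u v. u < v \<and> (\<forall>t. u < t \<and> t < v \<longrightarrow>
      has_interior d {z. Q \<iota> t z} \<and> (\<forall>z\<in>open_box d p q. Q \<iota> t z))"
    by (subst (asm) has_interior_1_iff[of
          "\<lambda>t. has_interior d {z. Q \<iota> t z} \<and> (\<forall>z\<in>open_box d p q. Q \<iota> t z)"])
  then obtain u v where uv: "u < v" and
    QQ: "\<And>t z. u < t \<Longrightarrow> t < v \<Longrightarrow> z \<in> open_box d p q \<Longrightarrow> Q \<iota> t z" by blast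
  have \<iota>: "inj_on \<iota> {..<d}" "\<iota> ` {..<d} \<subseteq> {..<m}" using \<iota>I by (auto simp: I_def)
  have "\<not> thin m (fibre d \<iota> X z)" if z: "z \<in> open_box d p q" for z
  proof
    assume thin: "thin m (fibre d \<iota> X z)"
    have zc: "z \<in> cart_pow d" using z open_box_subset by blast
    have "\<not> has_interval (\<lambda>t. \<exists>x\<in>fibre d \<iota> X z. \<exists>y\<in>cart_pow d. R x (y(d := t)))"
    proof (rule has_interval_graph[OF definable_fibre[OF X zc] thin])
      show "dfn S (\<lambda>w. \<exists>y\<in>cart_pow d. R (restrict (w 0) {..<m}) (y(d := w 1 0)))"
        by (intro dfn_bex R dfn_intros)
      fix x s t
      assume "x \<in> fibre d \<iota> X z" and ex: "\<exists>y\<in>cart_pow d. R x (y(d := s))" "\<exists>y\<in>cart_pow d. R x (y(d := t))"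
      then have x: "x \<in> cart_pow m" by (simp add: fibre_def X_def)
      obtain y y' where y: "y \<in> cart_pow d" "y' \<in> cart_pow d" "R x (y(d := s))" "R x (y'(d := t))"
        using ex by blast
      have "y(d := s) = y'(d := t)"
        by (rule Suc.prems(2)[OF x cart_pow_upd[OF y(1)] cart_pow_upd[OF y(2)] y(3,4)])
      then show "s = t" by (metis fun_upd_same)
    qed
    moreover have "\<exists>x\<in>fibre d \<iota> X z. \<exists>y\<in>cart_pow d. R x (y(d := t))" if t: "u < t" "t < v" for t
    proof -
      obtain x y where xy: "x \<in> cart_pow m" "y \<in> cart_pow d" "R x (y(d := t))" "coord_map d \<iota> x = z"
        using QQ[OF t z] unfolding Q_def by blast
      then have "x \<in> fibre d \<iota> X z"
        using cart_pow_upd[OF xy(2), of t] unfolding fibre_def X_def by blast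
      then show ?thesis using xy(2,3) by blast
    qed
    ultimately show False using uv unfolding has_interval_def by blast
  qed
  then have "has_interior d {z. \<not> thin m (fibre d \<iota> X z)}"
    using pq by (intro has_interiorI[of d p q]) auto
  then show ?case using thick_fibres[OF X \<iota>] unfolding X_def by blast
qed

lemma dfn_graph:
  assumes "definable_map S m n X f"
    and "\<And>i. atomic_term (\<lambda>w. g w i)" "\<And>w. g w \<in> cart_pow m"
    and "\<And>i. atomic_term (\<lambda>w. h w i)" "\<And>w. h w \<in> cart_pow n"
  shows "dfn S (\<lambda>w. graph_of X f (g w) (h w))"
proof -
  have X: "X \<subseteq> cart_pow m" "f ` X \<subseteq> cart_pow n"
    and G: "definable S (m + n) {append_pt m n x (f x) | x. x \<in> X}"
    using assms(1) definable_subset unfolding definable_map_def by blast+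
  have "dfn S (\<lambda>w. append_pt m n (g w) (h w) \<in> {append_pt m n x (f x) | x. x \<in> X})"
    by (intro dfn_mem[OF G] dfn_intros assms)
  then show ?thesis using append_pt_mem_graph[OF assms(3,5) X] by simp
qed

text \<open>\<open>f\<close> followed by the projection that witnesses the dimension of its image is
  a partial map whose values contain a box in M^d, and \<open>has_dim_domain\<close> applies to its
  graph.\<close>

lemma has_dim_image:
  assumes f: "definable_map S m n X f" and "has_dim n d (f ` X)"
  shows "has_dim m d X"
proof -
  have X: "X \<subseteq> cart_pow m" "f ` X \<subseteq> cart_pow n"
    using f definable_subset unfolding definable_map_def by blast+
  obtain \<iota> where \<iota>: "has_interior d (coord_map d \<iota> ` f ` X)"
    using assms(2) by (auto simp: has_dim_def)
  define R where "R x y \<longleftrightarrow> (\<exists>v\<in>cart_pow n. graph_of X f x v \<and> coord_map d \<iota> v = y)" for x y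
  have R: "R x y \<longleftrightarrow> x \<in> X \<and> coord_map d \<iota> (f x) = y" for x y
    using X(2) by (auto simp: R_def graph_of_def)
  have "has_dim m d {x \<in> cart_pow m. \<exists>y\<in>cart_pow d. R x y}"
  proof (rule has_dim_domain)
    show "dfn S (\<lambda>w. R (restrict (w 0) {..<m}) (restrict (w 1) {..<d}))"
      unfolding R_def by (intro dfn_bex dfn_conj dfn_graph[OF f] dfn_coord_eq dfn_intros)
    show "has_interior d {y. \<exists>x\<in>cart_pow m. R x y}"
      using \<iota> by (rule has_interior_mono) (use X(1) in \<open>auto simp: R\<close>)
  qed (auto simp: R)
  then show ?thesis by (rule has_dim_mono) (auto simp: R)
qed

section \<open>Discontinuities and the frontier\<close>

text \<open>
  In the next two proofs the fibres of the set over a generic point of the projection are discrete,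
  and boxes isolating their points can be chosen uniformly; over a small open set the set is then
  locally the graph of a map.
\<close>

lemma not_has_dim_frontier:
  assumes X: "definable S n X" and no: "\<not> has_dim n (Suc e) X"
  shows "\<not> has_dim n e (frontier_set n X)"
proof
  assume "has_dim n e (frontier_set n X)"
  then obtain \<iota> where \<iota>: "inj_on \<iota> {..<e}" "\<iota> ` {..<e} \<subseteq> {..<n}"
    and int: "has_interior e (coord_map e \<iota> ` frontier_set n X)" by (auto simp: has_dim_def)
  have F: "definable S n (frontier_set n X)"
  proof -
    have "frontier_set n X = {x \<in> cart_pow n. x \<notin> X \<and>
       (\<forall>a\<in>cart_pow n. \<forall>b\<in>cart_pow n. x \<in> open_box n a b \<longrightarrow>
         (\<exists>y\<in>cart_pow n. y \<in> X \<and> y \<in> open_box n a b))}"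
      using in_frontier_set_iff[of _ n X] by blast
    also have "definable S n \<dots>"
      by (intro dfn_definable dfn_conj dfn_not dfn_ball dfn_imp dfn_bex dfn_in_open_box
          dfn_mem[OF X] atomic_intros cart_pow_intros)
    finally show ?thesis .
  qed
  define A where "A z \<longleftrightarrow> z \<in> coord_map e \<iota> ` frontier_set n X \<and> thin n (fibre e \<iota> X z)" for z
  have A: "dfn S (\<lambda>w. A (restrict (w 0) {..<e}))"
    unfolding A_def by (intro dfn_conj dfn_in_image_coord_map[OF F] dfn_thin_fibre[OF X])
  have intA: "has_interior e {z. A z}"
    unfolding A_def
    by (rule generic_thin[OF X no \<iota> dfn_in_image_coord_map[OF F]]) (simp add: int)
  \<comment> \<open>The box contains a frontier point above \<open>z\<close> but no point of
    \<open>X\<close> above \<open>z\<close>. Small boxes around a frontier point \<open>x\<close>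
    have this property when the fibre is thin, because \<open>x\<close> is not in
    \<open>X\<close>.\<close>
  define R where "R z a b \<longleftrightarrow> (\<exists>x\<in>frontier_set n X. coord_map e \<iota> x = z \<and> x \<in> open_box n a b) \<and>
      \<not> (\<exists>y\<in>X. coord_map e \<iota> y = z \<and> y \<in> open_box n a b)" for z a b
  have "\<exists>a\<in>cart_pow n. \<exists>b\<in>cart_pow n. has_interior e {z. A z \<and> R z a b}"
  proof (rule uniform_small_box[OF A _ intA])
    show "dfn S (\<lambda>w. R (restrict (w 0) {..<e}) (restrict (w 1) {..<n}) (restrict (w 2) {..<n}))"
      unfolding R_def
      by (intro dfn_conj dfn_not dfn_bex_mem[OF F] dfn_bex_mem[OF X] dfn_coord_eq dfn_in_open_box
          atomic_intros cart_pow_intros)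
    fix z assume z: "z \<in> cart_pow e" "A z"
    then obtain x where x: "x \<in> frontier_set n X" "coord_map e \<iota> x = z" by (auto simp: A_def)
    then have "x \<in> cart_pow n" "x \<notin> X" by (simp_all add: in_frontier_set_iff)
    then obtain a b where ab: "x \<in> open_box n a b" "fibre e \<iota> X z \<inter> open_box n a b \<subseteq> {x}"
      using thin_isolated[OF definable_fibre[OF X z(1)]] z(2) unfolding A_def by blast
    have "R z a' b'" if "x \<in> open_box n a' b'" "open_box n a' b' \<subseteq> open_box n a b" for a' b'
      using that x ab(2) \<open>x \<notin> X\<close> unfolding R_def fibre_def by blast
    then show "\<exists>p a b. p \<in> open_box n a b \<and>
      (\<forall>a' b'. p \<in> open_box n a' b' \<and> open_box n a' b' \<subseteq> open_box n a b \<longrightarrow> R z a' b')"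
      using ab(1) by blast
  qed
  then obtain a b where "has_interior e {z. A z \<and> R z a b}" by blast
  then obtain p q where pq: "\<And>i. i < e \<Longrightarrow> p i < q i" "open_box e p q \<subseteq> {z. A z \<and> R z a b}"
    unfolding has_interior_def by blast
  obtain z where z: "z \<in> open_box e p q" using open_box_nonempty[of e p q] pq(1) by metis
  then obtain x where x: "x \<in> frontier_set n X" "coord_map e \<iota> x = z" "x \<in> open_box n a b"
    using pq(2) unfolding R_def by blast
  \<comment> \<open>The box around \<open>x\<close> is shrunk until it projects into the open set of
    good \<open>z\<close>. As \<open>x\<close> is in the closure of \<open>X\<close>, it still
    contains a point \<open>y\<close> of \<open>X\<close>, contrary to \<open>R\<close> at the
    projection of \<open>y\<close>.\<close>
  obtain a' b' where ab': "x \<in> open_box n a' b'" "open_box n a' b' \<subseteq> open_box n a b"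
      "\<And>y. y \<in> open_box n a' b' \<Longrightarrow> coord_map e \<iota> y \<in> open_box e p q"
    using pullback_open_box[OF \<iota>(1) x(3), of p q] \<iota>(2) x(2) z by metis
  have "\<exists>y\<in>cart_pow n. y \<in> X \<and> y \<in> open_box n (restrict a' {..<n}) (restrict b' {..<n})"
    using x(1) ab'(1) restrict_in_cart_pow unfolding in_frontier_set_iff
    by (metis open_box_restrict)
  then obtain y where y: "y \<in> X" "y \<in> open_box n a' b'" unfolding open_box_restrict by blast
  then have "R (coord_map e \<iota> y) a b" using ab'(3) pq(2) by blast
  then show False using y ab'(2) unfolding R_def by blast
qed

lemma not_has_dim_discont:
  assumes f: "definable_map S m n X f" and no: "\<not> has_dim m (Suc e) X"
  shows "\<not> has_dim m e (discont m n X f)"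
proof
  define D where "D = discont m n X f"
  have X: "definable S m X" and Xm: "X \<subseteq> cart_pow m" and fX: "f ` X \<subseteq> cart_pow n"
    using f definable_subset unfolding definable_map_def by blast+
  \<comment> \<open>Arbitrarily close to \<open>x\<close> some value of \<open>f\<close> leaves the
    box with corners \<open>c\<close> and \<open>d\<close>. If the box contains \<open>f x\<close>,
    it witnesses the discontinuity at \<open>x\<close>.\<close>
  define bad where "bad x c d \<longleftrightarrow> (\<forall>a\<in>cart_pow m. \<forall>b\<in>cart_pow m. x \<in> open_box m a b \<longrightarrow>
      (\<exists>y\<in>cart_pow m. y \<in> open_box m a b \<and>
        (\<exists>v\<in>cart_pow n. graph_of X f y v \<and> v \<notin> open_box n c d)))" for x c d
  have bad: "dfn S (\<lambda>w. bad (restrict (w 0) {..<m}) (restrict (w 1) {..<n}) (restrict (w 2) {..<n}))"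
    unfolding bad_def
    by (intro dfn_ball dfn_imp dfn_bex dfn_conj dfn_not dfn_graph[OF f] dfn_in_open_box
        atomic_intros cart_pow_intros)
  note bad' = dfn_rel3[OF bad]
  have inD: "x \<in> D \<longleftrightarrow> x \<in> cart_pow m \<and> (\<exists>c\<in>cart_pow n. \<exists>d\<in>cart_pow n.
      (\<exists>v\<in>cart_pow n. graph_of X f x v \<and> v \<in> open_box n c d) \<and> bad x c d)" for x
  proof -
    have graph: "(\<exists>v\<in>cart_pow n. graph_of X f y v \<and> P v) \<longleftrightarrow> y \<in> X \<and> P (f y)" for y P
      using fX unfolding graph_of_def by blast
    have "x \<in> D \<longleftrightarrow> x \<in> X \<and> (\<exists>c\<in>cart_pow n. \<exists>d\<in>cart_pow n. f x \<in> open_box n c d \<and> bad x c d)"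
      unfolding D_def in_discont_iff[OF Xm fX] bad_def graph by (simp only: conj_ac)
    then show ?thesis unfolding graph using Xm by blast
  qed
  have D: "definable S m D"
  proof -
    have "D = {x \<in> cart_pow m. \<exists>c\<in>cart_pow n. \<exists>d\<in>cart_pow n.
      (\<exists>v\<in>cart_pow n. graph_of X f x v \<and> v \<in> open_box n c d) \<and> bad x c d}"
      using inD by blast
    also have "definable S m \<dots>"
      by (intro dfn_definable dfn_bex dfn_conj dfn_graph[OF f] dfn_in_open_box bad'
          atomic_intros cart_pow_intros)
    finally show ?thesis .
  qed
  have DX: "D \<subseteq> X" by (auto simp: D_def discont_def)
  assume "has_dim m e (discont m n X f)"
  then obtain \<iota> where \<iota>: "inj_on \<iota> {..<e}" "\<iota> ` {..<e} \<subseteq> {..<m}"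
    and int: "has_interior e (coord_map e \<iota> ` D)" by (auto simp: has_dim_def D_def)
  define A where "A z \<longleftrightarrow> z \<in> coord_map e \<iota> ` D \<and> thin m (fibre e \<iota> X z)" for z
  have A: "dfn S (\<lambda>w. A (restrict (w 0) {..<e}))"
    unfolding A_def by (intro dfn_conj dfn_in_image_coord_map[OF D] dfn_thin_fibre[OF X])
  have intA: "has_interior e {z. A z}"
    unfolding A_def
    by (rule generic_thin[OF X no \<iota> dfn_in_image_coord_map[OF D]]) (simp add: int)
  \<comment> \<open>The box contains exactly one point of \<open>X\<close> above \<open>z\<close>,
    and this point is a discontinuity; over an open set of such \<open>z\<close> the part of
    \<open>X\<close> in the box is a graph.\<close>
  define R where "R z a b \<longleftrightarrow> (\<exists>x\<in>D. coord_map e \<iota> x = z \<and> x \<in> open_box m a b \<and>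
      \<not> (\<exists>y\<in>X. (coord_map e \<iota> y = z \<and> y \<in> open_box m a b) \<and> \<not> y = x))" for z a b
  have R: "dfn S (\<lambda>w. R (restrict (w 0) {..<e}) (restrict (w 1) {..<m}) (restrict (w 2) {..<m}))"
    unfolding R_def
    by (intro dfn_conj dfn_not dfn_bex_mem[OF D] dfn_bex_mem[OF X] dfn_coord_eq
        dfn_tuple_eq[where n = m] dfn_in_open_box
        atomic_intros cart_pow_intros)
  have "\<exists>a\<in>cart_pow m. \<exists>b\<in>cart_pow m. has_interior e {z. A z \<and> R z a b}"
  proof (rule uniform_small_box[OF A R intA])
    fix z assume z: "z \<in> cart_pow e" "A z"
    then obtain x where x: "x \<in> D" "coord_map e \<iota> x = z" by (auto simp: A_def)
    then have "x \<in> cart_pow m" using DX Xm by blast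
    then obtain a b where ab: "x \<in> open_box m a b" "fibre e \<iota> X z \<inter> open_box m a b \<subseteq> {x}"
      using thin_isolated[OF definable_fibre[OF X z(1)]] z(2) unfolding A_def by blast
    have "R z a' b'" if "x \<in> open_box m a' b'" "open_box m a' b' \<subseteq> open_box m a b" for a' b'
      using that x ab(2) unfolding R_def fibre_def by blast
    then show "\<exists>p a b. p \<in> open_box m a b \<and>
      (\<forall>a' b'. p \<in> open_box m a' b' \<and> open_box m a' b' \<subseteq> open_box m a b \<longrightarrow> R z a' b')"
      using ab(1) by blast
  qed
  then obtain a b where ab: "a \<in> cart_pow m" "b \<in> cart_pow m"
    and intR: "has_interior e {z. A z \<and> R z a b}" by blast
  \<comment> \<open>One target box is to witness the discontinuity above every \<open>z\<close> of
    an open set. It can be made uniform because a smaller box around the value is again a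
    witness.\<close>
  define Q where "Q z c d \<longleftrightarrow> (\<exists>x\<in>D. (coord_map e \<iota> x = z \<and> x \<in> open_box m a b) \<and>
      (\<exists>v\<in>cart_pow n. graph_of X f x v \<and> v \<in> open_box n c d) \<and> bad x c d)" for z c d
  have "\<exists>c\<in>cart_pow n. \<exists>d\<in>cart_pow n. has_interior e {z. (A z \<and> R z a b) \<and> Q z c d}"
  proof (rule uniform_small_box[OF _ _ intR])
    show "dfn S (\<lambda>w. A (restrict (w 0) {..<e}) \<and> R (restrict (w 0) {..<e}) a b)"
      by (intro dfn_conj A dfn_rel3[OF R] atomic_intros cart_pow_intros ab)
    show "dfn S (\<lambda>w. Q (restrict (w 0) {..<e}) (restrict (w 1) {..<n}) (restrict (w 2) {..<n}))"
      unfolding Q_def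
      by (intro dfn_bex_mem[OF D] dfn_bex dfn_conj dfn_coord_eq dfn_graph[OF f] dfn_in_open_box bad'
          atomic_intros cart_pow_intros)
    fix z assume "A z \<and> R z a b"
    then obtain x where x: "x \<in> D" "coord_map e \<iota> x = z" "x \<in> open_box m a b"
      unfolding R_def by blast
    obtain c d where cd: "x \<in> X" "f x \<in> open_box n c d" "bad x c d"
      using x(1) unfolding inD graph_of_def by blast
    have "Q z c' d'" if "f x \<in> open_box n c' d'" "open_box n c' d' \<subseteq> open_box n c d" for c' d'
    proof -
      have "bad x c' d'" using cd(3) that(2) unfolding bad_def by blast
      moreover have "f x \<in> cart_pow n" using that(1) open_box_subset by blast
      ultimately show ?thesis using x cd(1) that(1) unfolding Q_def graph_of_def by blast
    qed
    then show "\<exists>p c d. p \<in> open_box n c d \<and>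
      (\<forall>c' d'. p \<in> open_box n c' d' \<and> open_box n c' d' \<subseteq> open_box n c d \<longrightarrow> Q z c' d')"
      using cd(2) by blast
  qed
  then obtain c d where "has_interior e {z. (A z \<and> R z a b) \<and> Q z c d}" by blast
  then obtain p q where pq: "\<And>i. i < e \<Longrightarrow> p i < q i"
      "open_box e p q \<subseteq> {z. (A z \<and> R z a b) \<and> Q z c d}"
    unfolding has_interior_def by blast
  obtain z where z: "z \<in> open_box e p q" using open_box_nonempty[of e p q] pq(1) by metis
  then obtain x where x: "coord_map e \<iota> x = z" "x \<in> open_box m a b" "bad x c d"
    using pq(2) unfolding Q_def by blast
  \<comment> \<open>Near \<open>x\<close> there is a point \<open>y\<close> of \<open>X\<close>
    whose value lies outside the target box. But \<open>y\<close> is the only point of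
    \<open>X\<close> above its projection in the source box, and \<open>Q\<close> puts the value at
    that point inside the target box.\<close>
  obtain a' b' where ab': "x \<in> open_box m a' b'" "open_box m a' b' \<subseteq> open_box m a b"
      "\<And>y. y \<in> open_box m a' b' \<Longrightarrow> coord_map e \<iota> y \<in> open_box e p q"
    using pullback_open_box[OF \<iota>(1) x(2), of p q] \<iota>(2) x(1) z by metis
  have "\<exists>y\<in>cart_pow m. y \<in> open_box m (restrict a' {..<m}) (restrict b' {..<m}) \<and>
        (\<exists>v\<in>cart_pow n. graph_of X f y v \<and> v \<notin> open_box n c d)"
    using x(3) ab'(1) restrict_in_cart_pow unfolding bad_def by (metis open_box_restrict)
  then obtain y where y: "y \<in> X" "y \<in> open_box m a' b'" "f y \<notin> open_box n c d"
    unfolding open_box_restrict graph_of_def by blast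
  then have RQ: "R (coord_map e \<iota> y) a b" "Q (coord_map e \<iota> y) c d" using ab'(3) pq(2) by blast+
  obtain x1 where x1: "\<And>y'. y' \<in> X \<Longrightarrow> coord_map e \<iota> y' = coord_map e \<iota> y \<Longrightarrow>
      y' \<in> open_box m a b \<Longrightarrow> y' = x1"
    using RQ(1) unfolding R_def by blast
  obtain x2 where x2: "x2 \<in> X" "coord_map e \<iota> x2 = coord_map e \<iota> y" "x2 \<in> open_box m a b"
      "f x2 \<in> open_box n c d"
    using RQ(2) unfolding Q_def graph_of_def by blast
  have "x2 = y" using x1[OF x2(1,2,3)] x1[OF y(1) refl] y(2) ab'(2) by blast
  then show False using x2(4) y(3) by simp
qed

end

text \<open>In the two strict inequalities \<open>X\<close> is nonempty: for empty \<open>X\<close>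
  both sides are \<open>Minf\<close>, which is not below itself in the order of
  \<open>extended\<close>. Each assertion follows from the corresponding implication between
  thresholds, except the one on products, which also needs the arithmetic of
  \<open>extended\<close>.\<close>

theorem theorem3p8:
  fixes S :: "('f, 'r, 'a::{unbounded_dense_linorder, linorder_topology}) fo_struct"
  assumes "definably_complete S"
    and "locally_o_minimal S"
    and "property_a S"
  shows "(\<forall>n X Y. definable S n X \<and> definable S n Y \<and> X \<subseteq> Y \<longrightarrow> def_dim n X \<le> def_dim n Y)
    \<and> (\<forall>n \<sigma> X. \<sigma> permutes {..<n} \<and> definable S n X \<longrightarrow>
         def_dim n X = def_dim n (coord_map n \<sigma> ` X))
    \<and> (\<forall>m n X Y. definable S m X \<and> definable S n Y \<longrightarrow>
         def_dim (m + n) (set_prod m n X Y) = def_dim m X + def_dim n Y)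
    \<and> (\<forall>n X Y. definable S n X \<and> definable S n Y \<longrightarrow>
         def_dim n (X \<union> Y) = max (def_dim n X) (def_dim n Y))
    \<and> (\<forall>m n X f. definable_map S m n X f \<longrightarrow> def_dim n (f ` X) \<le> def_dim m X)
    \<and> (\<forall>m n X f. definable_map S m n X f \<and> X \<noteq> {} \<longrightarrow>
         def_dim m (discont m n X f) < def_dim m X)
    \<and> (\<forall>n X. definable S n X \<and> X \<noteq> {} \<longrightarrow> def_dim n (frontier_set n X) < def_dim n X)"
proof (intro conjI allI impI; (elim conjE)?)
  interpret tame_structure S by (rule tame_structure.intro[OF assms])
  show "def_dim n X \<le> def_dim n Y" if "X \<subseteq> Y" for n and X Y :: "(nat \<Rightarrow> 'a) set"
    using that by (intro def_dim_leI) (rule has_dim_mono)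
  show "def_dim n X = def_dim n (coord_map n \<sigma> ` X)" if "\<sigma> permutes {..<n}"
    for n \<sigma> and X :: "(nat \<Rightarrow> 'a) set"
    by (rule def_dim_eqI) (rule has_dim_permute[OF that, symmetric])
  show "def_dim (m + n) (set_prod m n X Y) = def_dim m X + def_dim n Y"
    for m n and X Y :: "(nat \<Rightarrow> 'a) set"
    by (rule def_dim_set_prod)
  show "def_dim n (X \<union> Y) = max (def_dim n X) (def_dim n Y)"
    if XY: "definable S n X" "definable S n Y" for n X Y
  proof (rule order_antisym)
    show "max (def_dim n X) (def_dim n Y) \<le> def_dim n (X \<union> Y)"
      by (intro max.boundedI def_dim_leI) (auto intro: has_dim_mono)
    show "def_dim n (X \<union> Y) \<le> max (def_dim n X) (def_dim n Y)"
    proof (cases rule: def_dim_cases[of "X \<union> Y" n])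
      case (2 d)
      then have "has_dim n d (X \<union> Y)" using Fin_le_def_dim[of d n "X \<union> Y"] by simp
      then show ?thesis
        unfolding 2(2) le_max_iff_disj Fin_le_def_dim by (simp add: has_dim_Un[OF XY])
    qed simp
  qed
  show "def_dim n (f ` X) \<le> def_dim m X" if "definable_map S m n X f" for m n X f
    by (rule def_dim_leI) (rule has_dim_image[OF that])
  show "def_dim m (discont m n X f) < def_dim m X" if "definable_map S m n X f" "X \<noteq> {}" for m n X f
    by (rule def_dim_lessI[OF that(2)]) (rule not_has_dim_discont[OF that(1)])
  show "def_dim n (frontier_set n X) < def_dim n X" if "definable S n X" "X \<noteq> {}" for n X
    by (rule def_dim_lessI[OF that(2)]) (rule not_has_dim_frontier[OF that(1)])
qed

end
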